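(* For all positive integers $k,N$, the reduced level-rank map with $n=1$, $$\bar\tau:\mathcal H_{kN}(k,1)_{\mathfrak{sl}_k[z]}\longrightarrow\mathcal H_N(1,k),$$ is an isomorphism.
   Context: For positive integers $M,p,\ell$ let $\mathbb C[X,A]$ be the polynomial ring in the entries of an $M\times M$ matrix $X$ and a $p\times M$ matrix $A$, and $\mathcal H_M(p,\ell)=\{f: f(gXg^{-1},Ag^{-1})=\det(g)^{-\ell}f(X,A)\ \forall g\in GL_M(\mathbb C)\}$. $\mathfrak{gl}_p[z]$ acts on it by $E^a_b\otimes z^m\mapsto\sum_{i,j}A^a_i(X^m)^i_j\,\partial/\partial A^b_j$. $\mathcal H_{kN}(k,1)_{\mathfrak{sl}_k[z]}=\mathcal H_{kN}(k,1)/\mathfrak{sl}_k[z]\cdot\mathcal H_{kN}(k,1)$, with $\mathfrak{sl}_k[z]\subset\mathfrak{gl}_k[z]$. The level-rank map $\tau:\mathcal H_{kN}(k,1)\to\mathcal H_N(1,k)$ is $\tau(f)(X,A)=f(X\otimes1_k,A\otimes1_k)$ (Kronecker products; $X$ is $N\times N$, $A$ is $1\times N$). It annihilates $\mathfrak{sl}_k[z]\cdot\mathcal H_{kN}(k,1)$, and $\bar\tau$ is the induced map on coinvariants. *)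

theory Defs
  imports "Jordan_Normal_Form.VS_Connect" "HOL-Library.Poly_Mapping"
    "HOL-Algebra.AbelCoset"
begin

section \<open>Polynomials in the entries of two matrices\<close>

text \<open>
  A monomial is a finitely supported exponent vector, and a polynomial is a finitely supported
  family of coefficients indexed by monomials; the ring structure is the convolution structure of
  \<^theory>\<open>HOL-Library.Poly_Mapping\<close>.  Matrix indices start at 0.
\<close>

datatype entry = XE nat nat | AE nat nat

type_synonym mpoly = "(entry \<Rightarrow>\<^sub>0 nat) \<Rightarrow>\<^sub>0 complex"

definition Const :: "complex \<Rightarrow> mpoly" where
  "Const c = Poly_Mapping.single 0 c"

definition Var :: "entry \<Rightarrow> mpoly" where
  "Var v = Poly_Mapping.single (Poly_Mapping.single v 1) 1"

definition entries :: "nat \<Rightarrow> nat \<Rightarrow> entry set" where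
  "entries M p = {XE i j | i j. i < M \<and> j < M} \<union> {AE a i | a i. a < p \<and> i < M}"

definition poly_ring :: "nat \<Rightarrow> nat \<Rightarrow> mpoly set" where
  "poly_ring M p = {f. \<forall>m \<in> Poly_Mapping.keys f. Poly_Mapping.keys m \<subseteq> entries M p}"

definition subst :: "(entry \<Rightarrow> mpoly) \<Rightarrow> mpoly \<Rightarrow> mpoly" where
  "subst \<sigma> f = (\<Sum>m \<in> Poly_Mapping.keys f.
     Const (Poly_Mapping.lookup f m) *
     (\<Prod>v \<in> Poly_Mapping.keys m. \<sigma> v ^ Poly_Mapping.lookup m v))"

text \<open>The value \<open>f(X', A')\<close> at two matrices over the polynomial ring.\<close>

definition eval_at :: "mpoly \<Rightarrow> mpoly mat \<Rightarrow> mpoly mat \<Rightarrow> mpoly" where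
  "eval_at f X' A' =
     subst (\<lambda>v. case v of XE i j \<Rightarrow> X' $$ (i, j) | AE a i \<Rightarrow> A' $$ (a, i)) f"

text \<open>
  The truncated subtraction of exponents is harmless: if \<open>v\<close> does not occur in \<open>m\<close>,
  the new coefficient is \<open>0\<close>.
\<close>

definition partial_deriv :: "entry \<Rightarrow> mpoly \<Rightarrow> mpoly" where
  "partial_deriv v f = (\<Sum>m \<in> Poly_Mapping.keys f.
     Poly_Mapping.single (m - Poly_Mapping.single v 1)
       (of_nat (Poly_Mapping.lookup m v) * Poly_Mapping.lookup f m))"

definition X_mat :: "nat \<Rightarrow> mpoly mat" where
  "X_mat M = mat M M (\<lambda>(i, j). Var (XE i j))"

definition A_mat :: "nat \<Rightarrow> nat \<Rightarrow> mpoly mat" where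
  "A_mat p M = mat p M (\<lambda>(a, i). Var (AE a i))"


section \<open>The spaces of semi-invariants\<close>

text \<open>In the following set, \<open>h\<close> is the inverse of \<open>g\<close>.\<close>

definition H_set :: "nat \<Rightarrow> nat \<Rightarrow> nat \<Rightarrow> mpoly set" where
  "H_set M p l = {f \<in> poly_ring M p.
     \<forall>g \<in> carrier_mat M M. \<forall>h \<in> carrier_mat M M. inverts_mat g h \<and> inverts_mat h g \<longrightarrow>
       eval_at f (map_mat Const g * X_mat M * map_mat Const h) (A_mat p M * map_mat Const h) =
       Const (det g powi (- int l)) * f}"

definition H_space :: "nat \<Rightarrow> nat \<Rightarrow> nat \<Rightarrow> (complex, mpoly) module" where
  "H_space M p l = \<lparr>carrier = H_set M p l, mult = undefined, one = undefined,
     zero = 0, add = (+), smult = (\<lambda>c f. Const c * f)\<rparr>"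


section \<open>The current algebra action and coinvariants\<close>

text \<open>The action of \<open>E\<^sup>a\<^sub>b \<otimes> z\<^sup>m\<close>.\<close>

definition elem_act :: "nat \<Rightarrow> nat \<Rightarrow> nat \<Rightarrow> nat \<Rightarrow> mpoly \<Rightarrow> mpoly" where
  "elem_act M a b m f = (\<Sum>i<M. \<Sum>j<M.
     Var (AE a i) * (X_mat M ^\<^sub>m m) $$ (i, j) * partial_deriv (AE b j) f)"

text \<open>
  An element of \<open>gl\<^sub>p[z] = gl\<^sub>p \<otimes> \<complex>[z]\<close> is a \<open>p \<times> p\<close> matrix over \<open>\<complex>[z]\<close>; the elementary
  matrix \<open>E\<^sup>a\<^sub>b\<close> has its nonzero entry in row \<open>a\<close> and column \<open>b\<close>.
\<close>

definition gl_act :: "nat \<Rightarrow> nat \<Rightarrow> complex poly mat \<Rightarrow> mpoly \<Rightarrow> mpoly" where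
  "gl_act M p Y f = (\<Sum>a<p. \<Sum>b<p. \<Sum>m\<le>Polynomial.degree (Y $$ (a, b)).
     Const (poly.coeff (Y $$ (a, b)) m) * elem_act M a b m f)"

definition sl_current :: "nat \<Rightarrow> complex poly mat set" where
  "sl_current p = {Y \<in> carrier_mat p p. (\<Sum>a<p. Y $$ (a, a)) = 0}"

definition sl_image :: "nat \<Rightarrow> nat \<Rightarrow> nat \<Rightarrow> mpoly set" where
  "sl_image M p l = LinearCombinations.module.span class_ring (H_space M p l)
     {gl_act M p Y f | Y f. Y \<in> sl_current p \<and> f \<in> H_set M p l}"

text \<open>
  The quotient of a vector space by a subspace.  The \<open>U +>\<close> in the scalar multiplication
  matters only for the scalar \<open>0\<close>.
\<close>

definition quotient_space :: "('a, 'b) module \<Rightarrow> 'b set \<Rightarrow> ('a, 'b set) module" where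
  "quotient_space V U = \<lparr>carrier = a_rcosets\<^bsub>V\<^esub> U, mult = undefined, one = undefined,
     zero = U, add = set_add V, smult = (\<lambda>c C. \<Union>x\<in>C. U +>\<^bsub>V\<^esub> (c \<odot>\<^bsub>V\<^esub> x))\<rparr>"

definition coinvariants :: "nat \<Rightarrow> nat \<Rightarrow> (complex, mpoly set) module" where
  "coinvariants k N = quotient_space (H_space (k * N) k 1) (sl_image (k * N) k 1)"


section \<open>The level-rank map\<close>

definition kronecker :: "'a::semiring_1 mat \<Rightarrow> 'a mat \<Rightarrow> 'a mat" where
  "kronecker A B = mat (dim_row A * dim_row B) (dim_col A * dim_col B)
     (\<lambda>(i, j). A $$ (i div dim_row B, j div dim_col B) * B $$ (i mod dim_row B, j mod dim_col B))"

definition level_rank :: "nat \<Rightarrow> nat \<Rightarrow> mpoly \<Rightarrow> mpoly" where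
  "level_rank k N f = eval_at f (kronecker (X_mat N) (1\<^sub>m k)) (kronecker (A_mat 1 N) (1\<^sub>m k))"

text \<open>
  The induced map on cosets: the level-rank map is constant on a coset because it annihilates
  \<open>sl_image\<close>.
\<close>

definition reduced_level_rank :: "nat \<Rightarrow> nat \<Rightarrow> mpoly set \<Rightarrow> mpoly" where
  "reduced_level_rank k N C = the_elem (level_rank k N ` C)"

definition vs_isomorphism ::
  "'a ring \<Rightarrow> ('a, 'b) module \<Rightarrow> ('a, 'c) module \<Rightarrow> ('b \<Rightarrow> 'c) \<Rightarrow> bool" where
  "vs_isomorphism K V W T \<longleftrightarrow> linear_map K V W T \<and> bij_betw T (carrier V) (carrier W)"

end

theory Submission
  imports Defs "Jordan_Normal_Form.Schur_Decomposition"
    "HOL-Computational_Algebra.Formal_Power_Series"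
begin

text \<open>
  Diagonalizable matrices are dense, so a semi-invariant \<open>f(X, A)\<close> is determined by its values at
  \<open>X = diag(x\<^sub>1, ..., x\<^sub>M)\<close>.  For weight 1 the torus makes these values linear in every column of \<open>A\<close>
  and the permutation matrices make them alternating; hence \<open>H\<^sub>M(k, 1)\<close> is spanned by the determinants
  with rows \<open>A\<^sub>c X\<^sup>\<mu>\<close> and is \<open>\<Lambda>\<^sup>M(\<complex>\<^sup>k[z])\<close> with its natural action of \<open>gl\<^sub>k[z]\<close>.

  For injectivity, the Cartan part of \<open>sl\<^sub>k[z]\<close> suffices.  Its constant elements remove all weights
  but 0, where the space is a tensor product of \<open>k\<close> copies of the alternating polynomials in \<open>N\<close>
  variables; \<open>(E\<^sup>a\<^sub>a - E\<^sup>b\<^sub>b) \<otimes> z\<^sup>m\<close> identifies multiplication by the power sum of degree \<open>m\<close> in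
  copies \<open>a\<close> and \<open>b\<close>.  As power sums generate the symmetric polynomials, all symmetric factors can be
  moved to the last copy, and what remains is detected by the level-rank map, which on diagonal
  matrices multiplies the \<open>k\<close> alternating polynomials.  For surjectivity, an element of \<open>H\<^sub>N(1, k)\<close> is
  the \<open>k\<close>-th power of the Vandermonde determinant times a symmetric polynomial, its value at the
  companion matrix.
\<close>

section \<open>Polynomials as functions\<close>

text \<open>Most identities of polynomials are checked on complex values: there a matrix can be
  diagonalized, and a current acts as the derivative along a vector field, so equivariance can
  simply be differentiated. The step that needs an idea is the description of the coinvariants.
  Every alternating polynomial is the Vandermonde determinant times a symmetric one, so one would
  like to divide each of the first k - 1 factors by the Vandermonde determinant and multiply the
  last factor by the quotients. The currents offer multiplication by symmetric polynomials but no
  division. The division is therefore an induction: the Pieri rule expresses an alternant with a gap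
  in its exponents by an elementary symmetric polynomial times a lower alternant, up to smaller
  terms. After that all information sits in the last factor, and as the Vandermonde determinant does
  not vanish at distinct points, nothing is lost when the k factors are multiplied. The same picture
  dictates the preimages for surjectivity: Vandermonde determinants in k - 1 factors and the
  remaining alternating polynomial in the last one.\<close>

definition monom_at :: "(entry \<Rightarrow> complex) \<Rightarrow> (entry \<Rightarrow>\<^sub>0 nat) \<Rightarrow> complex" where
  "monom_at w m = (\<Prod>v\<in>Poly_Mapping.keys m. w v ^ Poly_Mapping.lookup m v)"

definition ev :: "mpoly \<Rightarrow> (entry \<Rightarrow> complex) \<Rightarrow> complex" where
  "ev f w = (\<Sum>m\<in>Poly_Mapping.keys f. Poly_Mapping.lookup f m * monom_at w m)"

lemma monom_at_superset:
  assumes "finite S" "Poly_Mapping.keys m \<subseteq> S"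
  shows "monom_at w m = (\<Prod>v\<in>S. w v ^ Poly_Mapping.lookup m v)"
  unfolding monom_at_def using assms
  by (intro prod.mono_neutral_left) (auto simp: in_keys_iff)

lemma monom_at_add: "monom_at w (m + n) = monom_at w m * monom_at w n"
proof -
  let ?S = "Poly_Mapping.keys m \<union> Poly_Mapping.keys n"
  have "Poly_Mapping.keys (m + n) \<subseteq> ?S" by (rule Poly_Mapping.keys_add)
  then show ?thesis
    by (simp add: monom_at_superset[of ?S] lookup_add power_add prod.distrib)
qed

lemma monom_at_0 [simp]: "monom_at w 0 = 1"
  by (simp add: monom_at_def)

lemma monom_at_single [simp]: "monom_at w (Poly_Mapping.single v n) = w v ^ n"
  by (simp add: monom_at_def)

lemma ev_superset:
  assumes "finite S" "Poly_Mapping.keys f \<subseteq> S"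
  shows "ev f w = (\<Sum>m\<in>S. Poly_Mapping.lookup f m * monom_at w m)"
  unfolding ev_def using assms by (intro sum.mono_neutral_left) (auto simp: in_keys_iff)

lemma ev_add [simp]: "ev (f + g) w = ev f w + ev g w"
proof -
  let ?S = "Poly_Mapping.keys f \<union> Poly_Mapping.keys g"
  have "Poly_Mapping.keys (f + g) \<subseteq> ?S" by (rule Poly_Mapping.keys_add)
  then show ?thesis
    by (simp add: ev_superset[of ?S] lookup_add distrib_right sum.distrib)
qed

lemma ev_0 [simp]: "ev 0 w = 0"
  by (simp add: ev_def)

lemma ev_single [simp]: "ev (Poly_Mapping.single m c) w = c * monom_at w m"
  by (simp add: ev_def)

lemma ev_sum [simp]: "ev (sum f S) w = (\<Sum>i\<in>S. ev (f i) w)"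
  by (induction S rule: infinite_finite_induct) auto

lemma ev_uminus [simp]: "ev (- f) w = - ev f w"
  using ev_add[of f "- f" w] by (simp add: eq_neg_iff_add_eq_0 add.commute)

lemma ev_diff [simp]: "ev (f - g) w = ev f w - ev g w"
  using ev_add[of f "- g" w] by simp

lemma mpoly_eq_sum_single:
  fixes f :: mpoly
  shows "f = (\<Sum>m\<in>Poly_Mapping.keys f. Poly_Mapping.single m (Poly_Mapping.lookup f m))"
  by (rule poly_mapping_eqI) (auto simp: lookup_sum lookup_single when_def in_keys_iff)

lemma ev_mult [simp]: "ev (f * g) w = ev f w * ev g w"
proof -
  have "f * g = (\<Sum>m\<in>Poly_Mapping.keys f. \<Sum>n\<in>Poly_Mapping.keys g.
      Poly_Mapping.single (m + n) (Poly_Mapping.lookup f m * Poly_Mapping.lookup g n))"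
    by (subst (1) mpoly_eq_sum_single[of f], subst (1) mpoly_eq_sum_single[of g])
      (simp add: sum_product mult_single)
  then have "ev (f * g) w = (\<Sum>m\<in>Poly_Mapping.keys f. \<Sum>n\<in>Poly_Mapping.keys g.
      Poly_Mapping.lookup f m * Poly_Mapping.lookup g n * monom_at w (m + n))"
    by (simp only: ev_sum ev_single)
  then show ?thesis
    by (simp add: monom_at_add ev_def sum_product mult_ac)
qed

lemma ev_Const [simp]: "ev (Const c) w = c"
  by (simp add: Const_def)

lemma ev_Var [simp]: "ev (Var v) w = w v"
  by (simp add: Var_def)

lemma Const_0: "Const 0 = 0"
  by (simp add: Const_def)

lemma Const_1: "Const 1 = 1"
  by (simp add: Const_def)

lemma ev_1 [simp]: "ev 1 w = 1"
  using ev_Const[of 1 w] by (simp only: Const_1)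

lemma ev_power [simp]: "ev (f ^ n) w = ev f w ^ n"
  by (induction n) auto

lemma ev_prod [simp]: "ev (prod f S) w = (\<Prod>i\<in>S. ev (f i) w)"
  by (induction S rule: infinite_finite_induct) auto

lemma ev_subst: "ev (subst \<sigma> f) w = ev f (\<lambda>v. ev (\<sigma> v) w)"
  by (simp add: subst_def ev_def[of f] monom_at_def)

lemma monom_at_cong:
  "(\<And>v. v \<in> Poly_Mapping.keys m \<Longrightarrow> w v = w' v) \<Longrightarrow> monom_at w m = monom_at w' m"
  by (simp add: monom_at_def)

lemma sum_powers_eq_0_imp:
  fixes c :: "nat \<Rightarrow> complex"
  assumes "finite S" "infinite {t. (\<Sum>d\<in>S. c d * t ^ d) = 0}" "d \<in> S"
  shows "c d = 0"
proof -
  let ?p = "\<Sum>d\<in>S. Polynomial.monom (c d) d"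
  have "{t. (\<Sum>d\<in>S. c d * t ^ d) = 0} = {t. poly ?p t = 0}"
    by (simp add: poly_sum poly_monom)
  with assms(2) have "infinite {t. poly ?p t = 0}" by simp
  then have "?p = 0" using poly_roots_finite by blast
  then have "poly.coeff ?p d = 0" by simp
  then show ?thesis using assms by (simp add: coeff_sum if_distrib cong: if_cong)
qed

text \<open>
  Scaling one variable separates a polynomial function into its components of fixed degree in
  that variable; this splits any two distinct monomials apart.
\<close>

lemma ev_eq_0_imp:
  assumes "\<And>w. ev f w = 0"
  shows "f = 0"
proof (rule ccontr)
  assume "f \<noteq> 0"
  with assms show False
  proof (induction "card (Poly_Mapping.keys f)" arbitrary: f rule: less_induct)
    case less
    let ?K = "Poly_Mapping.keys f"
    from less.prems have ne: "?K \<noteq> {}" by simp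
    then obtain m where m: "m \<in> ?K" by blast
    show False
    proof (cases "?K = {m}")
      case True
      then have "ev f (\<lambda>_. 1) = Poly_Mapping.lookup f m"
        by (simp add: ev_def monom_at_def)
      with less.prems m show False by (simp add: in_keys_iff)
    next
      case False
      with m obtain n where n: "n \<in> ?K" "n \<noteq> m" by blast
      then obtain v where v: "Poly_Mapping.lookup m v \<noteq> Poly_Mapping.lookup n v"
        by (metis poly_mapping_eqI)
      define deg where "deg = (\<lambda>q::entry \<Rightarrow>\<^sub>0 nat. Poly_Mapping.lookup q v)"
      define comp where "comp = (\<lambda>d. \<Sum>q\<in>{q\<in>?K. deg q = d}.
          Poly_Mapping.single q (Poly_Mapping.lookup f q))"
      have lookup_comp: "Poly_Mapping.lookup (comp d) q
          = (if deg q = d then Poly_Mapping.lookup f q else 0)" for d q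
        by (auto simp: comp_def lookup_sum lookup_single when_def in_keys_iff)
      have keys_comp: "Poly_Mapping.keys (comp d) = {q\<in>?K. deg q = d}" for d
        by (auto simp: in_keys_iff lookup_comp split: if_splits)
      have "ev (comp (deg m)) w = 0" for w
      proof -
        have scale: "monom_at (w(v := t * w v)) q = t ^ deg q * monom_at w q" for t q
        proof -
          let ?S = "insert v (Poly_Mapping.keys q)"
          have *: "(\<Prod>u\<in>Poly_Mapping.keys q - {v}. (w(v := t * w v)) u ^ Poly_Mapping.lookup q u)
            = (\<Prod>u\<in>Poly_Mapping.keys q - {v}. w u ^ Poly_Mapping.lookup q u)"
            by (rule prod.cong) auto
          have split: "monom_at x q = x v ^ deg q *
              (\<Prod>u\<in>Poly_Mapping.keys q - {v}. x u ^ Poly_Mapping.lookup q u)" for x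
            by (subst monom_at_superset[of ?S]) (auto simp: prod.insert_remove deg_def)
          show ?thesis unfolding split * by (simp add: power_mult_distrib)
        qed
        have "ev f (w(v := t * w v)) = (\<Sum>d\<in>deg ` ?K. ev (comp d) w * t ^ d)" for t
        proof -
          have "ev f (w(v := t * w v))
              = (\<Sum>q\<in>?K. Poly_Mapping.lookup f q * monom_at w q * t ^ deg q)"
            by (simp add: ev_def scale mult_ac)
          also have "\<dots> = (\<Sum>d\<in>deg ` ?K. \<Sum>q\<in>{q\<in>?K. deg q = d}.
              Poly_Mapping.lookup f q * monom_at w q * t ^ deg q)"
            by (rule sum.image_gen) simp
          also have "\<dots> = (\<Sum>d\<in>deg ` ?K. ev (comp d) w * t ^ d)"
            by (rule sum.cong) (auto simp: comp_def sum_distrib_right)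
          finally show ?thesis .
        qed
        then have "{t. (\<Sum>d\<in>deg ` ?K. ev (comp d) w * t ^ d) = 0} = UNIV"
          using less.prems by simp
        then show ?thesis
          using sum_powers_eq_0_imp[of "deg ` ?K" "\<lambda>d. ev (comp d) w" "deg m"] m
          by (simp add: infinite_UNIV_char_0)
      qed
      moreover have "comp (deg m) \<noteq> 0"
        using m keys_comp[of "deg m"] by (metis (mono_tags, lifting) empty_iff keys_zero mem_Collect_eq)
      moreover have "card (Poly_Mapping.keys (comp (deg m))) < card ?K"
      proof (rule psubset_card_mono)
        have "n \<notin> Poly_Mapping.keys (comp (deg m))" using v by (simp add: keys_comp deg_def)
        then show "Poly_Mapping.keys (comp (deg m)) \<subset> ?K" using n keys_comp by blast
      qed simp
      ultimately show False using less.hyps by blast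
    qed
  qed
qed

lemma ev_ext: "(\<And>w. ev f w = ev g w) \<Longrightarrow> f = g"
  using ev_eq_0_imp[of "f - g"] by simp

text \<open>Turns closure properties of the ring into facts about functions. For the converse
  direction, setting the foreign variables to 0 keeps the values of \<open>f\<close> and kills
  exactly its monomials that contain such a variable, so \<open>f\<close> equals the sum of the
  others.\<close>

lemma poly_ring_iff_ev:
  "f \<in> poly_ring M p \<longleftrightarrow>
    (\<forall>w w'. (\<forall>v\<in>entries M p. w v = w' v) \<longrightarrow> ev f w = ev f w')"
proof
  assume f: "f \<in> poly_ring M p"
  show "\<forall>w w'. (\<forall>v\<in>entries M p. w v = w' v) \<longrightarrow> ev f w = ev f w'"
  proof (intro allI impI)
    fix w w' :: "entry \<Rightarrow> complex"
    assume "\<forall>v\<in>entries M p. w v = w' v"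
    with f have "m \<in> Poly_Mapping.keys f \<Longrightarrow> monom_at w m = monom_at w' m" for m
      by (intro monom_at_cong) (auto simp: poly_ring_def)
    then show "ev f w = ev f w'" by (simp add: ev_def)
  qed
next
  assume indep: "\<forall>w w'. (\<forall>v\<in>entries M p. w v = w' v) \<longrightarrow> ev f w = ev f w'"
  define g where "g = (\<Sum>m\<in>{m\<in>Poly_Mapping.keys f. Poly_Mapping.keys m \<subseteq> entries M p}.
      Poly_Mapping.single m (Poly_Mapping.lookup f m))"
  have "ev f w = ev g w" for w
  proof -
    define w' where "w' = (\<lambda>v. if v \<in> entries M p then w v else 0)"
    have zero: "monom_at w' m = 0" if "\<not> Poly_Mapping.keys m \<subseteq> entries M p" for m
      using that by (auto simp: monom_at_def w'_def in_keys_iff)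
    have same: "monom_at w' m = monom_at w m" if "Poly_Mapping.keys m \<subseteq> entries M p" for m
      using that by (intro monom_at_cong) (auto simp: w'_def)
    have "ev f w = ev f w'" using indep by (simp add: w'_def)
    also have "\<dots> = (\<Sum>m\<in>{m\<in>Poly_Mapping.keys f. Poly_Mapping.keys m \<subseteq> entries M p}.
        Poly_Mapping.lookup f m * monom_at w' m)"
      unfolding ev_def by (rule sum.mono_neutral_right) (auto simp: zero)
    also have "\<dots> = ev g w" by (auto simp: g_def same intro!: sum.cong)
    finally show ?thesis .
  qed
  then have "f = g" by (rule ev_ext)
  moreover have "g \<in> poly_ring M p"
    using Poly_Mapping.keys_sum[of "\<lambda>m. Poly_Mapping.single m (Poly_Mapping.lookup f m)"]
    by (force simp: g_def poly_ring_def split: if_splits)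
  ultimately show "f \<in> poly_ring M p" by simp
qed

text \<open>On a line a polynomial function is a polynomial in one variable. This is the form of
  Zariski density by which generic arguments are later replaced by arbitrary ones.\<close>

lemma ev_line_eq_0:
  assumes "infinite {t. ev f (\<lambda>v. w v + t * u v) = 0}"
  shows "ev f (\<lambda>v. w v + t * u v) = 0"
proof -
  define q where "q = (\<Sum>m\<in>Poly_Mapping.keys f. [:Poly_Mapping.lookup f m:] *
      (\<Prod>v\<in>Poly_Mapping.keys m. [:w v, u v:] ^ Poly_Mapping.lookup m v))"
  have q: "poly q t = ev f (\<lambda>v. w v + t * u v)" for t
    by (simp add: q_def ev_def monom_at_def poly_sum poly_prod)
  with assms have "infinite {t. poly q t = 0}" by simp
  then have "q = 0" using poly_roots_finite by blast
  with q show ?thesis by (metis poly_0)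
qed

section \<open>Formal partial derivatives and derivatives along lines\<close>

lemma ev_partial_deriv:
  "ev (partial_deriv v f) w = (\<Sum>m\<in>Poly_Mapping.keys f. Poly_Mapping.lookup f m *
     (of_nat (Poly_Mapping.lookup m v) * monom_at w (m - Poly_Mapping.single v 1)))"
  by (simp add: partial_deriv_def mult_ac)

lemma monom_at_remove:
  "of_nat (Poly_Mapping.lookup m v) * monom_at w (m - Poly_Mapping.single v 1) =
     (\<Prod>u\<in>Poly_Mapping.keys m - {v}. w u ^ Poly_Mapping.lookup m u) *
     (of_nat (Poly_Mapping.lookup m v) * w v ^ (Poly_Mapping.lookup m v - 1))"
proof (cases "v \<in> Poly_Mapping.keys m")
  case True
  let ?n = "m - Poly_Mapping.single v 1"
  have "Poly_Mapping.keys ?n \<subseteq> Poly_Mapping.keys m"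
    by (auto simp: in_keys_iff lookup_minus)
  then have "monom_at w ?n = (\<Prod>u\<in>Poly_Mapping.keys m. w u ^ Poly_Mapping.lookup ?n u)"
    by (simp add: monom_at_superset)
  also have "\<dots> = w v ^ (Poly_Mapping.lookup m v - 1) *
      (\<Prod>u\<in>Poly_Mapping.keys m - {v}. w u ^ Poly_Mapping.lookup ?n u)"
    using True by (subst prod.remove[of _ v]) (auto simp: lookup_minus)
  also have "(\<Prod>u\<in>Poly_Mapping.keys m - {v}. w u ^ Poly_Mapping.lookup ?n u) =
      (\<Prod>u\<in>Poly_Mapping.keys m - {v}. w u ^ Poly_Mapping.lookup m u)"
    by (rule prod.cong) (auto simp: lookup_minus lookup_single)
  finally show ?thesis by simp
qed (simp add: in_keys_iff)

text \<open>The bridge from formal derivatives to analysis: a first-order operator becomes a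
  derivative along a direction, and uniqueness of derivatives can then replace computations with
  partial derivatives.\<close>

lemma has_field_derivative_ev_line:
  assumes "finite S" "\<And>v. v \<notin> S \<Longrightarrow> u v = 0"
  shows "((\<lambda>t. ev f (\<lambda>v. w v + t * u v)) has_field_derivative
     (\<Sum>v\<in>S. u v * ev (partial_deriv v f) w)) (at 0)"
proof -
  have monom: "((\<lambda>t. monom_at (\<lambda>v. w v + t * u v) m) has_field_derivative
      (\<Sum>v\<in>S. u v * (of_nat (Poly_Mapping.lookup m v) * monom_at w (m - Poly_Mapping.single v 1))))
      (at 0)" for m
  proof -
    let ?K = "Poly_Mapping.keys m"
    let ?d = "\<lambda>v. of_nat (Poly_Mapping.lookup m v) * w v ^ (Poly_Mapping.lookup m v - 1) * u v"
    have "((\<lambda>t. (w v + t * u v) ^ Poly_Mapping.lookup m v) has_field_derivative ?d v) (at 0)" for v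
      by (auto intro!: derivative_eq_intros)
    then have "((\<lambda>t. \<Prod>v\<in>?K. (w v + t * u v) ^ Poly_Mapping.lookup m v) has_field_derivative
        (\<Sum>v\<in>?K. ?d v * (\<Prod>x\<in>?K - {v}. (w x + 0 * u x) ^ Poly_Mapping.lookup m x))) (at 0)"
      by (intro has_field_derivative_prod)
    also have "(\<Sum>v\<in>?K. ?d v * (\<Prod>x\<in>?K - {v}. (w x + 0 * u x) ^ Poly_Mapping.lookup m x)) =
        (\<Sum>v\<in>?K. u v * (of_nat (Poly_Mapping.lookup m v) * monom_at w (m - Poly_Mapping.single v 1)))"
      by (simp only: monom_at_remove) (simp add: mult_ac)
    also have "\<dots> = (\<Sum>v\<in>?K \<inter> S. u v *
        (of_nat (Poly_Mapping.lookup m v) * monom_at w (m - Poly_Mapping.single v 1)))"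
      using assms by (intro sum.mono_neutral_right) auto
    also have "\<dots> = (\<Sum>v\<in>S. u v *
        (of_nat (Poly_Mapping.lookup m v) * monom_at w (m - Poly_Mapping.single v 1)))"
      using assms by (intro sum.mono_neutral_left) (auto simp: in_keys_iff)
    finally show ?thesis by (simp only: monom_at_def)
  qed
  have "((\<lambda>t. ev f (\<lambda>v. w v + t * u v)) has_field_derivative
      (\<Sum>m\<in>Poly_Mapping.keys f. Poly_Mapping.lookup f m * (\<Sum>v\<in>S. u v *
        (of_nat (Poly_Mapping.lookup m v) * monom_at w (m - Poly_Mapping.single v 1))))) (at 0)"
    unfolding ev_def by (intro DERIV_sum DERIV_cmult monom)
  also have "(\<Sum>m\<in>Poly_Mapping.keys f. Poly_Mapping.lookup f m * (\<Sum>v\<in>S. u v *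
        (of_nat (Poly_Mapping.lookup m v) * monom_at w (m - Poly_Mapping.single v 1)))) =
      (\<Sum>v\<in>S. u v * ev (partial_deriv v f) w)"
    unfolding ev_partial_deriv sum_distrib_left
    by (subst sum.swap) (simp add: mult_ac)
  finally show ?thesis .
qed


section \<open>Semi-invariants on diagonal matrices\<close>

text \<open>Outside the dimensions of the two matrices the values are unspecified; they never matter
  for polynomials in \<open>poly_ring\<close>, by \<open>peval_cong\<close>.\<close>

definition asg :: "complex mat \<Rightarrow> complex mat \<Rightarrow> entry \<Rightarrow> complex" where
  "asg X A v = (case v of XE i j \<Rightarrow> X $$ (i, j) | AE a i \<Rightarrow> A $$ (a, i))"

definition peval :: "mpoly \<Rightarrow> complex mat \<Rightarrow> complex mat \<Rightarrow> complex" where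
  "peval f X A = ev f (asg X A)"

definition Xof :: "nat \<Rightarrow> (entry \<Rightarrow> complex) \<Rightarrow> complex mat" where
  "Xof M w = mat M M (\<lambda>(i, j). w (XE i j))"

definition Aof :: "nat \<Rightarrow> nat \<Rightarrow> (entry \<Rightarrow> complex) \<Rightarrow> complex mat" where
  "Aof p M w = mat p M (\<lambda>(a, i). w (AE a i))"

lemma Xof_carrier [simp]: "Xof M w \<in> carrier_mat M M"
  by (simp add: Xof_def)

lemma Aof_carrier [simp]: "Aof p M w \<in> carrier_mat p M"
  by (simp add: Aof_def)

lemma ev_eq_peval: "f \<in> poly_ring M p \<Longrightarrow> ev f w = peval f (Xof M w) (Aof p M w)"
  unfolding peval_def poly_ring_iff_ev
  by (elim allE[of _ w] allE[of _ "asg (Xof M w) (Aof p M w)"])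
    (auto simp: entries_def asg_def Xof_def Aof_def)

lemma peval_cong:
  assumes "f \<in> poly_ring M p"
    and "\<And>i j. i < M \<Longrightarrow> j < M \<Longrightarrow> X $$ (i, j) = X' $$ (i, j)"
    and "\<And>a i. a < p \<Longrightarrow> i < M \<Longrightarrow> A $$ (a, i) = A' $$ (a, i)"
  shows "peval f X A = peval f X' A'"
  using assms unfolding peval_def poly_ring_iff_ev
  by (elim allE[of _ "asg X A"] allE[of _ "asg X' A'"]) (auto simp: entries_def asg_def)

lemma poly_ring_eqI:
  assumes "f \<in> poly_ring M p" "g \<in> poly_ring M p"
    and "\<And>X A. X \<in> carrier_mat M M \<Longrightarrow> A \<in> carrier_mat p M \<Longrightarrow> peval f X A = peval g X A"
  shows "f = g"
  by (rule ev_ext) (simp add: ev_eq_peval[OF assms(1)] ev_eq_peval[OF assms(2)] assms(3))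

lemma peval_simps [simp]:
  "peval (f + g) X A = peval f X A + peval g X A"
  "peval (f - g) X A = peval f X A - peval g X A"
  "peval (- f) X A = - peval f X A"
  "peval (f * g) X A = peval f X A * peval g X A"
  "peval 0 X A = 0"
  "peval (Const c) X A = c"
  "peval (sum F S) X A = (\<Sum>i\<in>S. peval (F i) X A)"
  by (simp_all add: peval_def)

interpretation ev_hom: comm_ring_hom "\<lambda>f. ev f w" for w
  by unfold_locales auto

lemma map_ev_Const [simp]: "map_mat (\<lambda>f. ev f w) (map_mat Const g) = g"
  by (rule eq_matI) auto

lemma map_ev_X_mat: "map_mat (\<lambda>f. ev f w) (X_mat M) = Xof M w"
  by (rule eq_matI) (auto simp: X_mat_def Xof_def)

lemma map_ev_A_mat: "map_mat (\<lambda>f. ev f w) (A_mat p M) = Aof p M w"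
  by (rule eq_matI) (auto simp: A_mat_def Aof_def)

lemma X_mat_carrier [simp]: "X_mat M \<in> carrier_mat M M"
  by (simp add: X_mat_def)

lemma A_mat_carrier [simp]: "A_mat p M \<in> carrier_mat p M"
  by (simp add: A_mat_def)

lemma ev_eval_at:
  assumes "f \<in> poly_ring M p" "X' \<in> carrier_mat M M" "A' \<in> carrier_mat p M"
  shows "ev (eval_at f X' A') w =
    peval f (map_mat (\<lambda>q. ev q w) X') (map_mat (\<lambda>q. ev q w) A')"
proof -
  let ?w = "\<lambda>v. ev (case v of XE i j \<Rightarrow> X' $$ (i, j) | AE a i \<Rightarrow> A' $$ (a, i)) w"
  let ?w' = "asg (map_mat (\<lambda>q. ev q w) X') (map_mat (\<lambda>q. ev q w) A')"
  have "ev f ?w = ev f ?w'"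
    using assms unfolding poly_ring_iff_ev
    by (elim allE[of _ ?w] allE[of _ ?w']) (auto simp: entries_def asg_def)
  then show ?thesis by (simp add: eval_at_def ev_subst peval_def)
qed

lemma inverse_mat_det:
  fixes g h :: "complex mat"
  assumes "g \<in> carrier_mat M M" "h \<in> carrier_mat M M" "g * h = 1\<^sub>m M"
  shows "det g powi (- int l) = det h ^ l"
proof -
  have "det g * det h = 1" using assms by (metis det_mult det_one)
  then have "det h = inverse (det g)" by (metis inverse_unique)
  then show ?thesis by (simp add: power_int_minus power_inverse)
qed

text \<open>Trades matrices over the polynomial ring for complex matrices, and the negative power of
  \<open>det g\<close> for an ordinary power of the determinant of the inverse
  \<open>h\<close>.\<close>

lemma H_set_iff:
  "f \<in> H_set M p l \<longleftrightarrow> f \<in> poly_ring M p \<and>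
    (\<forall>g\<in>carrier_mat M M. \<forall>h\<in>carrier_mat M M. g * h = 1\<^sub>m M \<and> h * g = 1\<^sub>m M \<longrightarrow>
      (\<forall>X\<in>carrier_mat M M. \<forall>A\<in>carrier_mat p M.
        peval f (g * X * h) (A * h) = det h ^ l * peval f X A))"
  (is "_ \<longleftrightarrow> _ \<and> ?R")
proof (cases "f \<in> poly_ring M p")
  case f: True
  have key: "(eval_at f (map_mat Const g * X_mat M * map_mat Const h) (A_mat p M * map_mat Const h) =
       Const (det g powi (- int l)) * f) \<longleftrightarrow>
      (\<forall>X\<in>carrier_mat M M. \<forall>A\<in>carrier_mat p M.
        peval f (g * X * h) (A * h) = det h ^ l * peval f X A)"
    if gh: "g \<in> carrier_mat M M" "h \<in> carrier_mat M M" "g * h = 1\<^sub>m M" for g h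
  proof -
    have c: "map_mat Const g \<in> carrier_mat M M" "map_mat Const h \<in> carrier_mat M M"
      "A_mat p M * map_mat Const h \<in> carrier_mat p M"
      using gh by (auto intro: mult_carrier_mat[of _ p M])
    have lhs: "ev (eval_at f (map_mat Const g * X_mat M * map_mat Const h)
        (A_mat p M * map_mat Const h)) w =
        peval f (g * Xof M w * h) (Aof p M w * h)" for w
      using c by (subst ev_eval_at[OF f])
        (auto simp: ev_hom.mat_hom_mult[of _ M M _ M] ev_hom.mat_hom_mult[of _ p M _ M]
          map_ev_X_mat map_ev_A_mat)
    have "(eval_at f (map_mat Const g * X_mat M * map_mat Const h) (A_mat p M * map_mat Const h) =
       Const (det g powi (- int l)) * f) \<longleftrightarrow>
       (\<forall>w. peval f (g * Xof M w * h) (Aof p M w * h) = det h ^ l * peval f (Xof M w) (Aof p M w))"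
      (is "?a = ?b \<longleftrightarrow> _")
    proof
      assume "?a = ?b"
      then have "ev ?a w = ev ?b w" for w by simp
      then show "\<forall>w. peval f (g * Xof M w * h) (Aof p M w * h) = det h ^ l * peval f (Xof M w) (Aof p M w)"
        by (simp only: lhs) (simp add: inverse_mat_det[OF gh] ev_eq_peval[OF f])
    next
      assume "\<forall>w. peval f (g * Xof M w * h) (Aof p M w * h) = det h ^ l * peval f (Xof M w) (Aof p M w)"
      then show "?a = ?b"
        by (intro ev_ext, simp only: lhs) (simp add: inverse_mat_det[OF gh] ev_eq_peval[OF f])
    qed
    also have "\<dots> \<longleftrightarrow> (\<forall>X\<in>carrier_mat M M. \<forall>A\<in>carrier_mat p M.
        peval f (g * X * h) (A * h) = det h ^ l * peval f X A)"
    proof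
      assume w: "\<forall>w. peval f (g * Xof M w * h) (Aof p M w * h) =
        det h ^ l * peval f (Xof M w) (Aof p M w)"
      show "\<forall>X\<in>carrier_mat M M. \<forall>A\<in>carrier_mat p M.
        peval f (g * X * h) (A * h) = det h ^ l * peval f X A"
      proof (intro ballI)
        fix X A :: "complex mat" assume "X \<in> carrier_mat M M" "A \<in> carrier_mat p M"
        then have "Xof M (asg X A) = X" "Aof p M (asg X A) = A"
          by (auto simp: Xof_def Aof_def asg_def intro!: eq_matI)
        with w show "peval f (g * X * h) (A * h) = det h ^ l * peval f X A" by metis
      qed
    qed simp
    finally show ?thesis .
  qed
  have inv: "inverts_mat g h \<and> inverts_mat h g \<longleftrightarrow> g * h = 1\<^sub>m M \<and> h * g = 1\<^sub>m M"
    if "g \<in> carrier_mat M M" "h \<in> carrier_mat M M" for g h :: "complex mat"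
    using that by (auto simp: inverts_mat_def)
  show ?thesis
    unfolding H_set_def using f by (auto simp: inv key)
qed (simp add: H_set_def)

lemma H_set_poly_ring: "f \<in> H_set M p l \<Longrightarrow> f \<in> poly_ring M p"
  by (simp add: H_set_def)

lemma peval_conjugate:
  assumes "f \<in> H_set M p l" "g \<in> carrier_mat M M" "h \<in> carrier_mat M M"
    "g * h = 1\<^sub>m M" "h * g = 1\<^sub>m M" "X \<in> carrier_mat M M" "A \<in> carrier_mat p M"
  shows "peval f (g * X * h) (A * h) = det h ^ l * peval f X A"
  using assms unfolding H_set_iff by blast

lemma H_set_add: "f \<in> H_set M p l \<Longrightarrow> g \<in> H_set M p l \<Longrightarrow> f + g \<in> H_set M p l"
  unfolding H_set_iff poly_ring_iff_ev by (auto simp: distrib_left) metis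

lemma H_set_Const: "f \<in> H_set M p l \<Longrightarrow> Const c * f \<in> H_set M p l"
  unfolding H_set_iff poly_ring_iff_ev by auto

lemma H_set_0: "0 \<in> H_set M p l"
  unfolding H_set_iff poly_ring_iff_ev by auto

lemma H_set_uminus: "f \<in> H_set M p l \<Longrightarrow> - f \<in> H_set M p l"
  unfolding H_set_iff poly_ring_iff_ev by auto

lemma H_set_diff: "f \<in> H_set M p l \<Longrightarrow> g \<in> H_set M p l \<Longrightarrow> f - g \<in> H_set M p l"
  using H_set_add[of f M p l "- g"] H_set_uminus by simp

lemma H_set_sum: "(\<And>i. i \<in> S \<Longrightarrow> F i \<in> H_set M p l) \<Longrightarrow> sum F S \<in> H_set M p l"
  by (induction S rule: infinite_finite_induct) (auto simp: H_set_0 H_set_add)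

section \<open>Diagonalization and density\<close>

lemma vandermonde_independent:
  fixes x :: "nat \<Rightarrow> complex"
  assumes "inj_on x {..<M}" "\<And>m. m < M \<Longrightarrow> (\<Sum>j<M. c j * x j ^ m) = 0" "j < M"
  shows "c j = 0"
proof -
  \<comment> \<open>the Lagrange numerator of the node \<open>x j\<close>\<close>
  define q where "q = (\<Prod>i\<in>{..<M} - {j}. [:- x i, 1:])"
  have "degree q \<le> card ({..<M} - {j})"
    unfolding q_def by (rule order_trans[OF degree_prod_sum_le]) auto
  then have deg: "degree q < M" using assms(3) by simp
  have q0: "poly q (x i) = 0" if "i < M" "i \<noteq> j" for i
    unfolding q_def poly_prod using that by (intro prod_zero) (auto intro!: bexI[of _ i])
  have qj: "poly q (x j) \<noteq> 0"
    using assms(1,3) by (auto simp: q_def poly_prod inj_on_def)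
  have "0 = (\<Sum>m\<le>degree q. poly.coeff q m * (\<Sum>i<M. c i * x i ^ m))"
    using deg by (intro sum.neutral[symmetric]) (simp add: assms(2))
  also have "\<dots> = (\<Sum>i<M. c i * poly q (x i))"
    unfolding poly_altdef sum_distrib_left by (subst sum.swap) (simp add: mult_ac)
  also have "\<dots> = c j * poly q (x j)"
    using assms(3) q0 by (subst sum.remove[of _ j]) (auto intro!: sum.neutral)
  finally show ?thesis using qj by simp
qed

definition vandermonde :: "nat \<Rightarrow> (nat \<Rightarrow> complex) \<Rightarrow> complex mat" where
  "vandermonde M x = mat M M (\<lambda>(i, j). x j ^ i)"

lemma det_vandermonde_nonzero:
  assumes "inj_on x {..<M}"
  shows "det (vandermonde M x) \<noteq> 0"
proof
  have V: "vandermonde M x \<in> carrier_mat M M" by (simp add: vandermonde_def)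
  assume "det (vandermonde M x) = 0"
  then obtain v where v: "v \<in> carrier_vec M" "v \<noteq> 0\<^sub>v M" "vandermonde M x *\<^sub>v v = 0\<^sub>v M"
    using det_0_iff_vec_prod_zero_field[OF V] by auto
  have "(\<Sum>j<M. v $ j * x j ^ m) = 0" if "m < M" for m
    using v(1) arg_cong[OF v(3), of "\<lambda>u. u $ m"] that
    by (simp add: vandermonde_def scalar_prod_def mult.commute lessThan_atLeast0)
  then have "v $ j = 0" if "j < M" for j
    using vandermonde_independent[OF assms, of "\<lambda>j. v $ j"] that by blast
  with v show False by (auto intro: eq_vecI)
qed

lemma distinct_eigenvalues_diagonalizable:
  fixes X :: "complex mat" and d :: "nat \<Rightarrow> complex"
  assumes X: "X \<in> carrier_mat M M" and cp: "char_poly X = (\<Prod>j<M. [:- d j, 1:])"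
    and inj: "inj_on d {..<M}"
  obtains P Q where "P \<in> carrier_mat M M" "Q \<in> carrier_mat M M" "P * Q = 1\<^sub>m M" "Q * P = 1\<^sub>m M"
    "X = P * mat_diag M d * Q"
proof -
  have "\<exists>v. eigenvector X v (d j)" if "j < M" for j
  proof -
    have "poly (char_poly X) (d j) = 0"
      unfolding cp poly_prod using that by (intro prod_zero) (auto intro!: bexI[of _ j])
    then have "eigenvalue X (d j)" using eigenvalue_root_char_poly[OF X] by simp
    then show ?thesis by (simp add: eigenvalue_def)
  qed
  then obtain v where v: "eigenvector X (v j) (d j)" if "j < M" for j by metis
  then have vc: "v j \<in> carrier_vec M" "v j \<noteq> 0\<^sub>v M" "X *\<^sub>v v j = d j \<cdot>\<^sub>v v j" if "j < M" for j
    using that X by (auto simp: eigenvector_def)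
  define P where "P = mat M M (\<lambda>(i, j). v j $ i)"
  have P: "P \<in> carrier_mat M M" by (simp add: P_def)
  have D: "mat_diag M d \<in> carrier_mat M M" by (simp add: mat_diag_def)
  have XP: "X * P = P * mat_diag M d"
  proof (rule eq_matI)
    fix i j assume "i < dim_row (P * mat_diag M d)" "j < dim_col (P * mat_diag M d)"
    then have ij: "i < M" "j < M" using P D by auto
    have colP: "col P j = v j" using ij vc(1)[of j] by (auto simp: P_def)
    have "(X * P) $$ (i, j) = (X *\<^sub>v v j) $ i" using ij X P by (simp add: colP)
    also have "\<dots> = v j $ i * d j" using ij vc[of j] by simp
    also have "\<dots> = (P * mat_diag M d) $$ (i, j)"
      using ij P by (subst mat_diag_mult_right[of _ M]) (auto simp: P_def)
    finally show "(X * P) $$ (i, j) = (P * mat_diag M d) $$ (i, j)" .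
  qed (use X P carrier_matD[OF D] in auto)
  have "det P \<noteq> 0"
  proof
    assume "det P = 0"
    then obtain w where w: "w \<in> carrier_vec M" "w \<noteq> 0\<^sub>v M" "P *\<^sub>v w = 0\<^sub>v M"
      using det_0_iff_vec_prod_zero_field[OF P] by auto
    have Dw: "mat_diag M d *\<^sub>v u = vec M (\<lambda>j. d j * u $ j)" if "u \<in> carrier_vec M" for u
      using that by (intro eq_vecI) (auto simp: mat_diag_def scalar_prod_def if_distrib[of "\<lambda>c. c * _"] sum.delta cong: if_cong)
    \<comment> \<open>Applying powers of \<open>X\<close> to a relation among the eigenvectors
      multiplies its coefficients by powers of the eigenvalues. In each coordinate this is a
      Vandermonde system, which forces the relation to be trivial.\<close>
    have pow: "P *\<^sub>v vec M (\<lambda>j. d j ^ m * w $ j) = 0\<^sub>v M" for m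
    proof (induction m)
      case 0
      have "vec M (\<lambda>j. d j ^ 0 * w $ j) = w" using w(1) by auto
      then show ?case using w(3) by simp
    next
      case (Suc m)
      let ?u = "vec M (\<lambda>j. d j ^ m * w $ j)"
      have "vec M (\<lambda>j. d j ^ Suc m * w $ j) = mat_diag M d *\<^sub>v ?u"
        by (subst Dw) auto
      then have "P *\<^sub>v vec M (\<lambda>j. d j ^ Suc m * w $ j) = (X * P) *\<^sub>v ?u"
        unfolding XP using P D by (simp add: assoc_mult_mat_vec[of _ M M _ M])
      also have "\<dots> = X *\<^sub>v (P *\<^sub>v ?u)" using P X by (simp add: assoc_mult_mat_vec[of _ M M _ M])
      also have "\<dots> = 0\<^sub>v M" using X by (simp add: Suc.IH) (auto intro!: eq_vecI)
      finally show ?case .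
    qed
    have entry: "v j $ i * w $ j = 0" if "i < M" "j < M" for i j
    proof (rule vandermonde_independent[OF inj _ \<open>j < M\<close>])
      fix m assume "m < M"
      show "(\<Sum>j<M. v j $ i * w $ j * d j ^ m) = 0"
        using arg_cong[OF pow[of m], of "\<lambda>u. u $ i"] that
        by (simp add: P_def scalar_prod_def lessThan_atLeast0 mult_ac)
    qed
    have "w $ j = 0" if "j < M" for j
    proof -
      obtain i where "i < M" "v j $ i \<noteq> 0"
        using vc(1,2)[OF \<open>j < M\<close>] by (metis carrier_vecD eq_vecI index_zero_vec(1,2))
      with entry[of i j] that show ?thesis by simp
    qed
    with w show False by (auto intro: eq_vecI)
  qed
  then obtain Q where Q: "Q \<in> carrier_mat M M" "P * Q = 1\<^sub>m M" "Q * P = 1\<^sub>m M"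
    using det_non_zero_imp_unit[OF P, of "()"] by (auto simp: Units_def ring_mat_def)
  have "P * mat_diag M d * Q = X * (P * Q)" using X P Q(1) by (simp flip: XP)
  then have "X = P * mat_diag M d * Q" using X Q by simp
  with that P Q show ?thesis by blast
qed

lemma finite_linear_root:
  fixes a b :: complex
  assumes "b \<noteq> 0"
  shows "finite {t. a + t * b = 0}"
proof -
  have "{t. a + t * b = 0} \<subseteq> {- a / b}" using assms by (auto simp: field_simps add_eq_0_iff)
  then show ?thesis using finite_subset by blast
qed

text \<open>
  Diagonalizable matrices are dense: triangularize, then move the diagonal entries apart along
  a line.
\<close>

lemma H_set_eq_0I:
  assumes f: "f \<in> H_set M p l"
    and diag: "\<And>x A. inj_on x {..<M} \<Longrightarrow> A \<in> carrier_mat p M \<Longrightarrow> peval f (mat_diag M x) A = 0"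
  shows "f = 0"
proof (rule poly_ring_eqI[of _ M p])
  show "f \<in> poly_ring M p" using f by (rule H_set_poly_ring)
  show "0 \<in> poly_ring M p" by (simp add: poly_ring_iff_ev)
  \<comment> \<open>Every \<open>A\<close> is of the form \<open>(A * P) * Q\<close>, so vanishing
    at \<open>T\<close> for all row parts passes to the conjugate of \<open>T\<close>.\<close>
  have conj: "peval f (P * T * Q) A = 0"
    if "P \<in> carrier_mat M M" "Q \<in> carrier_mat M M" "P * Q = 1\<^sub>m M" "Q * P = 1\<^sub>m M"
      "T \<in> carrier_mat M M" "A \<in> carrier_mat p M" "\<And>A. A \<in> carrier_mat p M \<Longrightarrow> peval f T A = 0"
    for P Q T A
  proof -
    have "A * P * Q = A" using that by (subst assoc_mult_mat[of _ p M _ M _ M]) auto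
    then have "peval f (P * T * Q) A = peval f (P * T * Q) (A * P * Q)" by simp
    also have "\<dots> = det Q ^ l * peval f T (A * P)"
      using that by (intro peval_conjugate[OF f]) auto
    finally show ?thesis using that by auto
  qed
  have distinct: "peval f T A = 0"
    if T: "T \<in> carrier_mat M M" "char_poly T = (\<Prod>j<M. [:- d j, 1:])" "inj_on d {..<M}"
      and A: "A \<in> carrier_mat p M" for T d A
  proof -
    obtain P Q where PQ: "P \<in> carrier_mat M M" "Q \<in> carrier_mat M M" "P * Q = 1\<^sub>m M" "Q * P = 1\<^sub>m M"
      "T = P * mat_diag M d * Q"
      using distinct_eigenvalues_diagonalizable[OF T] .
    show ?thesis unfolding PQ(5)
      using PQ A T diag by (intro conj) (auto simp: mat_diag_def)
  qed
  fix X A :: "complex mat" assume XA: "X \<in> carrier_mat M M" "A \<in> carrier_mat p M"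
  obtain es where es: "char_poly X = (\<Prod>e\<leftarrow>es. [:- e, 1:])"
    using char_poly_factorized[OF XA(1)] by auto
  obtain T P Q where "schur_decomposition X es = (T, P, Q)" by (metis prod_cases3)
  from schur_decomposition[OF XA(1) es this]
  have wit: "similar_mat_wit X T P Q" and ut: "upper_triangular T" by auto
  note S = similar_mat_witD2[OF XA(1) wit]
  have "peval f T A = 0" if A: "A \<in> carrier_mat p M" for A
  proof -
    \<comment> \<open>Adding t diag(0, 1, 2, ...) keeps the matrix triangular, so its diagonal
      entries remain the eigenvalues, and any two of them coincide for at most one t.\<close>
    define u where "u = (\<lambda>v. case v of XE i j \<Rightarrow> if i = j then of_nat i else 0 | AE a i \<Rightarrow> (0::complex))"
    define Tt where "Tt = (\<lambda>t. mat M M (\<lambda>(i, j). T $$ (i, j) + t * (if i = j then of_nat i else 0)))"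
    define d where "d = (\<lambda>t i. T $$ (i, i) + t * of_nat i)"
    have line: "ev f (\<lambda>v. asg T A v + t * u v) = peval f (Tt t) A" for t
    proof -
      have "ev f (\<lambda>v. asg T A v + t * u v) =
          peval f (Xof M (\<lambda>v. asg T A v + t * u v)) (Aof p M (\<lambda>v. asg T A v + t * u v))"
        using H_set_poly_ring[OF f] by (rule ev_eq_peval)
      also have "\<dots> = peval f (Tt t) A"
        by (rule peval_cong[OF H_set_poly_ring[OF f]])
          (auto simp: Xof_def Aof_def asg_def u_def Tt_def)
      finally show ?thesis .
    qed
    have zero: "peval f (Tt t) A = 0" if "inj_on (d t) {..<M}" for t
    proof (rule distinct[OF _ _ that A])
      show Tc: "Tt t \<in> carrier_mat M M" by (simp add: Tt_def)
      have "upper_triangular (Tt t)" using ut carrier_matD[OF S(5)]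
        by (auto simp: Tt_def upper_triangular_def)
      from char_poly_upper_triangular[OF Tc this]
      have "char_poly (Tt t) = (\<Prod>a\<leftarrow>diag_mat (Tt t). [:- a, 1:])" .
      also have "\<dots> = (\<Prod>j<M. [:- d t j, 1:])"
        unfolding diag_mat_def prod.list_conv_set_nth
        using Tc by (auto simp: Tt_def d_def lessThan_atLeast0 intro!: prod.cong)
      finally show "char_poly (Tt t) = (\<Prod>j<M. [:- d t j, 1:])" .
    qed
    have "finite {t. \<not> inj_on (d t) {..<M}}"
    proof (rule finite_subset)
      show "{t. \<not> inj_on (d t) {..<M}} \<subseteq> (\<Union>i<M. \<Union>j\<in>{..<M} - {i}.
          {t. (T $$ (i, i) - T $$ (j, j)) + t * (of_nat i - of_nat j) = 0})"
        by (auto simp: inj_on_def d_def algebra_simps)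
      show "finite (\<Union>i<M. \<Union>j\<in>{..<M} - {i}.
          {t. (T $$ (i, i) - T $$ (j, j)) + t * (of_nat i - of_nat j) = 0})"
        by (intro finite_UN_I finite_linear_root) auto
    qed
    then have "infinite (- {t. \<not> inj_on (d t) {..<M}})"
      by (simp add: Compl_eq_Diff_UNIV Diff_infinite_finite infinite_UNIV_char_0)
    then have "infinite {t. inj_on (d t) {..<M}}" by (simp add: Compl_eq)
    moreover have "{t. inj_on (d t) {..<M}} \<subseteq> {t. ev f (\<lambda>v. asg T A v + t * u v) = 0}"
      using zero line by auto
    ultimately have "infinite {t. ev f (\<lambda>v. asg T A v + t * u v) = 0}"
      using infinite_super by blast
    from ev_line_eq_0[OF this, of 0] show ?thesis by (simp add: peval_def)
  qed
  then show "peval f X A = peval 0 X A"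
    using S XA conj[of P Q T A] by simp
qed


section \<open>Row determinants span the semi-invariants of weight 1\<close>

lemma Xof_asg [simp]: "X \<in> carrier_mat M M \<Longrightarrow> Xof M (asg X A) = X"
  by (auto simp: Xof_def asg_def intro!: eq_matI)

lemma Aof_asg [simp]: "A \<in> carrier_mat p M \<Longrightarrow> Aof p M (asg X A) = A"
  by (auto simp: Aof_def asg_def intro!: eq_matI)

lemma mat_diag_carrier [simp]: "mat_diag n f \<in> carrier_mat n n"
  by (simp add: mat_diag_def)

lemma mat_diag_pow: "mat_diag n f ^\<^sub>m m = mat_diag n (\<lambda>i. f i ^ m :: 'a :: comm_semiring_1)"
proof (induction m)
  case 0
  then show ?case by (auto simp: mat_diag_def intro!: eq_matI)
next
  case (Suc m)
  then show ?case by (simp add: mat_diag_diag mult.commute)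
qed

text \<open>In the exterior power of the overview this is the wedge product of the vectors
  \<open>e_(c i) z^(\<mu> i)\<close>; below, \<open>c i\<close> is called the colour of row
  \<open>i\<close>.\<close>

definition row_det :: "nat \<Rightarrow> nat \<Rightarrow> (nat \<Rightarrow> nat) \<Rightarrow> (nat \<Rightarrow> nat) \<Rightarrow> mpoly" where
  "row_det p M c \<mu> = det (mat M M (\<lambda>(i, j). (A_mat p M * X_mat M ^\<^sub>m \<mu> i) $$ (c i, j)))"

lemma ev_row_det:
  assumes "\<And>i. i < M \<Longrightarrow> c i < p"
  shows "ev (row_det p M c \<mu>) w =
    det (mat M M (\<lambda>(i, j). (Aof p M w * Xof M w ^\<^sub>m \<mu> i) $$ (c i, j)))"
proof -
  have "map_mat (\<lambda>f. ev f w) (A_mat p M * X_mat M ^\<^sub>m m) = Aof p M w * Xof M w ^\<^sub>m m" for m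
    by (simp add: ev_hom.mat_hom_mult[of _ p M _ M] ev_hom.mat_hom_pow[of _ M]
        map_ev_X_mat map_ev_A_mat pow_carrier_mat)
  from this[symmetric] have "map_mat (\<lambda>f. ev f w) (mat M M (\<lambda>(i, j). (A_mat p M * X_mat M ^\<^sub>m \<mu> i) $$ (c i, j)))
      = mat M M (\<lambda>(i, j). (Aof p M w * Xof M w ^\<^sub>m \<mu> i) $$ (c i, j))"
    using assms carrier_matD[OF A_mat_carrier[of p M]] carrier_matD[OF pow_carrier_mat[OF X_mat_carrier[of M]]]
    by (intro eq_matI) auto
  then show ?thesis by (simp add: row_det_def flip: ev_hom.hom_det)
qed

lemma peval_row_det:
  assumes "\<And>i. i < M \<Longrightarrow> c i < p" "X \<in> carrier_mat M M" "A \<in> carrier_mat p M"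
  shows "peval (row_det p M c \<mu>) X A = det (mat M M (\<lambda>(i, j). (A * X ^\<^sub>m \<mu> i) $$ (c i, j)))"
  using assms by (simp add: peval_def ev_row_det)

text \<open>All matrices A X^m transform as A itself does. A determinant of M of their rows
  therefore picks up exactly one factor \<open>det h\<close>.\<close>

lemma mult_conjugate_pow:
  fixes g h X A :: "complex mat"
  assumes gh: "g \<in> carrier_mat M M" "h \<in> carrier_mat M M" "g * h = 1\<^sub>m M" "h * g = 1\<^sub>m M"
    and X: "X \<in> carrier_mat M M" and A: "A \<in> carrier_mat p M"
  shows "(A * h) * (g * X * h) ^\<^sub>m m = (A * X ^\<^sub>m m) * h"
proof -
  have "similar_mat_wit (g * X * h) X g h"
    using gh X by (intro similar_mat_witI) auto
  then have "similar_mat_wit ((g * X * h) ^\<^sub>m m) (X ^\<^sub>m m) g h" by (rule similar_mat_wit_pow)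
  then have "(g * X * h) ^\<^sub>m m = g * X ^\<^sub>m m * h"
    by (auto simp: similar_mat_wit_def Let_def)
  also have "(A * h) * \<dots> = (A * h) * (g * X ^\<^sub>m m) * h"
    using gh X A pow_carrier_mat[OF X, of m]
    by (intro assoc_mult_mat[of _ p M _ M _ M, symmetric]) auto
  also have "(A * h) * (g * X ^\<^sub>m m) = (A * h) * g * X ^\<^sub>m m"
    using gh X A pow_carrier_mat[OF X, of m]
    by (intro assoc_mult_mat[of _ p M _ M _ M, symmetric]) auto
  also have "(A * h) * g = A * (h * g)"
    using gh A by (intro assoc_mult_mat[of _ p M _ M _ M]) auto
  finally show ?thesis using gh A by simp
qed

lemma row_det_in_H_set:
  assumes c: "\<And>i. i < M \<Longrightarrow> c i < p"
  shows "row_det p M c \<mu> \<in> H_set M p 1"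
  unfolding H_set_iff
proof (intro conjI ballI impI)
  show "row_det p M c \<mu> \<in> poly_ring M p"
    unfolding poly_ring_iff_ev
  proof (intro allI impI)
    fix w w' :: "entry \<Rightarrow> complex"
    assume w: "\<forall>v\<in>entries M p. w v = w' v"
    have "Xof M w = Xof M w'" "Aof p M w = Aof p M w'"
      using w by (auto simp: Xof_def Aof_def entries_def intro!: eq_matI)
    then show "ev (row_det p M c \<mu>) w = ev (row_det p M c \<mu>) w'"
      using c by (simp add: ev_row_det)
  qed
next
  fix g h X A :: "complex mat"
  assume gh: "g \<in> carrier_mat M M" "h \<in> carrier_mat M M" "g * h = 1\<^sub>m M \<and> h * g = 1\<^sub>m M"
    and X: "X \<in> carrier_mat M M" and A: "A \<in> carrier_mat p M"
  let ?R = "mat M M (\<lambda>(i, j). (A * X ^\<^sub>m \<mu> i) $$ (c i, j))"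
  note pow = mult_conjugate_pow[OF gh(1,2) gh(3)[THEN conjunct1] gh(3)[THEN conjunct2] X A]
  have "peval (row_det p M c \<mu>) (g * X * h) (A * h) =
      det (mat M M (\<lambda>(i, j). ((A * X ^\<^sub>m \<mu> i) * h) $$ (c i, j)))"
    unfolding pow[symmetric] using gh X A c by (intro peval_row_det) auto
  also have "mat M M (\<lambda>(i, j). ((A * X ^\<^sub>m \<mu> i) * h) $$ (c i, j)) = ?R * h"
    using gh X A c by (intro eq_matI) (auto simp: scalar_prod_def)
  also have "det (?R * h) = det ?R * det h" using gh by (intro det_mult) auto
  finally show "peval (row_det p M c \<mu>) (g * X * h) (A * h) =
      det h ^ 1 * peval (row_det p M c \<mu>) X A"
    using c X A by (simp add: peval_row_det)
qed

lemma peval_row_det_diag: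
  assumes "\<And>i. i < M \<Longrightarrow> c i < p" "A \<in> carrier_mat p M"
  shows "peval (row_det p M c \<mu>) (mat_diag M x) A =
    det (mat M M (\<lambda>(i, j). A $$ (c i, j) * x j ^ \<mu> i))"
proof -
  have "mat M M (\<lambda>(i, j). (A * mat_diag M x ^\<^sub>m \<mu> i) $$ (c i, j)) =
      mat M M (\<lambda>(i, j). A $$ (c i, j) * x j ^ \<mu> i)"
    using assms by (intro eq_matI) (auto simp: mat_diag_pow mat_diag_mult_right[of _ p])
  then show ?thesis using assms by (subst peval_row_det) auto
qed

text \<open>Comparing coefficients gives 2 ^ deg = 2 ^ n for each monomial. The single scale 2
  suffices because its powers are distinct complex numbers.\<close>

lemma keys_homogeneous:
  fixes wt :: "entry \<Rightarrow> nat"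
  assumes "\<And>w. ev f (\<lambda>v. 2 ^ wt v * w v) = 2 ^ n * ev f w" "m \<in> Poly_Mapping.keys f"
  shows "(\<Sum>v\<in>Poly_Mapping.keys m. wt v * Poly_Mapping.lookup m v) = n"
proof -
  define deg where "deg = (\<lambda>m::entry \<Rightarrow>\<^sub>0 nat. \<Sum>v\<in>Poly_Mapping.keys m. wt v * Poly_Mapping.lookup m v)"
  define g where "g = (\<Sum>m\<in>Poly_Mapping.keys f.
    Poly_Mapping.single m (Poly_Mapping.lookup f m * (2 ^ deg m - 2 ^ n)))"
  have mon: "monom_at (\<lambda>v. 2 ^ wt v * w v) m = 2 ^ deg m * monom_at w m" for w m
    by (simp add: monom_at_def deg_def power_mult_distrib prod.distrib power_sum power_mult)
  have "ev g w = 0" for w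
  proof -
    have "ev g w = ev f (\<lambda>v. 2 ^ wt v * w v) - 2 ^ n * ev f w"
      unfolding g_def ev_sum ev_single ev_def[of f] mon sum_distrib_left sum_subtractf[symmetric]
      by (intro sum.cong refl) (simp add: algebra_simps)
    then show ?thesis using assms(1) by simp
  qed
  then have "g = 0" by (rule ev_eq_0_imp)
  then have "Poly_Mapping.lookup g m = 0" by simp
  then have "Poly_Mapping.lookup f m * (2 ^ deg m - 2 ^ n) = 0"
    using assms(2) by (simp add: g_def lookup_sum lookup_single when_def)
  then have "(2::complex) ^ deg m = 2 ^ n" using assms(2) by (simp add: in_keys_iff)
  then have "of_nat (2 ^ deg m) = (of_nat (2 ^ n) :: complex)" by simp
  then have "(2::nat) ^ deg m = 2 ^ n" by (simp only: of_nat_eq_iff)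
  then show ?thesis by (simp add: deg_def)
qed

text \<open>Semi-invariance under a permutation matrix, whose inverse is its transpose and whose
  determinant is the sign.\<close>

lemma peval_permute:
  assumes f: "f \<in> H_set M p 1" and \<sigma>: "\<sigma> permutes {0..<M}" and A: "A \<in> carrier_mat p M"
  shows "peval f (mat_diag M (\<lambda>i. x (\<sigma> i))) (mat p M (\<lambda>(a, j). A $$ (a, \<sigma> j))) =
    signof \<sigma> * peval f (mat_diag M x) A"
proof -
  define g :: "complex mat" where "g = mat M M (\<lambda>(i, j). 1\<^sub>m M $$ (\<sigma> i, j))"
  define h where "h = transpose_mat g"
  have [simp]: "\<sigma> i < M" if "i < M" for i
    using permutes_in_image[OF \<sigma>, of i] that by simp
  have inj: "\<sigma> i = \<sigma> j \<longleftrightarrow> i = j" for i j using permutes_inj[OF \<sigma>] by (auto dest: injD)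
  have g: "g \<in> carrier_mat M M" and h: "h \<in> carrier_mat M M" by (simp_all add: g_def h_def)
  have gi: "g $$ (i, j) = (if j = \<sigma> i then 1 else 0)" if "i < M" "j < M" for i j
    using that by (auto simp: g_def)
  have hi: "h $$ (i, j) = (if i = \<sigma> j then 1 else 0)" if "i < M" "j < M" for i j
    using that by (auto simp: g_def h_def)
  have "det g = signof \<sigma> * det (1\<^sub>m M)"
    unfolding g_def using \<sigma> by (intro det_permute_rows) auto
  then have det_h: "det h = signof \<sigma>" unfolding h_def by (simp add: det_transpose[OF g])
  have gh: "g * h = 1\<^sub>m M"
    using g h by (intro eq_matI)
      (auto simp: scalar_prod_def gi hi inj if_distrib[of "\<lambda>x. x * _"] cong: if_cong)
  then have hg: "h * g = 1\<^sub>m M" using mat_mult_left_right_inverse[OF g h] by simp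
  have 1: "A * h = mat p M (\<lambda>(a, j). A $$ (a, \<sigma> j))"
    using A h by (intro eq_matI)
      (auto simp: scalar_prod_def hi if_distrib[of "\<lambda>x. _ * x"] cong: if_cong)
  have 2: "g * mat_diag M x = mat M M (\<lambda>(i, j). if j = \<sigma> i then x (\<sigma> i) else 0)"
    using g by (subst mat_diag_mult_right) (auto simp: gi intro!: eq_matI)
  have 3: "g * mat_diag M x * h = mat_diag M (\<lambda>i. x (\<sigma> i))"
    unfolding 2 using h by (intro eq_matI)
      (auto simp: scalar_prod_def hi inj mat_diag_def if_distrib[of "\<lambda>x. x * _"] cong: if_cong)
  show ?thesis
    using peval_conjugate[OF f g h gh hg _ A, of "mat_diag M x"]
    unfolding 1 3 by (simp add: det_h)
qed

text \<open>
  The torus forces a semi-invariant to be linear in each column of \<open>A\<close> on diagonal \<open>X\<close>, and the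
  permutation matrices force it to be alternating.
\<close>

lemma H_set_1_eq_sum_row_det:
  assumes f: "f \<in> H_set M p 1"
  obtains K :: "(entry \<Rightarrow>\<^sub>0 nat) set" and a c \<mu> where "finite K"
    "\<And>m i. m \<in> K \<Longrightarrow> i < M \<Longrightarrow> c m i < p"
    "f = (\<Sum>m\<in>K. Const (a m) * row_det p M (c m) (\<mu> m))"
proof -
  note fr = H_set_poly_ring[OF f]
  \<comment> \<open>The restriction of \<open>f\<close> to diagonal X, kept as a formal polynomial
    so that its monomials can be inspected.\<close>
  define f' where "f' = subst (\<lambda>v. case v of XE i j \<Rightarrow> if i = j then Var v else 0 | AE b i \<Rightarrow> Var v) f"
  have ev_f': "ev f' w = peval f (mat_diag M (\<lambda>i. w (XE i i))) (Aof p M w)" for w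
  proof -
    have "ev f' w = ev f (\<lambda>v. case v of XE i j \<Rightarrow> if i = j then w v else 0 | AE b i \<Rightarrow> w v)"
      unfolding f'_def ev_subst by (rule arg_cong[of _ _ "ev f"]) (auto split: entry.splits)
    also have "\<dots> = peval f (mat_diag M (\<lambda>i. w (XE i i))) (Aof p M w)"
      unfolding ev_eq_peval[OF fr]
      by (rule peval_cong[OF fr]) (auto simp: Xof_def Aof_def mat_diag_def)
    finally show ?thesis .
  qed
  have f'r: "f' \<in> poly_ring M p"
    unfolding poly_ring_iff_ev ev_f'
    by (auto intro!: peval_cong[OF fr] simp: entries_def mat_diag_def Aof_def)
  define K where "K = Poly_Mapping.keys f'"
  \<comment> \<open>The weight that counts only \<open>XE i j\<close> has total degree 0, because
    \<open>f'\<close> does not depend on this variable.\<close>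
  have offdiag: "Poly_Mapping.lookup m (XE i j) = 0" if "m \<in> K" "i \<noteq> j" for m i j
  proof -
    have "(\<Sum>v\<in>Poly_Mapping.keys m. (if v = XE i j then 1 else 0) * Poly_Mapping.lookup m v) = 0"
      by (rule keys_homogeneous[of f'])
        (use that in \<open>auto simp: ev_f' K_def intro!: peval_cong[OF fr] simp: mat_diag_def Aof_def\<close>)
    then have "XE i j \<notin> Poly_Mapping.keys m" by force
    then show ?thesis by (simp add: in_keys_iff)
  qed
  have "\<exists>b<p. Poly_Mapping.lookup m (AE b i) = 1 \<and>
      (\<forall>b'. b' \<noteq> b \<longrightarrow> Poly_Mapping.lookup m (AE b' i) = 0)" if m: "m \<in> K" and i: "i < M" for m i
  proof -
    define wt :: "entry \<Rightarrow> nat" where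
      "wt = (\<lambda>v. case v of XE _ _ \<Rightarrow> 0 | AE _ j \<Rightarrow> if j = i then 1 else 0)"
    have hom: "ev f' (\<lambda>v. 2 ^ wt v * w v) = 2 ^ 1 * ev f' w" for w
    proof -
      \<comment> \<open>This torus element doubles column \<open>i\<close> of A, commutes with every
        diagonal X and has determinant 2. Weight 1 therefore makes \<open>f'\<close> homogeneous of
        degree 1 in column \<open>i\<close>.\<close>
      define h where "h = mat_diag M (\<lambda>j. if j = i then (2::complex) else 1)"
      define g where "g = mat_diag M (\<lambda>j. if j = i then (1/2::complex) else 1)"
      have gh: "g * h = 1\<^sub>m M" "h * g = 1\<^sub>m M"
        unfolding g_def h_def mat_diag_diag by (auto simp: mat_diag_def intro!: eq_matI)
      let ?D = "mat_diag M (\<lambda>i. w (XE i i))"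
      have D: "g * ?D * h = ?D"
        unfolding g_def h_def by (auto simp: mat_diag_diag intro!: arg_cong[of _ _ "mat_diag M"])
      have "upper_triangular h" by (auto simp: h_def mat_diag_def upper_triangular_def)
      then have "det h = prod_list (diag_mat h)"
        by (rule det_upper_triangular[of _ M]) (simp add: h_def)
      also have "\<dots> = (\<Prod>j<M. if j = i then 2 else 1)"
        unfolding diag_mat_def prod.list_conv_set_nth
        by (auto simp: h_def mat_diag_def lessThan_atLeast0 intro!: prod.cong)
      also have "\<dots> = 2" using i by simp
      finally have det_h: "det h = 2" .
      have Ah: "Aof p M (\<lambda>v. 2 ^ wt v * w v) = Aof p M w * h"
        unfolding h_def by (subst mat_diag_mult_right[of _ p]) (auto simp: Aof_def wt_def intro!: eq_matI)
      have "ev f' (\<lambda>v. 2 ^ wt v * w v) = peval f (g * ?D * h) (Aof p M w * h)"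
        unfolding ev_f' Ah D by (simp add: wt_def)
      also have "\<dots> = det h ^ 1 * peval f ?D (Aof p M w)"
        by (rule peval_conjugate[OF f _ _ gh]) (simp_all add: g_def h_def)
      finally show ?thesis by (simp add: det_h ev_f')
    qed
    have "(\<Sum>v\<in>Poly_Mapping.keys m. wt v * Poly_Mapping.lookup m v) = 1"
      using keys_homogeneous[OF hom] m by (simp add: K_def)
    then obtain v where v: "v \<in> Poly_Mapping.keys m" "wt v * Poly_Mapping.lookup m v = 1"
      "\<And>u. u \<in> Poly_Mapping.keys m \<Longrightarrow> u \<noteq> v \<Longrightarrow> wt u * Poly_Mapping.lookup m u = 0"
      by (subst (asm) sum_eq_1_iff) auto
    then obtain b where b: "v = AE b i" by (auto simp: wt_def split: entry.splits if_splits)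
    have "v \<in> entries M p" using f'r m v(1) by (auto simp: poly_ring_def K_def)
    then have "b < p" by (auto simp: b entries_def)
    moreover have "Poly_Mapping.lookup m (AE b' i) = 0" if "b' \<noteq> b" for b'
      using v(3)[of "AE b' i"] that by (auto simp: b wt_def in_keys_iff)
    ultimately show ?thesis using v(2) by (auto simp: b wt_def)
  qed
  then obtain c where c: "\<And>m i. m \<in> K \<Longrightarrow> i < M \<Longrightarrow> c m i < p"
    "\<And>m i. m \<in> K \<Longrightarrow> i < M \<Longrightarrow> Poly_Mapping.lookup m (AE (c m i) i) = 1"
    "\<And>m i b. m \<in> K \<Longrightarrow> i < M \<Longrightarrow> b \<noteq> c m i \<Longrightarrow> Poly_Mapping.lookup m (AE b i) = 0"
    by metis
  define \<mu> where "\<mu> = (\<lambda>(m::entry \<Rightarrow>\<^sub>0 nat) i. Poly_Mapping.lookup m (XE i i))"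
  have mon: "monom_at w m = (\<Prod>i<M. w (AE (c m i) i) * w (XE i i) ^ \<mu> m i)" if m: "m \<in> K" for m w
  proof -
    let ?S1 = "(\<lambda>i. XE i i) ` {..<M}" and ?S2 = "(\<lambda>i. AE (c m i) i) ` {..<M}"
    have "Poly_Mapping.keys m \<subseteq> ?S1 \<union> ?S2"
    proof
      fix v assume v: "v \<in> Poly_Mapping.keys m"
      then have "v \<in> entries M p" using f'r m by (auto simp: poly_ring_def K_def)
      then consider i j where "v = XE i j" "i < M" | b i where "v = AE b i" "i < M"
        by (auto simp: entries_def)
      then show "v \<in> ?S1 \<union> ?S2"
      proof cases
        case 1
        with v offdiag[OF m, of i j] have "i = j" by (auto simp: in_keys_iff)
        with 1 show ?thesis by simp
      next
        case 2
        with v c(3)[OF m, of i b] have "b = c m i" by (auto simp: in_keys_iff)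
        with 2 show ?thesis by simp
      qed
    qed
    then have "monom_at w m = (\<Prod>v\<in>?S1 \<union> ?S2. w v ^ Poly_Mapping.lookup m v)"
      by (simp add: monom_at_superset)
    also have "\<dots> = (\<Prod>v\<in>?S1. w v ^ Poly_Mapping.lookup m v) * (\<Prod>v\<in>?S2. w v ^ Poly_Mapping.lookup m v)"
      by (intro prod.union_disjoint) auto
    also have "\<dots> = (\<Prod>i<M. w (XE i i) ^ \<mu> m i) * (\<Prod>i<M. w (AE (c m i) i))"
      by (subst (1 2) prod.reindex) (auto simp: inj_on_def \<mu>_def c(2)[OF m])
    finally show ?thesis by (simp add: prod.distrib mult.commute)
  qed
  have diag: "peval f (mat_diag M x) A =
      (\<Sum>m\<in>K. Poly_Mapping.lookup f' m * (\<Prod>i<M. A $$ (c m i, i) * x i ^ \<mu> m i))"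
    if A: "A \<in> carrier_mat p M" for x A
  proof -
    let ?w = "asg (mat_diag M x) A"
    have "peval f (mat_diag M x) A = ev f' ?w"
      unfolding ev_f' using A
      by (intro peval_cong[OF fr]) (auto simp: asg_def mat_diag_def)
    also have "\<dots> = (\<Sum>m\<in>K. Poly_Mapping.lookup f' m * (\<Prod>i<M. A $$ (c m i, i) * x i ^ \<mu> m i))"
      unfolding ev_def by (rule sum.cong) (auto simp: mon asg_def mat_diag_def K_def)
    finally show ?thesis .
  qed
  \<comment> \<open>Being alternating on diagonal X, \<open>f\<close> equals its signed average over
    the M! permutations, and the average of a monomial that is linear in each column is a
    determinant.\<close>
  let ?F = "\<Sum>m\<in>K. Const (Poly_Mapping.lookup f' m / fact M) * row_det p M (c m) (\<mu> m)"
  have F: "?F \<in> H_set M p 1"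
    by (intro H_set_sum H_set_Const row_det_in_H_set c(1))
  have "f - ?F = 0"
  proof (rule H_set_eq_0I[OF H_set_diff[OF f F]])
    fix x and A :: "complex mat" assume A: "A \<in> carrier_mat p M"
    let ?P = "{\<sigma>. \<sigma> permutes {0..<M}}"
    have "fact M * peval f (mat_diag M x) A =
        (\<Sum>\<sigma>\<in>?P. peval f (mat_diag M x) A)"
      by (simp add: card_permutations)
    also have "\<dots> = (\<Sum>\<sigma>\<in>?P. signof \<sigma> *
        peval f (mat_diag M (\<lambda>i. x (\<sigma> i))) (mat p M (\<lambda>(a, j). A $$ (a, \<sigma> j))))"
      using peval_permute[OF f _ A]
      by (intro sum.cong refl) (simp add: sign_def)
    also have "\<dots> = (\<Sum>\<sigma>\<in>?P. \<Sum>m\<in>K. Poly_Mapping.lookup f' m *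
        (signof \<sigma> * (\<Prod>i = 0..<M. A $$ (c m i, \<sigma> i) * x (\<sigma> i) ^ \<mu> m i)))"
      by (intro sum.cong refl, subst diag)
        (auto simp: c(1) sum_distrib_left mult_ac lessThan_atLeast0 intro!: sum.cong prod.cong)
    also have "\<dots> = (\<Sum>m\<in>K. Poly_Mapping.lookup f' m *
        (\<Sum>\<sigma>\<in>?P. signof \<sigma> * (\<Prod>i = 0..<M. A $$ (c m i, \<sigma> i) * x (\<sigma> i) ^ \<mu> m i)))"
      by (subst sum.swap) (simp add: sum_distrib_left)
    also have "\<dots> = (\<Sum>m\<in>K. Poly_Mapping.lookup f' m *
        peval (row_det p M (c m) (\<mu> m)) (mat_diag M x) A)"
    proof (intro sum.cong refl)
      fix m assume m: "m \<in> K"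
      have "(\<Prod>i = 0..<M. A $$ (c m i, \<sigma> i) * x (\<sigma> i) ^ \<mu> m i) =
          (\<Prod>i = 0..<M. mat M M (\<lambda>(i, j). A $$ (c m i, j) * x j ^ \<mu> m i) $$ (i, \<sigma> i))"
        if "\<sigma> permutes {0..<M}" for \<sigma>
        using permutes_in_image[OF that] by (intro prod.cong) auto
      then show "Poly_Mapping.lookup f' m *
          (\<Sum>\<sigma>\<in>?P. signof \<sigma> * (\<Prod>i = 0..<M. A $$ (c m i, \<sigma> i) * x (\<sigma> i) ^ \<mu> m i)) =
        Poly_Mapping.lookup f' m * peval (row_det p M (c m) (\<mu> m)) (mat_diag M x) A"
        using c(1)[OF m] A by (simp add: peval_row_det_diag det_def'[of _ M])
    qed
    also have "\<dots> = fact M * peval ?F (mat_diag M x) A"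
      by (simp add: sum_distrib_left)
    finally show "peval (f - ?F) (mat_diag M x) A = 0" by simp
  qed
  then show ?thesis using that[of K c "\<lambda>m. Poly_Mapping.lookup f' m / fact M" \<mu>] c(1)
    by (auto simp: K_def)
qed


section \<open>The current algebra as a derivation\<close>

lemma index_mult_mat_sum:
  assumes "A \<in> carrier_mat nr n" "B \<in> carrier_mat n nc" "i < nr" "j < nc"
  shows "(A * B) $$ (i, j) = (\<Sum>l<n. A $$ (i, l) * B $$ (l, j))"
  using assms by (simp add: scalar_prod_def lessThan_atLeast0)

lemma pow_mat_add:
  assumes "X \<in> carrier_mat n n"
  shows "X ^\<^sub>m (a + b) = X ^\<^sub>m a * X ^\<^sub>m b"
proof (induction b)
  case 0
  then show ?case using assms by simp
next
  case (Suc b)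
  then show ?case using assms by (simp add: assoc_mult_mat[of _ n n _ n _ n])
qed

text \<open>The vector field of the current \<open>Y\<close>: at (X, A) it is the sum over m of
  \<open>Y_m^T A X^m\<close>, where \<open>Y_m\<close> is the matrix of coefficients of z^m. Only A
  moves.\<close>

definition act_dir :: "nat \<Rightarrow> nat \<Rightarrow> complex poly mat \<Rightarrow> complex mat \<Rightarrow> complex mat \<Rightarrow> complex mat" where
  "act_dir M p Y X A = mat p M (\<lambda>(b, j). \<Sum>a<p. \<Sum>m\<le>degree (Y $$ (a, b)).
     poly.coeff (Y $$ (a, b)) m * (A * X ^\<^sub>m m) $$ (a, j))"

lemma act_dir_carrier [simp]: "act_dir M p Y X A \<in> carrier_mat p M"
  by (simp add: act_dir_def)

lemma ev_elem_act:
  assumes "a < p"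
  shows "ev (elem_act M a b m f) w =
    (\<Sum>j<M. (Aof p M w * Xof M w ^\<^sub>m m) $$ (a, j) * ev (partial_deriv (AE b j) f) w)"
proof -
  have X: "ev ((X_mat M ^\<^sub>m m) $$ (i, j)) w = (Xof M w ^\<^sub>m m) $$ (i, j)" if "i < M" "j < M" for i j
  proof -
    have "map_mat (\<lambda>f. ev f w) (X_mat M ^\<^sub>m m) = Xof M w ^\<^sub>m m"
      by (simp add: ev_hom.mat_hom_pow[of _ M] map_ev_X_mat)
    from arg_cong[OF this, of "\<lambda>B. B $$ (i, j)"] show ?thesis
      using that carrier_matD[OF pow_carrier_mat[OF X_mat_carrier[of M], of m]] by simp
  qed
  have "(Aof p M w * Xof M w ^\<^sub>m m) $$ (a, j) = (\<Sum>i<M. w (AE a i) * (Xof M w ^\<^sub>m m) $$ (i, j))"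
    if "j < M" for j
    using assms that carrier_matD[OF pow_carrier_mat[OF Xof_carrier[of M w], of m]]
    by (simp add: scalar_prod_def lessThan_atLeast0 Aof_def)
  then show ?thesis
    unfolding elem_act_def
    by (subst sum.swap) (simp add: X sum_distrib_right mult.assoc)
qed

lemma ev_gl_act:
  "ev (gl_act M p Y f) w = (\<Sum>b<p. \<Sum>j<M.
     act_dir M p Y (Xof M w) (Aof p M w) $$ (b, j) * ev (partial_deriv (AE b j) f) w)"
proof -
  let ?c = "\<lambda>a b m j. poly.coeff (Y $$ (a, b)) m * (Aof p M w * Xof M w ^\<^sub>m m) $$ (a, j)"
  let ?d = "\<lambda>b j. ev (partial_deriv (AE b j) f) w"
  have "ev (gl_act M p Y f) w =
      (\<Sum>a<p. \<Sum>b<p. \<Sum>m\<le>degree (Y $$ (a, b)). \<Sum>j<M. ?c a b m j * ?d b j)"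
    by (simp add: gl_act_def ev_elem_act[of _ p] sum_distrib_left mult.assoc)
  also have "\<dots> = (\<Sum>b<p. \<Sum>a<p. \<Sum>m\<le>degree (Y $$ (a, b)). \<Sum>j<M. ?c a b m j * ?d b j)"
    by (rule sum.swap)
  also have "\<dots> = (\<Sum>b<p. \<Sum>a<p. \<Sum>j<M. \<Sum>m\<le>degree (Y $$ (a, b)). ?c a b m j * ?d b j)"
    by (intro sum.cong refl sum.swap)
  also have "\<dots> = (\<Sum>b<p. \<Sum>j<M. \<Sum>a<p. \<Sum>m\<le>degree (Y $$ (a, b)). ?c a b m j * ?d b j)"
    by (intro sum.cong refl sum.swap)
  also have "\<dots> = (\<Sum>b<p. \<Sum>j<M. act_dir M p Y (Xof M w) (Aof p M w) $$ (b, j) * ?d b j)"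
    by (simp add: act_dir_def sum_distrib_right)
  finally show ?thesis .
qed

lemma has_field_derivative_gl_act_ev:
  assumes f: "f \<in> poly_ring M p"
  shows "((\<lambda>t. peval f (Xof M w) (Aof p M w + t \<cdot>\<^sub>m act_dir M p Y (Xof M w) (Aof p M w)))
     has_field_derivative ev (gl_act M p Y f) w) (at 0)"
proof -
  let ?D = "act_dir M p Y (Xof M w) (Aof p M w)"
  let ?S = "(\<lambda>(b, j). AE b j) ` ({..<p} \<times> {..<M})"
  define u where "u = (\<lambda>v. case v of XE _ _ \<Rightarrow> 0 | AE b j \<Rightarrow> if b < p \<and> j < M then ?D $$ (b, j) else 0)"
  have "((\<lambda>t. ev f (\<lambda>v. w v + t * u v)) has_field_derivative
      (\<Sum>v\<in>?S. u v * ev (partial_deriv v f) w)) (at 0)"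
    by (rule has_field_derivative_ev_line) (auto simp: u_def split: entry.splits)
  also have "(\<Sum>v\<in>?S. u v * ev (partial_deriv v f) w) = ev (gl_act M p Y f) w"
    unfolding ev_gl_act sum.cartesian_product
    by (subst sum.reindex) (auto simp: inj_on_def u_def intro!: sum.cong)
  also have "(\<lambda>t. ev f (\<lambda>v. w v + t * u v)) =
      (\<lambda>t. peval f (Xof M w) (Aof p M w + t \<cdot>\<^sub>m ?D))"
    unfolding ev_eq_peval[OF f]
    by (intro ext peval_cong[OF f]) (auto simp: Xof_def Aof_def u_def act_dir_def)
  finally show ?thesis .
qed

lemma gl_act_poly_ring:
  assumes f: "f \<in> poly_ring M p"
  shows "gl_act M p Y f \<in> poly_ring M p"
  unfolding poly_ring_iff_ev
proof (intro allI impI)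
  fix w w' :: "entry \<Rightarrow> complex"
  assume w: "\<forall>v\<in>entries M p. w v = w' v"
  have eq: "Xof M w = Xof M w'" "Aof p M w = Aof p M w'"
    using w by (auto simp: Xof_def Aof_def entries_def intro!: eq_matI)
  show "ev (gl_act M p Y f) w = ev (gl_act M p Y f) w'"
    using has_field_derivative_gl_act_ev[OF f, of w Y] has_field_derivative_gl_act_ev[OF f, of w' Y]
    unfolding eq by (rule DERIV_unique)
qed

lemma has_field_derivative_gl_act:
  assumes "f \<in> poly_ring M p" "X \<in> carrier_mat M M" "A \<in> carrier_mat p M"
  shows "((\<lambda>t. peval f X (A + t \<cdot>\<^sub>m act_dir M p Y X A))
     has_field_derivative peval (gl_act M p Y f) X A) (at 0)"
  using has_field_derivative_gl_act_ev[OF assms(1), of "asg X A" Y] assms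
  by (simp add: peval_def[of "gl_act M p Y f"])

text \<open>The vector field is equivariant: at (g X h, A h) it is the field at (X, A) times
  \<open>h\<close>. Hence semi-invariance can be differentiated along it, and the factor
  \<open>det h ^ l\<close> is constant.\<close>

lemma gl_act_H_set:
  assumes f: "f \<in> H_set M p l"
  shows "gl_act M p Y f \<in> H_set M p l"
  unfolding H_set_iff
proof (intro conjI ballI impI)
  note fr = H_set_poly_ring[OF f]
  show "gl_act M p Y f \<in> poly_ring M p" using fr by (rule gl_act_poly_ring)
  fix g h X A :: "complex mat"
  assume gh: "g \<in> carrier_mat M M" "h \<in> carrier_mat M M" "g * h = 1\<^sub>m M \<and> h * g = 1\<^sub>m M"
    and X: "X \<in> carrier_mat M M" and A: "A \<in> carrier_mat p M"
  let ?D = "act_dir M p Y X A"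
  have D: "act_dir M p Y (g * X * h) (A * h) = ?D * h"
  proof (rule eq_matI)
    fix b j assume "b < dim_row (?D * h)" "j < dim_col (?D * h)"
    then have bj: "b < p" "j < M" using gh by (auto simp: act_dir_def)
    have entry: "((A * h) * (g * X * h) ^\<^sub>m m) $$ (a, j) = (\<Sum>i<M. (A * X ^\<^sub>m m) $$ (a, i) * h $$ (i, j))"
      if "a < p" for a m
      unfolding mult_conjugate_pow[OF gh(1,2) gh(3)[THEN conjunct1] gh(3)[THEN conjunct2] X A]
      using gh X A bj that pow_carrier_mat[OF X, of m]
      by (intro index_mult_mat_sum[of _ p]) auto
    have "(?D * h) $$ (b, j) = (\<Sum>i<M. (\<Sum>a<p. \<Sum>m\<le>degree (Y $$ (a, b)).
        poly.coeff (Y $$ (a, b)) m * (A * X ^\<^sub>m m) $$ (a, i)) * h $$ (i, j))"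
      using bj gh by (simp add: scalar_prod_def lessThan_atLeast0 act_dir_def)
    also have "\<dots> = (\<Sum>a<p. \<Sum>m\<le>degree (Y $$ (a, b)).
        poly.coeff (Y $$ (a, b)) m * (\<Sum>i<M. (A * X ^\<^sub>m m) $$ (a, i) * h $$ (i, j)))"
      unfolding sum_distrib_right sum_distrib_left mult.assoc
      by (subst sum.swap, rule sum.cong[OF refl], rule sum.swap)
    also have "\<dots> = act_dir M p Y (g * X * h) (A * h) $$ (b, j)"
      using bj by (simp add: act_dir_def entry)
    finally show "act_dir M p Y (g * X * h) (A * h) $$ (b, j) = (?D * h) $$ (b, j)" by simp
  qed (use gh in \<open>auto simp: act_dir_def\<close>)
  have "A * h + t \<cdot>\<^sub>m (?D * h) = (A + t \<cdot>\<^sub>m ?D) * h" for t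
    using gh A by (subst add_mult_distrib_mat[of _ p M]) (auto simp: mult_smult_assoc_mat[of _ p M])
  then have "peval f (g * X * h) (A * h + t \<cdot>\<^sub>m act_dir M p Y (g * X * h) (A * h)) =
      det h ^ l * peval f X (A + t \<cdot>\<^sub>m ?D)" for t
    unfolding D using gh X A by (simp only:) (rule peval_conjugate[OF f], auto)
  then have "((\<lambda>t. det h ^ l * peval f X (A + t \<cdot>\<^sub>m ?D)) has_field_derivative
      peval (gl_act M p Y f) (g * X * h) (A * h)) (at 0)"
    using has_field_derivative_gl_act[OF fr, of "g * X * h" "A * h" Y] gh X A by simp
  moreover have "((\<lambda>t. det h ^ l * peval f X (A + t \<cdot>\<^sub>m ?D)) has_field_derivative
      det h ^ l * peval (gl_act M p Y f) X A) (at 0)"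
    by (intro DERIV_cmult has_field_derivative_gl_act fr X A)
  ultimately show "peval (gl_act M p Y f) (g * X * h) (A * h) = det h ^ l * peval (gl_act M p Y f) X A"
    by (rule DERIV_unique)
qed

section \<open>Derivatives of determinants, and the Cartan currents\<close>

lemma has_field_derivative_det:
  fixes R S :: "nat \<Rightarrow> nat \<Rightarrow> complex"
  shows "((\<lambda>t. det (mat n n (\<lambda>(i, j). R i j + t * S i j))) has_field_derivative
    (\<Sum>i<n. det (mat n n (\<lambda>(r, j). if r = i then S r j else R r j)))) (at 0)"
proof -
  let ?P = "{\<sigma>. \<sigma> permutes {0..<n}}"
  have det: "det (mat n n (\<lambda>(i, j). F i j)) = (\<Sum>\<sigma>\<in>?P. signof \<sigma> * (\<Prod>i<n. F i (\<sigma> i)))"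
    for F :: "nat \<Rightarrow> nat \<Rightarrow> complex"
    by (subst det_def'[of _ n]) (auto simp: permutes_in_image lessThan_atLeast0 intro!: sum.cong prod.cong)
  have "((\<lambda>t. \<Sum>\<sigma>\<in>?P. signof \<sigma> * (\<Prod>i<n. R i (\<sigma> i) + t * S i (\<sigma> i))) has_field_derivative
      (\<Sum>\<sigma>\<in>?P. signof \<sigma> * (\<Sum>i<n. S i (\<sigma> i) * (\<Prod>r\<in>{..<n} - {i}. R r (\<sigma> r) + 0 * S r (\<sigma> r))))) (at 0)"
    by (intro DERIV_sum DERIV_cmult has_field_derivative_prod) (auto intro!: derivative_eq_intros)
  also have "(\<Sum>\<sigma>\<in>?P. signof \<sigma> * (\<Sum>i<n. S i (\<sigma> i) * (\<Prod>r\<in>{..<n} - {i}. R r (\<sigma> r) + 0 * S r (\<sigma> r)))) =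
      (\<Sum>\<sigma>\<in>?P. signof \<sigma> * (\<Sum>i<n. \<Prod>r<n. if r = i then S r (\<sigma> r) else R r (\<sigma> r)))"
  proof (intro sum.cong refl arg_cong2[of _ _ _ _ "(*)"])
    fix \<sigma> i assume "i \<in> {..<n}"
    then show "S i (\<sigma> i) * (\<Prod>r\<in>{..<n} - {i}. R r (\<sigma> r) + 0 * S r (\<sigma> r)) =
        (\<Prod>r<n. if r = i then S r (\<sigma> r) else R r (\<sigma> r))"
      by (subst (2) prod.remove[of _ i]) (auto intro!: prod.cong)
  qed
  also have "\<dots> = (\<Sum>i<n. \<Sum>\<sigma>\<in>?P. signof \<sigma> * (\<Prod>r<n. if r = i then S r (\<sigma> r) else R r (\<sigma> r)))"
    unfolding sum_distrib_left by (rule sum.swap)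
  finally show ?thesis unfolding det .
qed

lemma has_field_derivative_det_trace:
  fixes Z :: "complex mat"
  assumes Z: "Z \<in> carrier_mat n n"
  shows "((\<lambda>t. det (1\<^sub>m n + t \<cdot>\<^sub>m Z)) has_field_derivative (\<Sum>i<n. Z $$ (i, i))) (at 0)"
proof -
  have "det (mat n n (\<lambda>(r, j). if r = i then Z $$ (r, j) else if r = j then 1 else 0)) = Z $$ (i, i)"
    (is "det ?E = _") if i: "i < n" for i
  proof -
    let ?P = "{\<sigma>. \<sigma> permutes {0..<n}}"
    \<comment> \<open>A permutation other than the identity moves at least two indices, hence some
      \<open>r\<close> different from \<open>i\<close>; row \<open>r\<close> is a unit row and
      contributes the factor 0.\<close>
    have 0: "signof \<sigma> * (\<Prod>r = 0..<n. ?E $$ (r, \<sigma> r)) = 0" if \<sigma>: "\<sigma> permutes {0..<n}" "\<sigma> \<noteq> id" for \<sigma>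
    proof -
      have "\<exists>r. r \<noteq> i \<and> \<sigma> r \<noteq> r"
      proof (rule ccontr)
        assume "\<nexists>r. r \<noteq> i \<and> \<sigma> r \<noteq> r"
        then have "\<sigma> permutes {i}" by (intro permutes_superset[OF \<sigma>(1)]) auto
        then show False using \<sigma>(2) by (simp add: permutes_sing id_def)
      qed
      then obtain r where r: "r \<noteq> i" "\<sigma> r \<noteq> r" by blast
      then have "r < n" using \<sigma>(1) by (auto simp: permutes_def)
      moreover have "\<sigma> r < n" using permutes_in_image[OF \<sigma>(1), of r] \<open>r < n\<close> by simp
      ultimately show ?thesis using r by (auto intro!: prod_zero bexI[of _ r])
    qed
    have "det ?E = (\<Sum>\<sigma>\<in>?P. signof \<sigma> * (\<Prod>r = 0..<n. ?E $$ (r, \<sigma> r)))"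
      by (rule det_def') simp
    also have "\<dots> = (\<Sum>\<sigma>\<in>{id}. signof \<sigma> * (\<Prod>r = 0..<n. ?E $$ (r, \<sigma> r)))"
      using 0 by (intro sum.mono_neutral_right) (auto simp: finite_permutations permutes_id)
    also have "\<dots> = (\<Prod>r = 0..<n. if r = i then Z $$ (r, r) else 1)"
      by (simp add: sign_id cong: if_cong)
    finally show ?thesis using i by simp
  qed
  then have "(\<Sum>i<n. det (mat n n (\<lambda>(r, j). if r = i then Z $$ (r, j) else if r = j then 1 else 0))) =
      (\<Sum>i<n. Z $$ (i, i))" by simp
  moreover have "1\<^sub>m n + t \<cdot>\<^sub>m Z = mat n n (\<lambda>(i, j). (if i = j then 1 else 0) + t * Z $$ (i, j))" for t
    using Z by (auto intro!: eq_matI)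
  ultimately show ?thesis
    using has_field_derivative_det[of n "\<lambda>i j. if i = j then 1 else 0" "\<lambda>i j. Z $$ (i, j)"] by simp
qed

text \<open>For \<open>a \<noteq> b\<close> this is the current
  \<open>(E^a_a - E^b_b) \<otimes> z^m\<close>.\<close>

definition cartan :: "nat \<Rightarrow> nat \<Rightarrow> nat \<Rightarrow> nat \<Rightarrow> complex poly mat" where
  "cartan p a b m = mat p p (\<lambda>(i, j). if i \<noteq> j then 0
     else if i = a then Polynomial.monom 1 m else if i = b then - Polynomial.monom 1 m else 0)"

lemma cartan_sl_current:
  assumes "a < p" "b < p" "a \<noteq> b"
  shows "cartan p a b m \<in> sl_current p"
proof -
  let ?m = "Polynomial.monom 1 m :: complex poly"
  have "(\<Sum>i<p. cartan p a b m $$ (i, i)) = (\<Sum>i<p. (if i = a then ?m else 0) + (if i = b then - ?m else 0))"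
    using assms by (intro sum.cong) (auto simp: cartan_def)
  also have "\<dots> = 0" using assms by (simp add: sum.distrib)
  finally show ?thesis by (simp add: sl_current_def cartan_def)
qed

text \<open>The Leibniz rule for a determinant in its rows: the field sends a row of A X^n of colour
  \<open>a\<close> to the same row of A X^(n + m), one of colour \<open>b\<close> to its negative,
  and rows of other colours to 0.\<close>

lemma gl_act_cartan_row_det:
  assumes ab: "a < p" "b < p" "a \<noteq> b" and c: "\<And>i. i < M \<Longrightarrow> c i < p"
  shows "gl_act M p (cartan p a b m) (row_det p M c \<mu>) =
    (\<Sum>i | i < M \<and> c i = a. row_det p M c (\<mu>(i := \<mu> i + m))) -
    (\<Sum>i | i < M \<and> c i = b. row_det p M c (\<mu>(i := \<mu> i + m)))" (is "?L = ?R")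
proof (rule poly_ring_eqI[of _ M p])
  define s :: "nat \<Rightarrow> complex" where "s = (\<lambda>i. if i = a then 1 else if i = b then -1 else 0)"
  have R: "row_det p M c \<nu> \<in> poly_ring M p" for \<nu>
    using row_det_in_H_set[OF c] by (rule H_set_poly_ring)
  show "?L \<in> poly_ring M p" using R by (rule gl_act_poly_ring)
  have "?R \<in> H_set M p 1"
    by (intro H_set_diff H_set_sum row_det_in_H_set c)
  then show "?R \<in> poly_ring M p" by (rule H_set_poly_ring)
  fix X A :: "complex mat" assume X: "X \<in> carrier_mat M M" and A: "A \<in> carrier_mat p M"
  let ?D = "act_dir M p (cartan p a b m) X A"
  have D: "?D $$ (r, j) = s r * (A * X ^\<^sub>m m) $$ (r, j)" if "r < p" "j < M" for r j
  proof -
    have "(\<Sum>n\<le>degree (cartan p a b m $$ (i, r)). poly.coeff (cartan p a b m $$ (i, r)) n * (A * X ^\<^sub>m n) $$ (i, j))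
        = (if i = r then s r * (A * X ^\<^sub>m m) $$ (r, j) else 0)" if "i < p" for i
      using that \<open>r < p\<close> ab by (auto simp: cartan_def s_def degree_monom_eq if_distrib[of "\<lambda>c. c * _"]
          sum_negf cong: if_cong)
    then show ?thesis using that by (simp add: act_dir_def)
  qed
  have powX: "X ^\<^sub>m n \<in> carrier_mat M M" for n using X by simp
  have entry: "((A + t \<cdot>\<^sub>m ?D) * X ^\<^sub>m \<mu> i) $$ (c i, j) =
      (A * X ^\<^sub>m \<mu> i) $$ (c i, j) + t * (s (c i) * (A * X ^\<^sub>m (\<mu> i + m)) $$ (c i, j))"
    if "i < M" "j < M" for i j t
  proof -
    have "A * X ^\<^sub>m (m + \<mu> i) = (A * X ^\<^sub>m m) * X ^\<^sub>m \<mu> i"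
      unfolding pow_mat_add[OF X] using A powX by (intro assoc_mult_mat[of _ p M _ M _ M, symmetric]) auto
    then have "A * X ^\<^sub>m (\<mu> i + m) = (A * X ^\<^sub>m m) * X ^\<^sub>m \<mu> i" by (simp add: add.commute)
    then have AX: "(A * X ^\<^sub>m (\<mu> i + m)) $$ (c i, j) = (\<Sum>r<M. (A * X ^\<^sub>m m) $$ (c i, r) * (X ^\<^sub>m \<mu> i) $$ (r, j))"
      using A powX c[OF that(1)] that by (simp only: index_mult_mat_sum[of _ p M _ M] mult_carrier_mat[of A p M])
    have "((A + t \<cdot>\<^sub>m ?D) * X ^\<^sub>m \<mu> i) $$ (c i, j) =
        (\<Sum>r<M. (A + t \<cdot>\<^sub>m ?D) $$ (c i, r) * (X ^\<^sub>m \<mu> i) $$ (r, j))"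
      using A powX c[OF that(1)] that by (intro index_mult_mat_sum[of _ p]) auto
    also have "\<dots> = (\<Sum>r<M. A $$ (c i, r) * (X ^\<^sub>m \<mu> i) $$ (r, j)) +
        t * (s (c i) * (\<Sum>r<M. (A * X ^\<^sub>m m) $$ (c i, r) * (X ^\<^sub>m \<mu> i) $$ (r, j)))"
      unfolding sum_distrib_left sum.distrib[symmetric]
      using A c[OF that(1)] carrier_matD[OF act_dir_carrier[of M p "cartan p a b m" X A]]
      by (intro sum.cong refl) (simp add: D algebra_simps del: index_mult_mat(1))
    also have "(\<Sum>r<M. A $$ (c i, r) * (X ^\<^sub>m \<mu> i) $$ (r, j)) = (A * X ^\<^sub>m \<mu> i) $$ (c i, j)"
      using A powX c[OF that(1)] that by (intro index_mult_mat_sum[of _ p, symmetric]) auto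
    finally show ?thesis unfolding AX .
  qed
  have rd: "peval (row_det p M c \<mu>) X (A + t \<cdot>\<^sub>m ?D) = det (mat M M (\<lambda>(i, j).
      (A * X ^\<^sub>m \<mu> i) $$ (c i, j) + t * (s (c i) * (A * X ^\<^sub>m (\<mu> i + m)) $$ (c i, j))))" for t
    using X A c
    by (subst peval_row_det) (auto simp: entry intro!: arg_cong[of _ _ det] eq_matI)
  have row: "det (mat M M (\<lambda>(r, j). if r = i then s (c r) * (A * X ^\<^sub>m (\<mu> r + m)) $$ (c r, j)
        else (A * X ^\<^sub>m \<mu> r) $$ (c r, j))) =
      s (c i) * peval (row_det p M c (\<mu>(i := \<mu> i + m))) X A" if "i < M" for i
  proof -
    let ?B = "mat M M (\<lambda>(r, j). (A * X ^\<^sub>m ((\<mu>(i := \<mu> i + m)) r)) $$ (c r, j))"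
    have "mat M M (\<lambda>(r, j). if r = i then s (c r) * (A * X ^\<^sub>m (\<mu> r + m)) $$ (c r, j)
        else (A * X ^\<^sub>m \<mu> r) $$ (c r, j)) = multrow i (s (c i)) ?B"
      using that by (intro eq_matI) (auto simp: mat_multrow_gen_def)
    then show ?thesis
      using that X A c by (simp add: det_multrow[of i M] peval_row_det del: fun_upd_apply)
  qed
  have "((\<lambda>t. peval (row_det p M c \<mu>) X (A + t \<cdot>\<^sub>m ?D)) has_field_derivative
      (\<Sum>i<M. s (c i) * peval (row_det p M c (\<mu>(i := \<mu> i + m))) X A)) (at 0)"
    unfolding rd
    using has_field_derivative_det[of M "\<lambda>i j. (A * X ^\<^sub>m \<mu> i) $$ (c i, j)"
        "\<lambda>i j. s (c i) * (A * X ^\<^sub>m (\<mu> i + m)) $$ (c i, j)"]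
    by (simp add: row)
  from DERIV_unique[OF has_field_derivative_gl_act[OF R X A] this]
  have "peval ?L X A = (\<Sum>i<M. s (c i) * peval (row_det p M c (\<mu>(i := \<mu> i + m))) X A)" .
  also have "\<dots> = (\<Sum>i<M. (if c i = a then peval (row_det p M c (\<mu>(i := \<mu> i + m))) X A else 0) -
      (if c i = b then peval (row_det p M c (\<mu>(i := \<mu> i + m))) X A else 0))"
    using ab by (intro sum.cong) (auto simp: s_def)
  also have "\<dots> = peval ?R X A"
    by (simp add: sum_subtractf sum.If_cases Int_def)
  finally show "peval ?L X A = peval ?R X A" .
qed


section \<open>The level-rank map annihilates the current algebra\<close>

lemma mult_add_less:
  fixes s r N k :: nat
  assumes "s < N" "r < k"
  shows "s * k + r < N * k"
proof -
  have "s * k + r < Suc s * k" using assms by simp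
  also have "\<dots> \<le> N * k" using assms by (intro mult_le_mono) auto
  finally show ?thesis .
qed

lemma bij_betw_div_mod:
  fixes k N :: nat
  assumes "k > 0"
  shows "bij_betw (\<lambda>(s, r). s * k + r) ({..<N} \<times> {..<k}) {..<N * k}"
proof (rule bij_betw_byWitness[where f' = "\<lambda>i. (i div k, i mod k)"])
  show "(\<lambda>(s, r). s * k + r) ` ({..<N} \<times> {..<k}) \<subseteq> {..<N * k}"
    by (auto simp: mult_add_less)
  show "(\<lambda>i. (i div k, i mod k)) ` {..<N * k} \<subseteq> {..<N} \<times> {..<k}"
    using assms by (auto simp: less_mult_imp_div_less)
qed (use assms in auto)

lemma sum_div_mod:
  assumes "(k::nat) > 0"
  shows "(\<Sum>i<N * k. F i) = (\<Sum>s<N. \<Sum>r<k. F (s * k + r))"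
  unfolding sum.cartesian_product
  by (subst sum.reindex_bij_betw[OF bij_betw_div_mod[OF assms], symmetric]) (simp add: split_def)

lemma prod_div_mod:
  assumes "(k::nat) > 0"
  shows "(\<Prod>i<N * k. F i) = (\<Prod>s<N. \<Prod>r<k. F (s * k + r))"
  unfolding prod.cartesian_product
  by (subst prod.reindex_bij_betw[OF bij_betw_div_mod[OF assms], symmetric]) (simp add: split_def)

text \<open>
  The direct sum of \<open>k\<close> square matrices, with basis ordered as in a Kronecker product: the
  index \<open>i\<close> belongs to summand \<open>i mod k\<close>.
\<close>

definition interleave :: "nat \<Rightarrow> nat \<Rightarrow> (nat \<Rightarrow> complex mat) \<Rightarrow> complex mat" where
  "interleave k N B = mat (N * k) (N * k)
     (\<lambda>(i, j). if i mod k = j mod k then B (i mod k) $$ (i div k, j div k) else 0)"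

lemma interleave_carrier [simp]: "interleave k N B \<in> carrier_mat (N * k) (N * k)"
  by (simp add: interleave_def)

lemma interleave_one: "k > 0 \<Longrightarrow> interleave k N (\<lambda>_. 1\<^sub>m N) = 1\<^sub>m (N * k)"
  by (rule eq_matI) (auto simp: interleave_def less_mult_imp_div_less, metis mod_div_decomp)

lemma interleave_mult:
  assumes k: "k > 0" and "\<And>a. a < k \<Longrightarrow> B a \<in> carrier_mat N N" "\<And>a. a < k \<Longrightarrow> C a \<in> carrier_mat N N"
  shows "interleave k N B * interleave k N C = interleave k N (\<lambda>a. B a * C a)"
proof (rule eq_matI)
  fix i j assume "i < dim_row (interleave k N (\<lambda>a. B a * C a))" "j < dim_col (interleave k N (\<lambda>a. B a * C a))"
  then have ij: "i < N * k" "j < N * k" by (auto simp: interleave_def)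
  then have ij': "i div k < N" "j div k < N" "i mod k < k" using k by (auto simp: less_mult_imp_div_less)
  have lt: "s * k + r < N * k" if "s < N" "r < k" for s r
    using that by (rule mult_add_less)
  have "(interleave k N B * interleave k N C) $$ (i, j) =
      (\<Sum>l<N * k. interleave k N B $$ (i, l) * interleave k N C $$ (l, j))"
    using ij by (intro index_mult_mat_sum[of _ "N * k"]) auto
  also have "\<dots> = (\<Sum>s<N. \<Sum>r<k. if r = i mod k then
      (if i mod k = j mod k then B (i mod k) $$ (i div k, s) * C (i mod k) $$ (s, j div k) else 0) else 0)"
    unfolding sum_div_mod[OF k] using ij k
    by (intro sum.cong refl) (auto simp: interleave_def lt)
  also have "\<dots> = interleave k N (\<lambda>a. B a * C a) $$ (i, j)"
    using ij ij' assms(2,3)[OF ij'(3)]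
    by (auto simp: interleave_def index_mult_mat_sum[of _ N N _ N] simp del: index_mult_mat(1))
  finally show "(interleave k N B * interleave k N C) $$ (i, j) = interleave k N (\<lambda>a. B a * C a) $$ (i, j)" .
qed (auto simp: interleave_def)

text \<open>Reordering the basis would cost the sign of a permutation. Instead every summand is
  triangularized: among indices with the same residue, the order agrees with that of the quotients,
  so interleaved triangular matrices are again triangular and only diagonal entries remain.\<close>

lemma det_interleave:
  assumes k: "k > 0" and B: "\<And>a. a < k \<Longrightarrow> B a \<in> carrier_mat N N"
  shows "det (interleave k N B) = (\<Prod>a<k. det (B a))"
proof -
  have "\<exists>T P Q. similar_mat_wit (B a) T P Q \<and> upper_triangular T" if a: "a < k" for a
  proof -
    obtain es where es: "char_poly (B a) = (\<Prod>e\<leftarrow>es. [:- e, 1:])"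
      using char_poly_factorized[OF B[OF a]] by auto
    obtain T P Q where "schur_decomposition (B a) es = (T, P, Q)" by (metis prod_cases3)
    from schur_decomposition[OF B[OF a] es this] show ?thesis by blast
  qed
  then obtain T P Q where wit: "\<And>a. a < k \<Longrightarrow> similar_mat_wit (B a) (T a) (P a) (Q a)"
    and ut: "\<And>a. a < k \<Longrightarrow> upper_triangular (T a)" by metis
  note S = similar_mat_witD2[OF B wit]
  have I_cong: "interleave k N F = interleave k N G" if "\<And>a. a < k \<Longrightarrow> F a = G a" for F G
    using that k by (auto simp: interleave_def intro!: eq_matI)
  have "interleave k N B = interleave k N (\<lambda>a. P a * T a * Q a)"
    using S(3) by (rule I_cong)
  also have "\<dots> = interleave k N P * interleave k N T * interleave k N Q"
    using S(4-7) k by (simp add: interleave_mult mult_carrier_mat[of _ N N])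
  finally have "interleave k N B = interleave k N P * interleave k N T * interleave k N Q" .
  moreover have "interleave k N P * interleave k N Q = 1\<^sub>m (N * k)"
    unfolding interleave_one[OF k, symmetric]
    using S(1,6,7) k by (subst interleave_mult) (auto intro: I_cong)
  moreover have "interleave k N Q * interleave k N P = 1\<^sub>m (N * k)"
    unfolding interleave_one[OF k, symmetric]
    using S(2,6,7) k by (subst interleave_mult) (auto intro: I_cong)
  ultimately have "similar_mat_wit (interleave k N B) (interleave k N T) (interleave k N P) (interleave k N Q)"
    by (intro similar_mat_witI[of _ _ "N * k"]) (assumption | rule interleave_carrier)+
  then have "similar_mat (interleave k N B) (interleave k N T)" unfolding similar_mat_def by blast
  then have "det (interleave k N B) = det (interleave k N T)" by (rule det_similar)
  also have "\<dots> = prod_list (diag_mat (interleave k N T))"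
  proof (rule det_upper_triangular[of _ "N * k"])
    show "upper_triangular (interleave k N T)"
    proof (rule upper_triangularI)
      fix i j assume "j < i" "i < dim_row (interleave k N T)"
      then have ij: "j < i" "i < N * k" by (auto simp: interleave_def)
      show "interleave k N T $$ (i, j) = 0"
      proof (cases "i mod k = j mod k")
        case True
        have a: "i mod k < k" using k by simp
        have "j div k \<noteq> i div k" using ij True by (metis mod_div_decomp less_irrefl)
        then have "j div k < i div k" using div_le_mono[of j i k] ij by simp
        moreover have "i div k < N" using ij by (simp add: less_mult_imp_div_less)
        ultimately have "T (i mod k) $$ (i div k, j div k) = 0"
          using ut[OF a] carrier_matD[OF S(5)[OF a a]] by (auto simp: upper_triangular_def)
        then show ?thesis using ij True by (simp add: interleave_def)
      qed (use ij in \<open>simp add: interleave_def\<close>)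
    qed
  qed simp
  also have "\<dots> = (\<Prod>i<N * k. T (i mod k) $$ (i div k, i div k))"
    unfolding diag_mat_def prod.list_conv_set_nth
    by (auto simp: interleave_def lessThan_atLeast0 intro!: prod.cong)
  also have "\<dots> = (\<Prod>s<N. \<Prod>a<k. T a $$ (s, s))"
    unfolding prod_div_mod[OF k] by (intro prod.cong refl) auto
  also have "\<dots> = (\<Prod>a<k. \<Prod>s<N. T a $$ (s, s))" by (rule prod.swap)
  also have "\<dots> = (\<Prod>a<k. det (B a))"
  proof (intro prod.cong refl)
    fix a assume "a \<in> {..<k}"
    then have a: "a < k" by simp
    have "similar_mat (B a) (T a)" unfolding similar_mat_def using wit[OF a] by blast
    then have "det (B a) = det (T a)" by (rule det_similar)
    also have "\<dots> = prod_list (diag_mat (T a))"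
      using ut[OF a] S(5)[OF a a] by (rule det_upper_triangular)
    also have "\<dots> = (\<Prod>s<N. T a $$ (s, s))"
      unfolding diag_mat_def prod.list_conv_set_nth
      using S(5)[OF a a] by (auto simp: lessThan_atLeast0 intro!: prod.cong)
    finally show "(\<Prod>s<N. T a $$ (s, s)) = det (B a)" ..
  qed
  finally show ?thesis .
qed

section \<open>Kronecker products with an identity matrix\<close>

abbreviation kron1 :: "nat \<Rightarrow> complex mat \<Rightarrow> complex mat" where
  "kron1 k A \<equiv> kronecker A (1\<^sub>m k)"

lemma kron1_carrier: "A \<in> carrier_mat r c \<Longrightarrow> kronecker A (1\<^sub>m k) \<in> carrier_mat (r * k) (c * k)"
  by (simp add: kronecker_def)

lemma kron1_index:
  assumes "A \<in> carrier_mat r c" "i < r * k" "j < c * k"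
  shows "kron1 k A $$ (i, j) = (if i mod k = j mod k then A $$ (i div k, j div k) else 0)"
proof -
  have "k > 0" using assms(2) by (cases k) auto
  then show ?thesis using assms by (simp add: kronecker_def)
qed

lemma kron1_eq_interleave: "g \<in> carrier_mat N N \<Longrightarrow> kron1 k g = interleave k N (\<lambda>_. g)"
  by (intro eq_matI) (auto simp: kron1_index[of _ N N] interleave_def, auto simp: kronecker_def)

lemma det_kron1: "k > 0 \<Longrightarrow> g \<in> carrier_mat N N \<Longrightarrow> det (kron1 k g) = det g ^ k"
  by (simp add: kron1_eq_interleave det_interleave)

lemma kron1_mult:
  assumes A: "A \<in> carrier_mat r n" and B: "B \<in> carrier_mat n c"
  shows "kron1 k A * kron1 k B = kron1 k (A * B)"
proof (rule eq_matI)
  fix i j assume "i < dim_row (kron1 k (A * B))" "j < dim_col (kron1 k (A * B))"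
  then have ij: "i < r * k" "j < c * k" using A B by (auto simp: kronecker_def)
  then have k: "k > 0" by (cases k) auto
  have ij': "i div k < r" "j div k < c" "i mod k < k" using ij k by (auto simp: less_mult_imp_div_less)
  have lt: "s * k + a < n * k" if "s < n" "a < k" for s a
    using that by (rule mult_add_less)
  have "(kron1 k A * kron1 k B) $$ (i, j) = (\<Sum>l<n * k. kron1 k A $$ (i, l) * kron1 k B $$ (l, j))"
    using ij by (intro index_mult_mat_sum[of _ "r * k" "n * k" _ "c * k"] kron1_carrier A B)
  also have "\<dots> = (\<Sum>s<n. \<Sum>a<k. if a = i mod k then
      (if i mod k = j mod k then A $$ (i div k, s) * B $$ (s, j div k) else 0) else 0)"
    unfolding sum_div_mod[OF k] using ij k
    by (intro sum.cong refl) (auto simp: kron1_index[OF A] kron1_index[OF B] lt)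
  also have "\<dots> = kron1 k (A * B) $$ (i, j)"
    using ij ij' by (auto simp: kron1_index[OF mult_carrier_mat[OF A B]] index_mult_mat_sum[OF A B] simp del: index_mult_mat(1))
  finally show "(kron1 k A * kron1 k B) $$ (i, j) = kron1 k (A * B) $$ (i, j)" .
qed (use A B in \<open>auto simp: kronecker_def\<close>)

lemma kron1_one: "k > 0 \<Longrightarrow> kron1 k (1\<^sub>m N) = 1\<^sub>m (N * k)"
  by (simp add: kron1_eq_interleave[of _ N] interleave_one)

lemma kron1_pow:
  assumes "k > 0" "X \<in> carrier_mat N N"
  shows "kron1 k X ^\<^sub>m m = kron1 k (X ^\<^sub>m m)"
proof (induction m)
  case 0
  then show ?case using assms carrier_matD[OF kron1_carrier[OF assms(2), of k]] by (simp add: kron1_one)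
next
  case (Suc m)
  then show ?case using assms by (simp add: kron1_mult[of _ N N _ N])
qed

lemma map_ev_kron:
  "map_mat (\<lambda>f. ev f w) (kronecker B (1\<^sub>m k)) = kron1 k (map_mat (\<lambda>f. ev f w) B)"
proof (rule eq_matI)
  fix i j assume "i < dim_row (kron1 k (map_mat (\<lambda>f. ev f w) B))" "j < dim_col (kron1 k (map_mat (\<lambda>f. ev f w) B))"
  then have ij: "i < dim_row B * k" "j < dim_col B * k" by (auto simp: kronecker_def)
  then have "k > 0" by (cases k) auto
  with ij show "map_mat (\<lambda>f. ev f w) (kronecker B (1\<^sub>m k)) $$ (i, j) = kron1 k (map_mat (\<lambda>f. ev f w) B) $$ (i, j)"
    by (simp add: kronecker_def less_mult_imp_div_less)
qed (auto simp: kronecker_def)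

section \<open>The level-rank map on semi-invariants\<close>

lemma ev_level_rank:
  assumes "f \<in> poly_ring (k * N) k"
  shows "ev (level_rank k N f) w = peval f (kron1 k (Xof N w)) (kron1 k (Aof 1 N w))"
  unfolding level_rank_def
  using kron1_carrier[OF X_mat_carrier[of N], of k] kron1_carrier[OF A_mat_carrier[of 1 N], of k]
  by (subst ev_eval_at[OF assms]) (auto simp: map_ev_kron map_ev_X_mat map_ev_A_mat mult.commute[of k N])

lemma peval_level_rank:
  assumes "f \<in> poly_ring (k * N) k" "X \<in> carrier_mat N N" "A \<in> carrier_mat 1 N"
  shows "peval (level_rank k N f) X A = peval f (kron1 k X) (kron1 k A)"
  using ev_level_rank[OF assms(1), of "asg X A"] assms by (simp add: peval_def)

text \<open>Conjugation by \<open>g\<close> becomes conjugation by its Kronecker product with the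
  identity, whose determinant is \<open>det g ^ k\<close>. This is how weight 1 turns into weight
  k.\<close>

lemma level_rank_H_set:
  assumes k: "k > 0" and f: "f \<in> H_set (k * N) k 1"
  shows "level_rank k N f \<in> H_set N 1 k"
  unfolding H_set_iff
proof (intro conjI ballI impI)
  note fr = H_set_poly_ring[OF f]
  show "level_rank k N f \<in> poly_ring N 1"
    unfolding poly_ring_iff_ev
  proof (intro allI impI)
    fix w w' :: "entry \<Rightarrow> complex"
    assume w: "\<forall>v\<in>entries N 1. w v = w' v"
    have "Xof N w = Xof N w'" "Aof 1 N w = Aof 1 N w'"
      using w by (auto simp: Xof_def Aof_def entries_def intro!: eq_matI)
    then show "ev (level_rank k N f) w = ev (level_rank k N f) w'"
      by (simp add: ev_level_rank[OF fr])
  qed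
  fix g h X A :: "complex mat"
  assume gh: "g \<in> carrier_mat N N" "h \<in> carrier_mat N N" "g * h = 1\<^sub>m N \<and> h * g = 1\<^sub>m N"
    and X: "X \<in> carrier_mat N N" and A: "A \<in> carrier_mat 1 N"
  have "peval (level_rank k N f) (g * X * h) (A * h) =
      peval f (kron1 k g * kron1 k X * kron1 k h) (kron1 k A * kron1 k h)"
    using gh X A by (subst peval_level_rank[OF fr]) (auto simp: kron1_mult[of _ N N _ N] kron1_mult[of _ 1 N _ N] intro: mult_carrier_mat[of _ _ N])
  also have "\<dots> = det (kron1 k h) ^ 1 * peval f (kron1 k X) (kron1 k A)"
    using gh X A k kron1_carrier[OF gh(1), of k] kron1_carrier[OF gh(2), of k]
      kron1_carrier[OF X, of k] kron1_carrier[OF A, of k]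
    by (intro peval_conjugate[OF f])
      (auto simp: kron1_mult[of _ N N _ N] kron1_one mult.commute[of k N])
  finally show "peval (level_rank k N f) (g * X * h) (A * h) = det h ^ k * peval (level_rank k N f) X A"
    using k gh X A by (simp add: det_kron1 peval_level_rank[OF fr])
qed

lemma pow_mat_commute:
  "X \<in> carrier_mat n n \<Longrightarrow> X ^\<^sub>m m * X = X * X ^\<^sub>m m"
  using pow_mat_add[of X n m 1] pow_mat_add[of X n 1 m] by (simp add: add.commute)

text \<open>
  At \<open>(X \<otimes> 1, A \<otimes> 1)\<close> the vector field of a current \<open>Y\<close> is right multiplication by
  \<open>Z = \<Sum> X\<^sup>m \<otimes> Y\<^sub>m\<^sup>T\<close>.  As \<open>Z\<close> commutes with \<open>X \<otimes> 1\<close>, it acts on semi-invariants by its trace.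
\<close>

lemma level_rank_gl_act:
  assumes k: "k > 0" and Y: "Y \<in> sl_current k" and f: "f \<in> H_set (k * N) k 1"
  shows "level_rank k N (gl_act (k * N) k Y f) = 0"
proof (rule poly_ring_eqI[of _ N 1])
  note fr = H_set_poly_ring[OF f]
  have gf: "gl_act (k * N) k Y f \<in> H_set (k * N) k 1" using f by (rule gl_act_H_set)
  show "level_rank k N (gl_act (k * N) k Y f) \<in> poly_ring N 1"
    using level_rank_H_set[OF k gf] by (rule H_set_poly_ring)
  show "0 \<in> poly_ring N 1" by (simp add: poly_ring_iff_ev)
  fix X A :: "complex mat" assume X: "X \<in> carrier_mat N N" and A: "A \<in> carrier_mat 1 N"
  let ?M = "N * k"
  let ?X = "kron1 k X" and ?A = "kron1 k A"
  let ?c = "\<lambda>a b m. poly.coeff (Y $$ (a, b)) m"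
  have X': "?X \<in> carrier_mat ?M ?M" and A': "?A \<in> carrier_mat k ?M"
    using kron1_carrier[OF X, of k] kron1_carrier[OF A, of k] by auto
  have powX: "X ^\<^sub>m m \<in> carrier_mat N N" for m using X by simp
  have lt: "s * k + a < N * k" if "s < N" "a < k" for s a
    using that by (rule mult_add_less)
  have dm: "i div k < N" "i mod k < k" if "i < N * k" for i
    using that k by (auto simp: less_mult_imp_div_less)
  define Z where "Z = mat ?M ?M (\<lambda>(i, j). \<Sum>m\<le>degree (Y $$ (j mod k, i mod k)).
     ?c (j mod k) (i mod k) m * (X ^\<^sub>m m) $$ (i div k, j div k))"
  have Z: "Z \<in> carrier_mat ?M ?M" by (simp add: Z_def)
  have ZX: "Z * ?X = ?X * Z"
  proof (rule eq_matI)
    fix i j assume "i < dim_row (?X * Z)" "j < dim_col (?X * Z)"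
    then have ij: "i < ?M" "j < ?M" using X' Z by auto
    let ?S = "\<lambda>F. \<Sum>m\<le>degree (Y $$ (j mod k, i mod k)). ?c (j mod k) (i mod k) m * F m"
    have "(Z * ?X) $$ (i, j) = (\<Sum>s<N. \<Sum>a<k. Z $$ (i, s * k + a) * ?X $$ (s * k + a, j))"
      using ij by (subst index_mult_mat_sum[OF Z X']) (auto simp: sum_div_mod[OF k])
    also have "\<dots> = (\<Sum>s<N. \<Sum>a<k. if a = j mod k then
        ?S (\<lambda>m. (X ^\<^sub>m m) $$ (i div k, s)) * X $$ (s, j div k) else 0)"
      using ij by (intro sum.cong refl) (auto simp: kron1_index[OF X] Z_def lt)
    also have "\<dots> = ?S (\<lambda>m. (X ^\<^sub>m m * X) $$ (i div k, j div k))"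
      using dm[OF ij(1)] dm[OF ij(2)]
      by (simp add: index_mult_mat_sum[OF powX X] sum_distrib_left sum_distrib_right mult.assoc)
        (rule sum.swap)
    also have "\<dots> = ?S (\<lambda>m. (X * X ^\<^sub>m m) $$ (i div k, j div k))"
      by (simp only: pow_mat_commute[OF X])
    also have "\<dots> = (\<Sum>s<N. \<Sum>a<k. if a = i mod k then
        X $$ (i div k, s) * ?S (\<lambda>m. (X ^\<^sub>m m) $$ (s, j div k)) else 0)"
      using dm[OF ij(1)] dm[OF ij(2)]
      by (simp add: index_mult_mat_sum[OF X powX] sum_distrib_left sum_distrib_right mult_ac)
        (rule sum.swap)
    also have "\<dots> = (\<Sum>s<N. \<Sum>a<k. ?X $$ (i, s * k + a) * Z $$ (s * k + a, j))"
      using ij by (intro sum.cong refl) (auto simp: kron1_index[OF X] Z_def lt)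
    also have "\<dots> = (?X * Z) $$ (i, j)"
      using ij by (subst index_mult_mat_sum[OF X' Z]) (auto simp: sum_div_mod[OF k])
    finally show "(Z * ?X) $$ (i, j) = (?X * Z) $$ (i, j)" .
  qed (use X' Z in auto)
  have D: "act_dir (k * N) k Y ?X ?A = ?A * Z"
  proof (rule eq_matI)
    fix b j assume "b < dim_row (?A * Z)" "j < dim_col (?A * Z)"
    then have bj: "b < k" "j < ?M" using A' Z by auto
    have AX: "(?A * ?X ^\<^sub>m m) $$ (a, j) = (if a = j mod k then (A * X ^\<^sub>m m) $$ (0, j div k) else 0)"
      if "a < k" for a m
      using bj that k
      by (simp add: kron1_pow[OF k X] kron1_mult[OF A powX] kron1_index[OF mult_carrier_mat[OF A powX]])
    let ?S = "\<lambda>F. \<Sum>m\<le>degree (Y $$ (j mod k, b)). ?c (j mod k) b m * F m"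
    have "act_dir (k * N) k Y ?X ?A $$ (b, j) =
        (\<Sum>a<k. \<Sum>m\<le>degree (Y $$ (a, b)). ?c a b m * (?A * ?X ^\<^sub>m m) $$ (a, j))"
      using bj by (simp add: act_dir_def mult.commute[of k N] del: index_mult_mat(1))
    also have "\<dots> = (\<Sum>a<k. if a = j mod k then ?S (\<lambda>m. (A * X ^\<^sub>m m) $$ (0, j div k)) else 0)"
      by (intro sum.cong refl) (auto simp: AX simp del: index_mult_mat(1))
    also have "\<dots> = ?S (\<lambda>m. (A * X ^\<^sub>m m) $$ (0, j div k))" using k by simp
    also have "\<dots> = (\<Sum>s<N. \<Sum>a<k. if a = b then
        A $$ (0, s) * ?S (\<lambda>m. (X ^\<^sub>m m) $$ (s, j div k)) else 0)"
      using dm[OF bj(2)] bj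
      by (simp add: index_mult_mat_sum[OF A powX] sum_distrib_left mult_ac) (rule sum.swap)
    also have "\<dots> = (\<Sum>s<N. \<Sum>a<k. ?A $$ (b, s * k + a) * Z $$ (s * k + a, j))"
      using bj by (intro sum.cong refl) (auto simp: kron1_index[OF A] Z_def lt)
    also have "\<dots> = (?A * Z) $$ (b, j)"
      using bj by (subst index_mult_mat_sum[OF A' Z]) (auto simp: sum_div_mod[OF k])
    finally show "act_dir (k * N) k Y ?X ?A $$ (b, j) = (?A * Z) $$ (b, j)" .
  qed (use A' Z in \<open>auto simp: act_dir_def\<close>)
  \<comment> \<open>The trace of \<open>Z\<close> is the sum over m of tr(X^m) tr(Y_m), and every
    \<open>Y_m\<close> is traceless. The common degree bound \<open>B\<close> lets the sums over m
    and over the diagonal of \<open>Y\<close> be exchanged.\<close>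
  have tr: "(\<Sum>i<?M. Z $$ (i, i)) = 0"
  proof -
    define B where "B = Max ((\<lambda>a. degree (Y $$ (a, a))) ` {..<k})"
    have B: "degree (Y $$ (a, a)) \<le> B" if "a < k" for a using that by (simp add: B_def)
    have c0: "(\<Sum>a<k. ?c a a m) = 0" for m
    proof -
      have "(\<Sum>a<k. ?c a a m) = poly.coeff (\<Sum>a<k. Y $$ (a, a)) m" by (simp add: coeff_sum)
      then show ?thesis using Y by (simp add: sl_current_def)
    qed
    have "(\<Sum>i<?M. Z $$ (i, i)) =
        (\<Sum>s<N. \<Sum>a<k. \<Sum>m\<le>degree (Y $$ (a, a)). ?c a a m * (X ^\<^sub>m m) $$ (s, s))"
      unfolding sum_div_mod[OF k] by (intro sum.cong refl) (auto simp: Z_def lt)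
    also have "\<dots> = (\<Sum>s<N. \<Sum>a<k. \<Sum>m\<le>B. ?c a a m * (X ^\<^sub>m m) $$ (s, s))"
      using B by (intro sum.cong refl sum.mono_neutral_left) (auto simp: coeff_eq_0)
    also have "\<dots> = (\<Sum>s<N. \<Sum>m\<le>B. (\<Sum>a<k. ?c a a m) * (X ^\<^sub>m m) $$ (s, s))"
      unfolding sum_distrib_right by (intro sum.cong refl sum.swap)
    finally show ?thesis by (simp add: c0)
  qed
  define d where "d = (\<lambda>t. det (1\<^sub>m ?M + t \<cdot>\<^sub>m Z))"
  have d: "(d has_field_derivative 0) (at 0)"
    using has_field_derivative_det_trace[OF Z] unfolding d_def tr .
  \<comment> \<open>Where it is invertible, 1 + t Z fixes \<open>?X\<close> under conjugation and
    carries \<open>?A\<close> along the field, so semi-invariance leaves only the factor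
    \<open>d t\<close>. Since \<open>d 0 = 1\<close>, this holds near 0, which is enough to compare
    derivatives; and the derivative of \<open>d\<close> at 0 is the trace of
    \<open>Z\<close>.\<close>
  have act: "peval f ?X (?A + t \<cdot>\<^sub>m act_dir (k * N) k Y ?X ?A) = d t * peval f ?X ?A"
    if t: "d t \<noteq> 0" for t
  proof -
    let ?h = "1\<^sub>m ?M + t \<cdot>\<^sub>m Z"
    have h: "?h \<in> carrier_mat ?M ?M" using Z by simp
    obtain g where g: "g \<in> carrier_mat ?M ?M" "g * ?h = 1\<^sub>m ?M" "?h * g = 1\<^sub>m ?M"
      using det_non_zero_imp_unit[OF h, of "()"] t by (auto simp: d_def Units_def ring_mat_def)
    have "?X * ?h = ?h * ?X"
      using X' Z by (simp add: mult_add_distrib_mat[of _ ?M ?M _ ?M] add_mult_distrib_mat[of _ ?M ?M _ _ ?M]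
          mult_smult_distrib[of _ ?M ?M _ ?M] mult_smult_assoc_mat[of _ ?M ?M _ ?M] ZX)
    then have "g * ?X * ?h = g * ?h * ?X"
      using g(1) h X' by (simp add: assoc_mult_mat[of _ ?M ?M _ ?M _ ?M])
    then have gXh: "g * ?X * ?h = ?X" using g(2) X' by simp
    have "?A + t \<cdot>\<^sub>m act_dir (k * N) k Y ?X ?A = ?A * ?h"
      unfolding D using A' Z
      by (simp add: mult_add_distrib_mat[of _ k ?M _ ?M] mult_smult_distrib[of _ k ?M _ ?M])
    then have "peval f ?X (?A + t \<cdot>\<^sub>m act_dir (k * N) k Y ?X ?A) = peval f (g * ?X * ?h) (?A * ?h)"
      by (simp only: gXh)
    also have "\<dots> = det ?h ^ 1 * peval f ?X ?A"
      using g h X' A' by (intro peval_conjugate[OF f]) (auto simp: mult.commute[of k N])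
    finally show ?thesis by (simp add: d_def)
  qed
  have "(d \<longlongrightarrow> d 0) (at 0)" using d by (metis DERIV_isCont isCont_def)
  moreover have "1\<^sub>m ?M + 0 \<cdot>\<^sub>m Z = 1\<^sub>m ?M" using Z by (auto intro!: eq_matI)
  then have "d 0 \<noteq> 0" by (simp add: d_def)
  ultimately have "eventually (\<lambda>t. d t \<noteq> 0) (at 0)" by (rule tendsto_imp_eventually_ne)
  then have "eventually (\<lambda>t. d t \<noteq> 0) (nhds 0)"
    using \<open>d 0 \<noteq> 0\<close> by (simp add: eventually_nhds_conv_at)
  then have ev: "eventually (\<lambda>t. peval f ?X (?A + t \<cdot>\<^sub>m act_dir (k * N) k Y ?X ?A) = d t * peval f ?X ?A) (nhds 0)"
    by (rule eventually_mono) (rule act)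
  have "((\<lambda>t. peval f ?X (?A + t \<cdot>\<^sub>m act_dir (k * N) k Y ?X ?A)) has_field_derivative
      peval (gl_act (k * N) k Y f) ?X ?A) (at 0)"
    using X' A' by (intro has_field_derivative_gl_act fr) (auto simp: mult.commute[of k N])
  moreover have "((\<lambda>t. peval f ?X (?A + t \<cdot>\<^sub>m act_dir (k * N) k Y ?X ?A)) has_field_derivative 0) (at 0)"
    using DERIV_cmult_right[OF d, of "peval f ?X ?A"] unfolding DERIV_cong_ev[OF refl ev refl] by simp
  ultimately have "peval (gl_act (k * N) k Y f) ?X ?A = 0" by (rule DERIV_unique)
  then show "peval (level_rank k N (gl_act (k * N) k Y f)) X A = peval 0 X A"
    using X A by (simp add: peval_level_rank[OF H_set_poly_ring[OF gf]])
qed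


section \<open>Quotients of spaces of semi-invariants\<close>

lemma Const_add: "Const (a + b) = Const a + Const b"
  by (simp add: Const_def single_add)

lemma Const_mult: "Const (a * b) = Const a * Const b"
  by (simp add: Const_def mult_single)

lemma vectorspace_H_space: "vectorspace class_ring (H_space M p l)"
proof -
  have "Module.module class_ring (H_space M p l)"
  proof (rule module_criteria)
    show "\<forall>v\<in>carrier (H_space M p l). \<exists>neg_v\<in>carrier (H_space M p l).
        v \<oplus>\<^bsub>H_space M p l\<^esub> neg_v = \<zero>\<^bsub>H_space M p l\<^esub>"
    proof
      fix v assume "v \<in> carrier (H_space M p l)"
      then show "\<exists>neg_v\<in>carrier (H_space M p l). v \<oplus>\<^bsub>H_space M p l\<^esub> neg_v = \<zero>\<^bsub>H_space M p l\<^esub>"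
        by (intro bexI[of _ "- v"]) (auto simp: H_space_def H_set_uminus)
    qed
  qed (auto simp: H_space_def H_set_0 H_set_add H_set_Const Const_add Const_mult Const_1 add_ac
      distrib_left distrib_right mult.assoc intro: class_cring.cring_axioms)
  then show ?thesis unfolding vectorspace_def by (simp add: class_field)
qed

lemma sl_generators_subset:
  "{gl_act M p Y f | Y f. Y \<in> sl_current p \<and> f \<in> H_set M p l} \<subseteq> carrier (H_space M p l)"
  by (auto simp: H_space_def gl_act_H_set)

lemma submodule_sl_image: "submodule class_ring (sl_image M p l) (H_space M p l)"
proof -
  interpret vectorspace class_ring "H_space M p l" by (rule vectorspace_H_space)
  show ?thesis unfolding sl_image_def by (rule span_is_submodule) (rule sl_generators_subset)
qed

lemma sl_image_subset: "sl_image M p l \<subseteq> H_set M p l"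
  using submodule.subset[OF submodule_sl_image] by (simp add: H_space_def)

lemma sl_image_0: "0 \<in> sl_image M p l"
  using submodule.zero_closed[OF submodule_sl_image, of M p l] by (simp add: H_space_def)

lemma sl_image_add: "f \<in> sl_image M p l \<Longrightarrow> g \<in> sl_image M p l \<Longrightarrow> f + g \<in> sl_image M p l"
  using submodule.m_closed[OF submodule_sl_image, of f M p l g] by (simp add: H_space_def)

lemma sl_image_Const: "f \<in> sl_image M p l \<Longrightarrow> Const c * f \<in> sl_image M p l"
  using submodule.smult_closed[OF submodule_sl_image, of c f M p l] by (simp add: H_space_def)

lemma sl_image_sum: "(\<And>i. i \<in> S \<Longrightarrow> F i \<in> sl_image M p l) \<Longrightarrow> sum F S \<in> sl_image M p l"
  by (induction S rule: infinite_finite_induct) (auto simp: sl_image_0 sl_image_add)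

lemma gl_act_sl_image:
  assumes "Y \<in> sl_current p" "f \<in> H_set M p l"
  shows "gl_act M p Y f \<in> sl_image M p l"
proof -
  interpret vectorspace class_ring "H_space M p l" by (rule vectorspace_H_space)
  show ?thesis
    unfolding sl_image_def using assms in_own_span[OF sl_generators_subset] by blast
qed

lemma level_rank_add:
  assumes "f \<in> poly_ring (k * N) k" "g \<in> poly_ring (k * N) k"
  shows "level_rank k N (f + g) = level_rank k N f + level_rank k N g"
proof -
  have "f + g \<in> poly_ring (k * N) k" using assms by (simp add: poly_ring_iff_ev) metis
  with assms show ?thesis by (intro ev_ext) (simp add: ev_level_rank)
qed

lemma level_rank_Const:
  assumes "f \<in> poly_ring (k * N) k"
  shows "level_rank k N (Const c * f) = Const c * level_rank k N f"
proof -
  have "Const c * f \<in> poly_ring (k * N) k" using assms by (auto simp: poly_ring_iff_ev)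
  with assms show ?thesis by (intro ev_ext) (simp add: ev_level_rank)
qed

lemma level_rank_sl_image:
  assumes "k > 0" "f \<in> sl_image (k * N) k 1"
  shows "level_rank k N f = 0"
proof -
  let ?V = "H_space (k * N) k 1"
  interpret vectorspace class_ring ?V by (rule vectorspace_H_space)
  let ?U = "{f \<in> H_set (k * N) k 1. level_rank k N f = 0}"
  have "level_rank k N 0 = 0" by (rule ev_ext) (simp add: ev_level_rank poly_ring_iff_ev peval_def)
  then have "submodule class_ring ?U ?V"
    by unfold_locales
      (auto simp: H_space_def H_set_0 H_set_add H_set_Const level_rank_add level_rank_Const H_set_poly_ring)
  then have "sl_image (k * N) k 1 \<subseteq> ?U"
    unfolding sl_image_def using assms(1)
    by (intro span_is_subset) (auto simp: level_rank_gl_act gl_act_H_set)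
  then show ?thesis using assms(2) by blast
qed

text \<open>The first isomorphism theorem. The cosets of the kernel are the fibres of
  \<open>T\<close>, nonempty by surjectivity; all operations on cosets are therefore computed on
  values of \<open>T\<close>, and \<open>the_elem\<close> picks the value on a fibre.\<close>

lemma vs_isomorphism_quotient:
  fixes T :: "mpoly \<Rightarrow> mpoly"
  assumes T: "\<And>f. f \<in> H_set M p l \<Longrightarrow> T f \<in> H_set N q r"
    and add: "\<And>f g. f \<in> H_set M p l \<Longrightarrow> g \<in> H_set M p l \<Longrightarrow> T (f + g) = T f + T g"
    and smult: "\<And>c f. f \<in> H_set M p l \<Longrightarrow> T (Const c * f) = Const c * T f"
    and onto: "\<And>h. h \<in> H_set N q r \<Longrightarrow> \<exists>f\<in>H_set M p l. T f = h"
    and ker: "U = {f \<in> H_set M p l. T f = 0}"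
  shows "vs_isomorphism class_ring (quotient_space (H_space M p l) U) (H_space N q r)
    (\<lambda>C. the_elem (T ` C))"
proof -
  let ?V = "H_space M p l" and ?W = "H_space N q r"
  let ?Q = "quotient_space ?V U"
  define fib where "fib = (\<lambda>y. {f \<in> H_set M p l. T f = y})"
  have T_diff: "T (f - g) = T f - T g" if "f \<in> H_set M p l" "g \<in> H_set M p l" for f g
  proof -
    have "T (f - g) + T g = T f" using add[OF H_set_diff[OF that] that(2)] by simp
    then show ?thesis by (simp add: algebra_simps)
  qed
  have coset: "U +>\<^bsub>?V\<^esub> x = fib (T x)" if x: "x \<in> H_set M p l" for x
  proof (intro equalityI subsetI)
    fix f assume "f \<in> U +>\<^bsub>?V\<^esub> x"
    then show "f \<in> fib (T x)"
      using x by (auto simp: a_r_coset_def' H_space_def fib_def ker H_set_add add)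
  next
    fix f assume f: "f \<in> fib (T x)"
    then have "f - x \<in> U" using x by (auto simp: fib_def ker T_diff H_set_diff)
    then have "(f - x) + x \<in> U +>\<^bsub>?V\<^esub> x" unfolding a_r_coset_def'
      by (auto simp: H_space_def intro!: bexI[of _ "f - x"])
    then show "f \<in> U +>\<^bsub>?V\<^esub> x" by simp
  qed
  have carrier: "carrier ?Q = fib ` H_set N q r"
  proof -
    have "carrier ?Q = (\<lambda>x. fib (T x)) ` H_set M p l"
      using coset by (auto simp: quotient_space_def A_RCOSETS_def' H_space_def)
    also have "\<dots> = fib ` T ` H_set M p l" by (simp add: image_image)
    also have "T ` H_set M p l = H_set N q r" using T onto by force
    finally show ?thesis .
  qed
  have ne: "fib y \<noteq> {}" if "y \<in> H_set N q r" for y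
    using onto[OF that] by (auto simp: fib_def)
  have the: "the_elem (T ` fib y) = y" if "y \<in> H_set N q r" for y
  proof -
    have "T ` fib y = {y}" using ne[OF that] by (auto simp: fib_def)
    then show ?thesis by simp
  qed
  have Qadd: "fib y \<oplus>\<^bsub>?Q\<^esub> fib z = fib (y + z)" if y: "y \<in> H_set N q r" and "z \<in> H_set N q r" for y z
  proof (intro equalityI subsetI)
    fix f assume "f \<in> fib y \<oplus>\<^bsub>?Q\<^esub> fib z"
    then show "f \<in> fib (y + z)"
      by (auto simp: quotient_space_def set_add_def' H_space_def fib_def H_set_add add)
  next
    fix f assume f: "f \<in> fib (y + z)"
    obtain g where g: "g \<in> fib y" using ne[OF y] by blast
    then have "f - g \<in> fib z" using f by (auto simp: fib_def T_diff H_set_diff)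
    with g have "g + (f - g) \<in> fib y \<oplus>\<^bsub>?Q\<^esub> fib z"
      unfolding quotient_space_def set_add_def' H_space_def
      by simp (rule bexI[of _ g], rule bexI[of _ "f - g"], simp_all)
    then show "f \<in> fib y \<oplus>\<^bsub>?Q\<^esub> fib z" by simp
  qed
  have Qsmult: "c \<odot>\<^bsub>?Q\<^esub> fib y = fib (Const c * y)" if y: "y \<in> H_set N q r" for c y
  proof -
    have "c \<odot>\<^bsub>?Q\<^esub> fib y = (\<Union>x\<in>fib y. U +>\<^bsub>?V\<^esub> (Const c * x))"
      by (simp add: quotient_space_def H_space_def)
    also have "\<dots> = (\<Union>x\<in>fib y. fib (Const c * y))"
      by (intro SUP_cong refl) (auto simp: fib_def coset H_set_Const smult)
    also have "\<dots> = fib (Const c * y)" using ne[OF y] by simp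
    finally show ?thesis .
  qed
  have Qzero: "\<zero>\<^bsub>?Q\<^esub> = fib 0" by (simp add: quotient_space_def ker fib_def)
  have "Module.module class_ring ?Q"
  proof (rule module_criteria)
    show "\<forall>v\<in>carrier ?Q. \<exists>neg_v\<in>carrier ?Q. v \<oplus>\<^bsub>?Q\<^esub> neg_v = \<zero>\<^bsub>?Q\<^esub>"
    proof
      fix v assume "v \<in> carrier ?Q"
      then obtain y where y: "y \<in> H_set N q r" "v = fib y" by (auto simp: carrier)
      then show "\<exists>neg_v\<in>carrier ?Q. v \<oplus>\<^bsub>?Q\<^esub> neg_v = \<zero>\<^bsub>?Q\<^esub>"
        by (intro bexI[of _ "fib (- y)"]) (auto simp: carrier Qadd Qzero H_set_uminus)
    qed
  qed (auto simp: carrier Qadd Qsmult Qzero H_set_0 H_set_add H_set_Const Const_add Const_mult Const_1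
      add_ac distrib_left distrib_right mult.assoc intro: class_cring.cring_axioms)
  then have Q: "vectorspace class_ring ?Q" unfolding vectorspace_def by (simp add: class_field)
  have "(\<lambda>C. the_elem (T ` C)) \<in> LinearCombinations.module_hom class_ring ?Q ?W"
    unfolding LinearCombinations.module_hom_def
    by (auto simp: carrier the Qadd Qsmult H_set_add H_set_Const) (auto simp: H_space_def)
  with Q vectorspace_H_space[of N q r] have "linear_map class_ring ?Q ?W (\<lambda>C. the_elem (T ` C))"
    unfolding linear_map_def mod_hom_def mod_hom_axioms_def by (auto simp: vectorspace_def)
  moreover have "bij_betw (\<lambda>C. the_elem (T ` C)) (carrier ?Q) (carrier ?W)"
  proof (rule bij_betw_byWitness[where f' = fib])
    show "\<forall>C\<in>carrier ?Q. fib (the_elem (T ` C)) = C" by (auto simp: carrier the)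
    have W: "carrier ?W = H_set N q r" by (simp add: H_space_def)
    show "(\<lambda>C. the_elem (T ` C)) ` carrier ?Q \<subseteq> carrier ?W"
      unfolding carrier W using the by (simp add: image_subset_iff)
    show "fib ` carrier ?W \<subseteq> carrier ?Q" unfolding carrier W by (rule subset_refl)
    show "\<forall>y\<in>carrier ?W. the_elem (T ` fib y) = y" unfolding W using the by (rule ballI)
  qed
  ultimately show ?thesis by (simp add: vs_isomorphism_def)
qed


section \<open>Reduction by the Cartan currents\<close>

lemma row_det_cong:
  assumes "\<And>i. i < M \<Longrightarrow> c i = c' i" "\<And>i. i < M \<Longrightarrow> \<mu> i = \<mu>' i"
  shows "row_det p M c \<mu> = row_det p M c' \<mu>'"
  unfolding row_det_def using assms by (intro arg_cong[of _ _ det] eq_matI) auto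

lemma row_det_permute:
  assumes "\<pi> permutes {0..<M}"
  shows "row_det p M (\<lambda>i. c (\<pi> i)) (\<lambda>i. \<mu> (\<pi> i)) = signof \<pi> * row_det p M c \<mu>"
proof -
  let ?B = "mat M M (\<lambda>(i, j). (A_mat p M * X_mat M ^\<^sub>m \<mu> i) $$ (c i, j))"
  have "row_det p M (\<lambda>i. c (\<pi> i)) (\<lambda>i. \<mu> (\<pi> i)) = det (mat M M (\<lambda>(i, j). ?B $$ (\<pi> i, j)))"
    unfolding row_det_def using permutes_in_image[OF assms]
    by (intro arg_cong[of _ _ det] eq_matI) auto
  also have "\<dots> = signof \<pi> * row_det p M c \<mu>"
    unfolding row_det_def using assms by (intro det_permute_rows) auto
  finally show ?thesis .
qed

lemma row_det_eq_0:
  assumes "i < M" "j < M" "i \<noteq> j" "c i = c j" "\<mu> i = \<mu> j"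
  shows "row_det p M c \<mu> = 0"
  unfolding row_det_def using assms
  by (intro det_identical_rows[of _ M i j]) (auto intro!: eq_vecI)

lemma Const_of_int: "Const (of_int n) = of_int n"
  by (simp add: Const_def flip: single_of_int)

lemma Const_of_nat: "Const (of_nat n) = of_nat n"
  by (simp add: Const_def flip: single_of_nat)

section \<open>Elementary symmetric polynomials and Newton's identities\<close>

definition elem_sym :: "(nat \<Rightarrow> 'a) \<Rightarrow> nat set \<Rightarrow> nat \<Rightarrow> 'a :: comm_ring_1" where
  "elem_sym y S r = (\<Sum>U | U \<subseteq> S \<and> card U = r. \<Prod>i\<in>U. y i)"

lemma elem_sym_0:
  assumes "finite S"
  shows "elem_sym y S 0 = 1"
proof -
  have "{U. U \<subseteq> S \<and> card U = 0} = {{}}"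
    using assms by (auto dest: finite_subset)
  then show ?thesis by (simp add: elem_sym_def)
qed

lemma elem_sym_eq_fps_nth:
  assumes "finite S"
  shows "elem_sym y S r = fps_nth (\<Prod>i\<in>S. 1 + fps_const (y i) * fps_X) r"
proof -
  have "(\<Prod>i\<in>S. 1 + fps_const (y i) * fps_X) = (\<Prod>i\<in>S. fps_const (y i) * fps_X + 1)"
    by (simp add: add.commute)
  also have "\<dots> = (\<Sum>U\<in>Pow S. fps_const (\<Prod>i\<in>U. y i) * fps_X ^ card U)"
  proof (subst prod_add[OF assms], intro sum.cong refl)
    fix U assume "U \<in> Pow S"
    have "(\<Prod>i\<in>U. fps_const (y i)) = fps_const (\<Prod>i\<in>U. y i)"
      by (induction U rule: infinite_finite_induct) (auto simp flip: fps_const_mult)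
    then show "(\<Prod>i\<in>U. fps_const (y i) * fps_X) * (\<Prod>i\<in>S - U. 1) =
        fps_const (\<Prod>i\<in>U. y i) * fps_X ^ card U"
      by (simp add: prod.distrib)
  qed
  also have "fps_nth \<dots> r = (\<Sum>U\<in>Pow S. if card U = r then \<Prod>i\<in>U. y i else 0)"
    by (auto simp: fps_sum_nth fps_X_power_iff intro!: sum.cong)
  also have "\<dots> = elem_sym y S r"
    unfolding elem_sym_def using assms by (subst sum.inter_filter[symmetric]) (auto simp: Pow_def)
  finally show ?thesis ..
qed

text \<open>Read off from the logarithmic derivative of the generating function.\<close>

lemma newton_identity:
  assumes "finite S"
  shows "of_nat (Suc r) * elem_sym y S (Suc r) =
    (\<Sum>i=0..r. elem_sym y S i * ((- 1) ^ (r - i) * (\<Sum>j\<in>S. y j ^ Suc (r - i))))"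
proof -
  let ?E = "\<lambda>S. \<Prod>i\<in>S. 1 + fps_const (y i) * fps_X"
  let ?P = "\<lambda>S. Abs_fps (\<lambda>n. (- 1) ^ n * (\<Sum>j\<in>S. y j ^ Suc n))"
  \<comment> \<open>The geometric series for a / (1 + a X), which is the logarithmic derivative of a
    single factor, with the denominator cleared.\<close>
  have P1: "(1 + fps_const a * fps_X) * Abs_fps (\<lambda>n. (- 1) ^ n * a ^ Suc n) = fps_const a" for a :: 'a
  proof (rule fps_ext)
    fix n show "fps_nth ((1 + fps_const a * fps_X) * Abs_fps (\<lambda>n. (- 1) ^ n * a ^ Suc n)) n = fps_nth (fps_const a) n"
      by (cases n) (auto simp: distrib_right mult.assoc algebra_simps)
  qed
  have "fps_deriv (?E S) = ?E S * ?P S"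
    using assms
  proof (induction S rule: finite_induct)
    case empty
    then show ?case by (simp add: fps_zero_def)
  next
    case (insert a S)
    have "?P (insert a S) = Abs_fps (\<lambda>n. (- 1) ^ n * y a ^ Suc n) + ?P S"
      using insert by (intro fps_ext) (simp add: algebra_simps)
    then have "?E (insert a S) * ?P (insert a S) =
        ?E S * ((1 + fps_const (y a) * fps_X) * Abs_fps (\<lambda>n. (- 1) ^ n * y a ^ Suc n)) +
        (1 + fps_const (y a) * fps_X) * (?E S * ?P S)"
      using insert by (simp only: prod.insert) (simp add: algebra_simps)
    also have "\<dots> = fps_deriv (?E (insert a S))"
      unfolding P1 insert.IH[symmetric] using insert by (simp add: algebra_simps)
    finally show ?case ..
  qed
  then have "fps_nth (fps_deriv (?E S)) r = fps_nth (?E S * ?P S) r" by simp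
  then show ?thesis
    by (simp add: fps_mult_nth elem_sym_eq_fps_nth[OF assms] del: power_Suc)
qed

section \<open>Row determinants of weight 0 for the constant Cartan elements\<close>

context
  fixes k N :: nat
  assumes k: "k > 0"
begin

definition block :: "nat \<Rightarrow> nat set" where
  "block a = {i. i < k * N \<and> i mod k = a}"

text \<open>Every colour occurs N times. The colouring \<open>i mod k\<close> is the one that
  matches the index order of a Kronecker product with \<open>1\<^sub>m k\<close>.\<close>

definition std_det :: "(nat \<Rightarrow> nat) \<Rightarrow> mpoly" where
  "std_det \<mu> = row_det k (k * N) (\<lambda>i. i mod k) \<mu>"

abbreviation "Wsub \<equiv> sl_image (k * N) k 1"

lemma finite_block [simp]: "finite (block a)"
  by (simp add: block_def)

lemma card_block:
  assumes "a < k"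
  shows "card (block a) = N"
proof -
  have "bij_betw (\<lambda>s. s * k + a) {..<N} (block a)"
  proof (rule bij_betw_byWitness[where f' = "\<lambda>i. i div k"])
    show "(\<lambda>s. s * k + a) ` {..<N} \<subseteq> block a"
      using bij_betw_div_mod[OF k, of N] assms
      by (auto simp: block_def bij_betw_def mult.commute[of k N])
    show "(\<lambda>i. i div k) ` block a \<subseteq> {..<N}"
      by (auto simp: block_def mult.commute[of k N] less_mult_imp_div_less)
  qed (use assms in \<open>auto simp: block_def\<close>)
  then show ?thesis by (metis bij_betw_same_card card_lessThan)
qed

lemma std_det_H_set: "std_det \<mu> \<in> H_set (k * N) k 1"
  unfolding std_det_def using k by (intro row_det_in_H_set) simp

text \<open>The constant current for \<open>a\<close> and \<open>b\<close> acts by the difference of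
  the two multiplicities; a nonzero scalar puts the determinant itself into the image.\<close>

lemma row_det_unbalanced:
  assumes c: "\<And>i. i < k * N \<Longrightarrow> c i < k" and ab: "a < k" "b < k"
    and ne: "card {i. i < k * N \<and> c i = a} \<noteq> card {i. i < k * N \<and> c i = b}"
  shows "row_det k (k * N) c \<mu> \<in> Wsub"
proof -
  let ?n = "\<lambda>a. card {i. i < k * N \<and> c i = a}"
  let ?d = "complex_of_nat (?n a) - of_nat (?n b)"
  have ab': "a \<noteq> b" using ne by auto
  have "gl_act (k * N) k (cartan k a b 0) (row_det k (k * N) c \<mu>) = Const ?d * row_det k (k * N) c \<mu>"
    using gl_act_cartan_row_det[OF ab ab' c, where m = 0 and \<mu> = \<mu>]
    by (simp add: Const_def single_diff left_diff_distrib flip: single_of_nat)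
  then have "Const ?d * row_det k (k * N) c \<mu> \<in> Wsub"
    using gl_act_sl_image[OF cartan_sl_current[OF ab ab', of 0] row_det_in_H_set[where c = c and M = "k * N" and \<mu> = \<mu>, OF c]] by simp
  then have "Const (1 / ?d) * (Const ?d * row_det k (k * N) c \<mu>) \<in> Wsub" by (rule sl_image_Const)
  moreover have "?d \<noteq> 0" using ne by simp
  ultimately show ?thesis by (simp add: Const_1 flip: mult.assoc Const_mult)
qed

text \<open>Equal multiplicities are all N, so the colouring is a rearrangement of the standard one;
  permuting the rows changes the determinant only by the sign \<open>\<epsilon>\<close>.\<close>

lemma row_det_balanced:
  assumes c: "\<And>i. i < k * N \<Longrightarrow> c i < k"
    and eq: "\<And>a b. a < k \<Longrightarrow> b < k \<Longrightarrow> card {i. i < k * N \<and> c i = a} = card {i. i < k * N \<and> c i = b}"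
  obtains \<epsilon> \<nu> where "row_det k (k * N) c \<mu> = Const \<epsilon> * std_det \<nu>"
proof -
  let ?A = "{0..<k * N}"
  let ?n = "\<lambda>a. card {i. i < k * N \<and> c i = a}"
  have "k * N = card (\<Union>a<k. {i. i < k * N \<and> c i = a})"
    using c by (subst card_lessThan[symmetric], intro arg_cong[of _ _ card]) auto
  also have "\<dots> = (\<Sum>a<k. ?n a)" by (subst card_UN_disjoint) auto
  also have "\<dots> = (\<Sum>a<k. ?n 0)"
    by (intro sum.cong refl) (rule eq[OF _ k], simp)
  finally have n: "?n a = N" if "a < k" for a using eq[of a 0] that k by simp
  have "image_mset c (mset_set ?A) = image_mset (\<lambda>i. i mod k) (mset_set ?A)"
  proof (rule multiset_eqI)
    fix a :: nat
    have cnt: "count (image_mset g (mset_set ?A)) a = card {i. i < k * N \<and> g i = a}" for g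
      by (simp add: count_image_mset' flip: lessThan_atLeast0) (auto intro!: arg_cong[of _ _ card])
    show "count (image_mset c (mset_set ?A)) a = count (image_mset (\<lambda>i. i mod k) (mset_set ?A)) a"
    proof (cases "a < k")
      case True
      then show ?thesis unfolding cnt using n[OF True] card_block[OF True] by (simp add: block_def)
    next
      case False
      then have "{i. i < k * N \<and> c i = a} = {}" "{i. i < k * N \<and> i mod k = a} = {}"
        using c k by force+
      then show ?thesis unfolding cnt by (simp only:)
    qed
  qed
  then obtain \<pi> where \<pi>: "\<pi> permutes ?A" "\<forall>i\<in>?A. c i = \<pi> i mod k"
    using image_mset_eq_implies_permutes[of ?A c "\<lambda>i. i mod k"] by auto
  have "row_det k (k * N) c \<mu> = row_det k (k * N) (\<lambda>i. \<pi> i mod k) (\<lambda>i. (\<mu> \<circ> inv_into UNIV \<pi>) (\<pi> i))"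
    using \<pi> by (intro row_det_cong) (auto simp: permutes_inverses)
  also have "\<dots> = signof \<pi> * std_det (\<mu> \<circ> inv_into UNIV \<pi>)"
    unfolding std_det_def using row_det_permute[OF \<pi>(1), of k "\<lambda>i. i mod k" "\<mu> \<circ> inv_into UNIV \<pi>"] by simp
  finally show ?thesis using that[of "signof \<pi>"] by (simp add: Const_of_int)
qed

lemma std_det_permute:
  assumes "\<pi> permutes {0..<k * N}" "\<And>i. i < k * N \<Longrightarrow> \<pi> i mod k = i mod k"
  shows "std_det (\<lambda>i. \<mu> (\<pi> i)) = signof \<pi> * std_det \<mu>"
proof -
  have "std_det (\<lambda>i. \<mu> (\<pi> i)) = row_det k (k * N) (\<lambda>i. \<pi> i mod k) (\<lambda>i. \<mu> (\<pi> i))"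
    unfolding std_det_def using assms by (intro row_det_cong) auto
  then show ?thesis unfolding std_det_def by (simp add: row_det_permute[OF assms(1), of k "\<lambda>i. i mod k"])
qed

text \<open>
  Polynomials in auxiliary variables \<open>XE i 0\<close> serve as linear combinations of exponent vectors
  of the determinants \<open>std_det\<close>; multiplication by power sums then models the Cartan currents.
\<close>

definition expo :: "(entry \<Rightarrow>\<^sub>0 nat) \<Rightarrow> nat \<Rightarrow> nat" where
  "expo m i = Poly_Mapping.lookup m (XE i 0)"

definition lin :: "mpoly \<Rightarrow> mpoly" where
  "lin P = (\<Sum>m\<in>Poly_Mapping.keys P. Const (Poly_Mapping.lookup P m) * std_det (expo m))"

lemma lin_superset:
  assumes "finite S" "Poly_Mapping.keys P \<subseteq> S"
  shows "lin P = (\<Sum>m\<in>S. Const (Poly_Mapping.lookup P m) * std_det (expo m))"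
  unfolding lin_def using assms
  by (intro sum.mono_neutral_left) (auto simp: in_keys_iff Const_0)

lemma lin_add: "lin (P + Q) = lin P + lin Q"
proof -
  let ?S = "Poly_Mapping.keys P \<union> Poly_Mapping.keys Q"
  have "Poly_Mapping.keys (P + Q) \<subseteq> ?S" by (rule Poly_Mapping.keys_add)
  then show ?thesis
    by (simp add: lin_superset[of ?S] lookup_add Const_add distrib_right sum.distrib)
qed

lemma lin_single: "lin (Poly_Mapping.single m c) = Const c * std_det (expo m)"
  by (simp add: lin_def Const_0)

lemma lin_0 [simp]: "lin 0 = 0"
  by (simp add: lin_def)

lemma lin_sum: "lin (sum F S) = (\<Sum>i\<in>S. lin (F i))"
  by (induction S rule: infinite_finite_induct) (auto simp: lin_add)

lemma lin_diff: "lin (P - Q) = lin P - lin Q"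
  using lin_add[of "P - Q" Q] by simp

lemma lin_Const: "lin (Const c * P) = Const c * lin P"
proof -
  have "Const c * P = (\<Sum>m\<in>Poly_Mapping.keys P. Poly_Mapping.single m (c * Poly_Mapping.lookup P m))"
    by (subst (1) mpoly_eq_sum_single[of P]) (simp add: sum_distrib_left Const_def mult_single)
  then have "lin (Const c * P) =
      (\<Sum>m\<in>Poly_Mapping.keys P. Const (c * Poly_Mapping.lookup P m) * std_det (expo m))"
    by (simp only: lin_sum lin_single)
  then show ?thesis by (simp add: lin_def[of P] Const_mult mult.assoc sum_distrib_left)
qed

section \<open>Moving symmetric factors from one block to another\<close>

definition aux :: "nat \<Rightarrow> mpoly" where
  "aux i = Var (XE i 0)"

text \<open>The largest ideal contained in the preimage of \<open>Wsub\<close> under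
  \<open>lin\<close>. The preimage is only a subspace, whereas Newton's identities multiply
  congruences by further polynomials.\<close>

definition cong_ideal :: "mpoly set" where
  "cong_ideal = {P. \<forall>Q. lin (P * Q) \<in> Wsub}"

lemma cong_ideal_add: "P \<in> cong_ideal \<Longrightarrow> Q \<in> cong_ideal \<Longrightarrow> P + Q \<in> cong_ideal"
  by (simp add: cong_ideal_def distrib_right lin_add sl_image_add)

lemma cong_ideal_mult: "P \<in> cong_ideal \<Longrightarrow> P * Q \<in> cong_ideal"
  by (simp add: cong_ideal_def mult.assoc)

lemma cong_ideal_mult': "P \<in> cong_ideal \<Longrightarrow> Q * P \<in> cong_ideal"
  using cong_ideal_mult by (simp add: mult.commute)

lemma cong_ideal_0: "0 \<in> cong_ideal"
  by (simp add: cong_ideal_def sl_image_0)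

lemma cong_ideal_sum: "(\<And>i. i \<in> S \<Longrightarrow> F i \<in> cong_ideal) \<Longrightarrow> sum F S \<in> cong_ideal"
  by (induction S rule: infinite_finite_induct) (auto simp: cong_ideal_0 cong_ideal_add)

lemma aux_power_mult_single:
  "aux i ^ m * Poly_Mapping.single q c = Poly_Mapping.single (Poly_Mapping.single (XE i 0) m + q) c"
proof -
  have "aux i ^ m = Poly_Mapping.single (Poly_Mapping.single (XE i 0) m) 1"
  proof (induction m)
    case (Suc m)
    have "aux i ^ Suc m = Poly_Mapping.single (Poly_Mapping.single (XE i 0) 1 + Poly_Mapping.single (XE i 0) m) 1"
      using Suc by (simp add: aux_def Var_def mult_single)
    then show ?case by (simp flip: single_add)
  qed simp
  then show ?thesis by (simp add: mult_single)
qed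

text \<open>Multiplying a monomial by a power sum raises one exponent of the block at a time by
  \<open>m\<close>, exactly as the Leibniz rule does for the Cartan current of degree
  \<open>m\<close>.\<close>

lemma power_sum_diff_in_ideal:
  assumes ab: "a < k" "b < k"
  shows "(\<Sum>i\<in>block a. aux i ^ m) - (\<Sum>i\<in>block b. aux i ^ m) \<in> cong_ideal"
proof (cases "a = b")
  case False
  let ?P = "(\<Sum>i\<in>block a. aux i ^ m) - (\<Sum>i\<in>block b. aux i ^ m)"
  have single: "lin (?P * Poly_Mapping.single q c) \<in> Wsub" for q c
  proof -
    have expo: "expo (Poly_Mapping.single (XE i 0) m + q) = (expo q)(i := expo q i + m)" for i
      by (auto simp: expo_def lookup_add lookup_single when_def)
    have "lin (?P * Poly_Mapping.single q c) = Const c *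
        ((\<Sum>i\<in>block a. std_det ((expo q)(i := expo q i + m))) -
         (\<Sum>i\<in>block b. std_det ((expo q)(i := expo q i + m))))"
      by (simp add: left_diff_distrib lin_diff sum_distrib_right lin_sum aux_power_mult_single lin_single
          expo right_diff_distrib sum_distrib_left)
    also have "(\<Sum>i\<in>block a. std_det ((expo q)(i := expo q i + m))) -
         (\<Sum>i\<in>block b. std_det ((expo q)(i := expo q i + m))) =
        gl_act (k * N) k (cartan k a b m) (std_det (expo q))"
      unfolding std_det_def block_def using k
      by (subst gl_act_cartan_row_det[OF ab False]) auto
    finally show ?thesis
      using gl_act_sl_image[OF cartan_sl_current[OF ab False] std_det_H_set] by (simp add: sl_image_Const)
  qed
  have "lin (?P * Q) \<in> Wsub" for Q
  proof -
    have "lin (?P * Q) = (\<Sum>q\<in>Poly_Mapping.keys Q. lin (?P * Poly_Mapping.single q (Poly_Mapping.lookup Q q)))"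
      by (subst (1) mpoly_eq_sum_single[of Q]) (simp only: sum_distrib_left lin_sum)
    then show ?thesis using single by (simp add: sl_image_sum)
  qed
  then show ?thesis by (simp add: cong_ideal_def)
qed (simp add: cong_ideal_0)

text \<open>Newton's identities express r times the r-th elementary symmetric polynomial by power
  sums and lower ones; congruence of both kinds of factors gives congruence of the products, and r
  is invertible in characteristic 0.\<close>

lemma elem_sym_diff_in_ideal:
  assumes ab: "a < k" "b < k"
  shows "elem_sym aux (block a) r - elem_sym aux (block b) r \<in> cong_ideal"
proof (induction r rule: less_induct)
  case (less r)
  show ?case
  proof (cases r)
    case 0
    then show ?thesis by (simp add: elem_sym_0 cong_ideal_0)
  next
    case (Suc s)
    let ?e = "\<lambda>a. elem_sym aux (block a)" and ?p = "\<lambda>a n. \<Sum>j\<in>block a. aux j ^ Suc n"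
    have "of_nat r * (?e a r - ?e b r) = (\<Sum>i=0..s. (- 1) ^ (s - i) *
        (?e a i * (?p a (s - i) - ?p b (s - i)) + (?e a i - ?e b i) * ?p b (s - i)))"
      unfolding Suc right_diff_distrib newton_identity[OF finite_block] sum_subtractf[symmetric]
      by (intro sum.cong refl) (simp add: algebra_simps del: power_Suc)
    also have "\<dots> \<in> cong_ideal"
      using Suc by (intro cong_ideal_sum cong_ideal_mult' cong_ideal_add cong_ideal_mult'
          power_sum_diff_in_ideal ab cong_ideal_mult less.IH) auto
    finally have "Const (1 / of_nat r) * (of_nat r * (?e a r - ?e b r)) \<in> cong_ideal"
      by (rule cong_ideal_mult')
    moreover have "Const (1 / of_nat r) * of_nat r = 1"
      using Suc unfolding Const_of_nat[symmetric] by (simp add: Const_1 del: of_nat_Suc flip: Const_mult)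
    ultimately show ?thesis by (simp flip: mult.assoc)
  qed
qed

section \<open>Reduction of all blocks but the last\<close>

definition last_expo :: "mpoly \<Rightarrow> bool" where
  "last_expo P \<longleftrightarrow> (\<forall>m\<in>Poly_Mapping.keys P. \<forall>i<k * N. i mod k \<noteq> k - 1 \<longrightarrow> expo m i = i div k)"

text \<open>\<open>last_expo\<close> asks for the exponents 0, ..., N - 1 in order in every block
  but the last: the level-rank map turns these blocks into Vandermonde determinants, while the last
  block stays free.\<close>

definition reducible :: "mpoly set" where
  "reducible = {f. \<exists>P. last_expo P \<and> f - lin P \<in> Wsub}"

lemma Wsub_reducible: "f \<in> Wsub \<Longrightarrow> f \<in> reducible"
  unfolding reducible_def by (auto simp: last_expo_def intro!: exI[of _ 0])

lemma reducible_add: "f \<in> reducible \<Longrightarrow> g \<in> reducible \<Longrightarrow> f + g \<in> reducible"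
proof -
  assume "f \<in> reducible" "g \<in> reducible"
  then obtain P Q where PQ: "last_expo P" "last_expo Q" "f - lin P \<in> Wsub" "g - lin Q \<in> Wsub"
    by (auto simp: reducible_def)
  have "last_expo (P + Q)"
    using PQ Poly_Mapping.keys_add[of P Q] by (auto simp: last_expo_def)
  moreover have "(f + g) - lin (P + Q) \<in> Wsub"
    using sl_image_add[OF PQ(3,4)] by (simp add: lin_add algebra_simps)
  ultimately show ?thesis by (auto simp: reducible_def)
qed

lemma reducible_Const: "f \<in> reducible \<Longrightarrow> Const c * f \<in> reducible"
proof -
  assume "f \<in> reducible"
  then obtain P where P: "last_expo P" "f - lin P \<in> Wsub" by (auto simp: reducible_def)
  have "Poly_Mapping.keys (Const c * P) \<subseteq> Poly_Mapping.keys P"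
    using Poly_Mapping.keys_mult[of "Const c" P] by (auto simp: Const_def split: if_splits)
  then have "last_expo (Const c * P)" using P by (auto simp: last_expo_def)
  moreover have "Const c * f - lin (Const c * P) \<in> Wsub"
    using sl_image_Const[OF P(2), of c] by (simp add: lin_Const right_diff_distrib)
  ultimately show ?thesis by (auto simp: reducible_def)
qed

lemma reducible_diff: "f \<in> reducible \<Longrightarrow> g \<in> reducible \<Longrightarrow> f - g \<in> reducible"
  using reducible_add[of f "Const (- 1) * g"] reducible_Const[of g "- 1"]
  by (simp add: Const_def single_uminus)

lemma reducible_sum: "(\<And>i. i \<in> S \<Longrightarrow> F i \<in> reducible) \<Longrightarrow> sum F S \<in> reducible"
  by (induction S rule: infinite_finite_induct) (auto simp: reducible_add Wsub_reducible sl_image_0)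

definition monomial :: "(nat \<Rightarrow> nat) \<Rightarrow> entry \<Rightarrow>\<^sub>0 nat" where
  "monomial \<mu> = (\<Sum>i<k * N. Poly_Mapping.single (XE i 0) (\<mu> i))"

lemma expo_monomial: "i < k * N \<Longrightarrow> expo (monomial \<mu>) i = \<mu> i"
  by (simp add: expo_def monomial_def lookup_sum lookup_single when_def)

lemma std_det_cong: "(\<And>i. i < k * N \<Longrightarrow> \<mu> i = \<nu> i) \<Longrightarrow> std_det \<mu> = std_det \<nu>"
  unfolding std_det_def by (rule row_det_cong) auto

lemma lin_monomial: "lin (Poly_Mapping.single (monomial \<mu>) c) = Const c * std_det \<mu>"
  by (simp add: lin_single expo_monomial cong: std_det_cong)

text \<open>The Pieri rule for determinants. Sets \<open>U\<close> that produce equal exponents in a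
  block are kept, since the corresponding determinants vanish anyway.\<close>

lemma lin_monomial_elem_sym:
  assumes "C \<subseteq> {..<k * N}"
  shows "lin (elem_sym aux C r * Poly_Mapping.single (monomial \<nu>) 1) =
    (\<Sum>U | U \<subseteq> C \<and> card U = r. std_det (\<lambda>i. if i \<in> U then Suc (\<nu> i) else \<nu> i))"
proof -
  have "lin ((\<Prod>i\<in>U. aux i) * Poly_Mapping.single (monomial \<nu>) 1) =
      std_det (\<lambda>i. if i \<in> U then Suc (\<nu> i) else \<nu> i)" if "U \<subseteq> C" for U
  proof -
    have U2: "U \<subseteq> {..<k * N}" using that assms by blast
    then have U: "finite U" "U \<subseteq> {..<k * N}" using finite_subset by blast+
    have "(\<Prod>i\<in>U. aux i) * Poly_Mapping.single (monomial \<nu>) 1 =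
        Poly_Mapping.single ((\<Sum>i\<in>U. Poly_Mapping.single (XE i 0) 1) + monomial \<nu>) 1"
      using U(1)
    proof (induction U rule: finite_induct)
      case (insert i U)
      then show ?case using aux_power_mult_single[of i 1] by (simp add: mult.assoc add.assoc)
    qed simp
    then show ?thesis
      using U by (auto simp: lin_single Const_1 expo_def lookup_add lookup_sum lookup_single when_def
          expo_monomial[unfolded expo_def] intro!: std_det_cong)
  qed
  then show ?thesis by (simp add: elem_sym_def sum_distrib_right lin_sum)
qed

text \<open>Raising an exponent n adds 2 n + 1 to its square, so among all choices of equally many
  exponents to be raised, the largest ones give the greatest weight. The last block is left out
  because symmetric factors are collected there.\<close>

definition weight :: "(nat \<Rightarrow> nat) \<Rightarrow> nat" where
  "weight \<mu> = (\<Sum>i | i < k * N \<and> i mod k \<noteq> k - 1. \<mu> i ^ 2)"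

lemma weight_incr:
  assumes "U \<subseteq> {i. i < k * N \<and> i mod k \<noteq> k - 1}"
  shows "weight (\<lambda>i. if i \<in> U then Suc (\<nu> i) else \<nu> i) = weight \<nu> + (\<Sum>i\<in>U. 2 * \<nu> i + 1)"
proof -
  let ?C = "{i. i < k * N \<and> i mod k \<noteq> k - 1}"
  have "weight (\<lambda>i. if i \<in> U then Suc (\<nu> i) else \<nu> i) =
      (\<Sum>i\<in>?C. \<nu> i ^ 2 + (if i \<in> U then 2 * \<nu> i + 1 else 0))"
    unfolding weight_def by (intro sum.cong) (auto simp: power2_eq_square)
  also have "\<dots> = weight \<nu> + (\<Sum>i\<in>?C. if i \<in> U then 2 * \<nu> i + 1 else 0)"
    by (simp add: weight_def sum.distrib)
  also have "(\<Sum>i\<in>?C. if i \<in> U then 2 * \<nu> i + 1 else 0) = (\<Sum>i\<in>U. 2 * \<nu> i + 1)"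
    using assms by (subst sum.inter_restrict[symmetric]) (auto intro!: sum.cong)
  finally show ?thesis .
qed

lemma std_det_sorted_reducible:
  assumes inj: "\<And>a. a < k - 1 \<Longrightarrow> inj_on \<mu> (block a)"
    and img: "\<And>a. a < k - 1 \<Longrightarrow> \<mu> ` block a = {..<N}"
  shows "std_det \<mu> \<in> reducible"
proof -
  let ?A = "{0..<k * N}"
  \<comment> \<open>Matching the labels \<open>?f\<close> and \<open>?g\<close> sorts the exponents
    of each block. The residue in a label preserves the blocks, and positions of the last block are
    labelled by themselves, so they stay fixed.\<close>
  let ?f = "\<lambda>i. (i mod k, if i mod k = k - 1 then i else i div k)"
  let ?g = "\<lambda>i. (i mod k, if i mod k = k - 1 then i else \<mu> i)"
  have lt: "i mod k < k - 1" if "i mod k \<noteq> k - 1" for i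
    using that k mod_less_divisor[OF k, of i] by linarith
  have f: "inj_on ?f ?A"
  proof (rule inj_onI)
    fix i j assume "?f i = ?f j"
    then have "i mod k = j mod k" "i = j \<or> i div k = j div k" by (auto split: if_splits)
    then show "i = j" by (metis div_mult_mod_eq)
  qed
  have g: "inj_on ?g ?A"
  proof (rule inj_onI)
    fix i j assume ij: "i \<in> ?A" "j \<in> ?A" "?g i = ?g j"
    show "i = j"
    proof (cases "i mod k = k - 1")
      case False
      with ij have "i \<in> block (i mod k)" "j \<in> block (i mod k)" "\<mu> i = \<mu> j"
        by (auto simp: block_def split: if_splits)
      with inj[OF lt[OF False]] show ?thesis by (auto dest: inj_onD)
    qed (use ij in auto)
  qed
  have "?g ` ?A \<subseteq> ?f ` ?A"
  proof (rule image_subsetI)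
    fix i assume "i \<in> ?A"
    then have i: "i < k * N" by simp
    show "?g i \<in> ?f ` ?A"
    proof (cases "i mod k = k - 1")
      case True
      then show ?thesis using i by force
    next
      case False
      have "\<mu> i < N" using img[OF lt[OF False]] i by (auto simp: block_def)
      then have "\<mu> i * k + i mod k < k * N"
        using mult_add_less[of "\<mu> i" N "i mod k" k] k by (simp add: mult.commute)
      then show ?thesis using False k by (intro image_eqI[of _ _ "\<mu> i * k + i mod k"]) auto
    qed
  qed
  then have "?g ` ?A = ?f ` ?A"
    by (rule card_subset_eq[rotated]) (simp_all only: card_image[OF f] card_image[OF g] finite_imageI finite_atLeastLessThan)
  then have "image_mset ?f (mset_set ?A) = image_mset ?g (mset_set ?A)"
    by (simp only: image_mset_mset_set[OF f] image_mset_mset_set[OF g])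
  then obtain \<pi> where \<pi>: "\<pi> permutes ?A" "\<forall>i\<in>?A. ?f i = ?g (\<pi> i)"
    using image_mset_eq_implies_permutes[of ?A ?f ?g] by auto
  have mod: "\<pi> i mod k = i mod k" if "i < k * N" for i using \<pi>(2) that by auto
  have "std_det (\<lambda>i. \<mu> (\<pi> i)) = signof \<pi> * std_det \<mu>"
    using \<pi>(1) mod by (rule std_det_permute)
  then have eq: "std_det \<mu> = Const (signof \<pi>) * std_det (\<lambda>i. \<mu> (\<pi> i))"
    by (simp add: sign_def Const_1 Const_of_int)
  have "\<mu> (\<pi> i) = i div k" if "i < k * N" "i mod k \<noteq> k - 1" for i
    using \<pi>(2)[rule_format, of i] mod[OF that(1)] that by simp
  then have "last_expo (Poly_Mapping.single (monomial (\<lambda>i. \<mu> (\<pi> i))) 1)"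
    by (auto simp: last_expo_def expo_monomial)
  then have "std_det (\<lambda>i. \<mu> (\<pi> i)) \<in> reducible"
    unfolding reducible_def
    by (auto simp: lin_monomial Const_1 sl_image_0 intro!: exI[of _ "Poly_Mapping.single (monomial (\<lambda>i. \<mu> (\<pi> i))) 1"])
  then show ?thesis unfolding eq by (rule reducible_Const)
qed

text \<open>
  If some block of exponents omits a value \<open>v\<close> below its maximum, lower the exponents above \<open>v\<close>
  by one.  By the Pieri rule, multiplying back by an elementary symmetric function gives the original
  determinant plus terms of smaller weight, and modulo the Cartan currents this function may be
  moved to the last block, where it does not contribute to the weight.
\<close>

lemma std_det_reducible: "std_det \<mu> \<in> reducible"
proof (induction \<mu> rule: measure_induct_rule[where f = weight])
  case (less \<mu>)
  show ?case
  proof (cases "\<forall>a<k. inj_on \<mu> (block a)")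
    case False
    then obtain a i j where "i \<in> block a" "j \<in> block a" "i \<noteq> j" "\<mu> i = \<mu> j"
      by (auto simp: inj_on_def)
    then have "std_det \<mu> = 0"
      unfolding std_det_def by (intro row_det_eq_0[of i _ j]) (auto simp: block_def)
    then show ?thesis by (simp add: Wsub_reducible sl_image_0)
  next
    case inj: True
    show ?thesis
    proof (cases "\<forall>a<k - 1. \<mu> ` block a = {..<N}")
      case True
      then show ?thesis using inj by (intro std_det_sorted_reducible) auto
    next
      case False
      then obtain a where a: "a < k - 1" "\<mu> ` block a \<noteq> {..<N}" by auto
      then have ak: "a < k" by simp
      let ?C = "block a"
      have cardS: "card (\<mu> ` ?C) = N" using inj ak by (simp add: card_image card_block)
      \<comment> \<open>N distinct exponents other than 0, ..., N - 1 miss some \<open>v < N\<close>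
        and reach some value of at least N, so the set \<open>T\<close> of exponents above the gap
        is nonempty.\<close>
      have "\<not> {..<N} \<subseteq> \<mu> ` ?C"
        using a(2) card_subset_eq[of "\<mu> ` ?C" "{..<N}"] cardS by auto
      then obtain v where v: "v < N" "v \<notin> \<mu> ` ?C" by auto
      have "\<not> \<mu> ` ?C \<subseteq> {..<N}"
        using a(2) card_subset_eq[of "{..<N}" "\<mu> ` ?C"] cardS by auto
      then obtain i0 where i0: "i0 \<in> ?C" "\<mu> i0 \<ge> N" by force
      define T where "T = {i \<in> ?C. \<mu> i > v}"
      define \<nu> where "\<nu> = (\<lambda>i. if i \<in> T then \<mu> i - 1 else \<mu> i)"
      have T: "finite T" "T \<subseteq> ?C" "T \<noteq> {}" using i0 v by (auto simp: T_def)
      have \<mu>: "(\<lambda>i. if i \<in> T then Suc (\<nu> i) else \<nu> i) = \<mu>" by (auto simp: \<nu>_def T_def)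
      have ge: "\<nu> i \<ge> v" if "i \<in> T" for i using that by (auto simp: \<nu>_def T_def)
      have lt: "\<nu> i < v" if "i \<in> ?C - T" for i
      proof -
        have "\<mu> i \<noteq> v" using that v by auto
        then show ?thesis using that by (auto simp: \<nu>_def T_def)
      qed
      have C: "?C \<subseteq> {i. i < k * N \<and> i mod k \<noteq> k - 1}" using a by (auto simp: block_def)
      have w\<mu>: "weight \<mu> = weight \<nu> + (\<Sum>i\<in>T. 2 * \<nu> i + 1)"
        using weight_incr[of T \<nu>] T C unfolding \<mu> by blast
      let ?D = "\<lambda>U. std_det (\<lambda>i. if i \<in> U then Suc (\<nu> i) else \<nu> i)"
      let ?r = "card T"
      \<comment> \<open>Passing from \<open>T\<close> to \<open>U\<close> trades indices with
        \<open>\<nu> i \<ge> v\<close> for equally many with \<open>\<nu> i < v\<close>, so less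
        weight is added.\<close>
      have small: "?D U \<in> reducible" if U: "U \<subseteq> ?C" "card U = ?r" "U \<noteq> T" for U
      proof (rule less.IH)
        have fU: "finite U" using finite_subset[OF U(1) finite_block] .
        have cards: "card (U - T) = card (T - U)"
          using U(2) fU T(1) by (metis card_Diff_subset_Int finite_Int Int_commute)
        have "U - T \<noteq> {}"
        proof
          assume "U - T = {}"
          then show False using U T(1) card_subset_eq[of T U] by auto
        qed
        then have "(\<Sum>i\<in>U - T. 2 * \<nu> i + 1) < (\<Sum>i\<in>U - T. 2 * v + 1)"
          using fU U lt by (intro sum_strict_mono) auto
        also have "\<dots> = (\<Sum>i\<in>T - U. 2 * v + 1)" using cards by simp
        also have "\<dots> \<le> (\<Sum>i\<in>T - U. 2 * \<nu> i + 1)" using ge by (intro sum_mono) auto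
        finally have "(\<Sum>i\<in>U - T. 2 * \<nu> i + 1) < (\<Sum>i\<in>T - U. 2 * \<nu> i + 1)" .
        moreover have "(\<Sum>i\<in>U. 2 * \<nu> i + 1) = (\<Sum>i\<in>U \<inter> T. 2 * \<nu> i + 1) + (\<Sum>i\<in>U - T. 2 * \<nu> i + 1)"
          using fU by (rule sum.Int_Diff)
        moreover have "(\<Sum>i\<in>T. 2 * \<nu> i + 1) = (\<Sum>i\<in>U \<inter> T. 2 * \<nu> i + 1) + (\<Sum>i\<in>T - U. 2 * \<nu> i + 1)"
          using sum.Int_Diff[OF T(1), of "\<lambda>i. 2 * \<nu> i + 1" U] by (simp add: Int_commute)
        ultimately show "weight (\<lambda>i. if i \<in> U then Suc (\<nu> i) else \<nu> i) < weight \<mu>"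
          unfolding w\<mu> using weight_incr[of U \<nu>] U(1) C by simp
      qed
      have last: "?D U \<in> reducible" if U: "U \<subseteq> block (k - 1)" for U
      proof (rule less.IH)
        have "weight (\<lambda>i. if i \<in> U then Suc (\<nu> i) else \<nu> i) = weight \<nu>"
          unfolding weight_def using U by (intro sum.cong) (auto simp: block_def)
        also have "\<dots> < weight \<mu>"
        proof -
          obtain i where "i \<in> T" using T by blast
          then have "0 < (\<Sum>i\<in>T. 2 * \<nu> i + 1)" using T(1) by (intro sum_pos) auto
          then show ?thesis unfolding w\<mu> by simp
        qed
        finally show "weight (\<lambda>i. if i \<in> U then Suc (\<nu> i) else \<nu> i) < weight \<mu>" .
      qed
      let ?y = "Poly_Mapping.single (monomial \<nu>) (1::complex)"
      have sub: "block b \<subseteq> {..<k * N}" for b by (auto simp: block_def)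
      have "(elem_sym aux ?C ?r - elem_sym aux (block (k - 1)) ?r) \<in> cong_ideal"
        using ak k by (intro elem_sym_diff_in_ideal) auto
      then have "lin (elem_sym aux ?C ?r * ?y) - lin (elem_sym aux (block (k - 1)) ?r * ?y) \<in> Wsub"
        by (simp add: cong_ideal_def left_diff_distrib lin_diff)
      then have "lin (elem_sym aux ?C ?r * ?y) - lin (elem_sym aux (block (k - 1)) ?r * ?y) \<in> reducible"
        by (rule Wsub_reducible)
      moreover have "lin (elem_sym aux (block (k - 1)) ?r * ?y) \<in> reducible"
        unfolding lin_monomial_elem_sym[OF sub] by (intro reducible_sum last) auto
      ultimately have "lin (elem_sym aux ?C ?r * ?y) \<in> reducible"
        using reducible_add by fastforce
      moreover have "lin (elem_sym aux ?C ?r * ?y) =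
          std_det \<mu> + (\<Sum>U\<in>{U. U \<subseteq> ?C \<and> card U = ?r} - {T}. ?D U)"
        unfolding lin_monomial_elem_sym[OF sub] using T
        by (subst sum.remove[of _ T]) (auto simp: \<mu>)
      moreover have "(\<Sum>U\<in>{U. U \<subseteq> ?C \<and> card U = ?r} - {T}. ?D U) \<in> reducible"
        using small by (intro reducible_sum) auto
      ultimately show ?thesis using reducible_diff by fastforce
    qed
  qed
qed

lemma H_set_reducible:
  assumes "f \<in> H_set (k * N) k 1"
  shows "f \<in> reducible"
proof -
  obtain K :: "(entry \<Rightarrow>\<^sub>0 nat) set" and c a \<mu> where "finite K"
    and K: "\<And>m i. m \<in> K \<Longrightarrow> i < k * N \<Longrightarrow> c m i < k"
    "f = (\<Sum>m\<in>K. Const (a m) * row_det k (k * N) (c m) (\<mu> m))"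
    by (rule H_set_1_eq_sum_row_det[OF assms]) blast
  have "row_det k (k * N) (c m) (\<mu> m) \<in> reducible" if m: "m \<in> K" for m
  proof (cases "\<forall>a b. a < k \<longrightarrow> b < k \<longrightarrow>
      card {i. i < k * N \<and> c m i = a} = card {i. i < k * N \<and> c m i = b}")
    case True
    then have eq: "card {i. i < k * N \<and> c m i = a} = card {i. i < k * N \<and> c m i = b}"
      if "a < k" "b < k" for a b using that by blast
    obtain \<epsilon> \<nu> where "row_det k (k * N) (c m) (\<mu> m) = Const \<epsilon> * std_det \<nu>"
      by (rule row_det_balanced[of "c m" "\<mu> m", OF K(1)[OF m] eq])
    then show ?thesis using reducible_Const[OF std_det_reducible] by simp
  next
    case False
    then obtain a b where "a < k" "b < k"
      "card {i. i < k * N \<and> c m i = a} \<noteq> card {i. i < k * N \<and> c m i = b}" by blast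
    then show ?thesis by (intro Wsub_reducible row_det_unbalanced[of "c m" a b, OF K(1)[OF m]])
  qed
  then show ?thesis unfolding K(2) by (intro reducible_sum reducible_Const)
qed

end


section \<open>The kernel of the level-rank map\<close>

lemma elem_sym_permute:
  assumes "finite S" "\<sigma> permutes S"
  shows "elem_sym (\<lambda>i. y (\<sigma> i)) S r = elem_sym y S r"
  unfolding elem_sym_eq_fps_nth[OF assms(1)]
  by (simp add: prod.permute[OF assms(2), of "\<lambda>i. 1 + fps_const (y i) * fps_X"] comp_def)

text \<open>Vieta's formulas. When \<open>x\<close> is one of the roots, the vanishing of the left
  side is the linear recurrence for its powers that the companion matrix encodes.\<close>

lemma prod_diff_eq_elem_sym:
  assumes "finite S"
  shows "(\<Prod>i\<in>S. x - y i) = (\<Sum>r\<le>card S. (- 1) ^ r * elem_sym y S r * x ^ (card S - r))"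
proof -
  have "(\<Prod>i\<in>S. x - y i) = (\<Prod>i\<in>S. - y i + x)" by simp
  also have "\<dots> = (\<Sum>U\<in>Pow S. (\<Prod>i\<in>U. - y i) * (\<Prod>i\<in>S - U. x))"
    by (rule prod_add[OF assms])
  also have "\<dots> = (\<Sum>U\<in>Pow S. (- 1) ^ card U * (\<Prod>i\<in>U. y i) * x ^ (card S - card U))"
  proof (intro sum.cong refl)
    fix U assume "U \<in> Pow S"
    then have "finite U" "U \<subseteq> S" using assms finite_subset by auto
    then show "(\<Prod>i\<in>U. - y i) * (\<Prod>i\<in>S - U. x) = (- 1) ^ card U * (\<Prod>i\<in>U. y i) * x ^ (card S - card U)"
      by (simp add: card_Diff_subset prod_uminus)
  qed
  also have "\<dots> = (\<Sum>r\<le>card S. \<Sum>U\<in>{U \<in> Pow S. card U = r}.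
      (- 1) ^ card U * (\<Prod>i\<in>U. y i) * x ^ (card S - card U))"
    using assms by (intro sum.group[symmetric]) (auto intro: card_mono)
  also have "\<dots> = (\<Sum>r\<le>card S. (- 1) ^ r * elem_sym y S r * x ^ (card S - r))"
    unfolding elem_sym_def sum_distrib_left sum_distrib_right
    by (intro sum.cong) auto
  finally show ?thesis .
qed

definition alternant :: "nat \<Rightarrow> (nat \<Rightarrow> nat) \<Rightarrow> (nat \<Rightarrow> complex) \<Rightarrow> complex" where
  "alternant N \<mu> x = det (mat N N (\<lambda>(s, t). x t ^ \<mu> s))"

lemma alternant_eq_sum_rows:
  "alternant N \<mu> x = (\<Sum>\<sigma> | \<sigma> permutes {0..<N}. signof \<sigma> * (\<Prod>s<N. x (\<sigma> s) ^ \<mu> s))"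
  unfolding alternant_def
  by (subst det_def'[of _ N]) (auto simp: permutes_in_image lessThan_atLeast0 intro!: sum.cong prod.cong)

lemma alternant_eq_sum_cols:
  "alternant N \<mu> x = (\<Sum>\<sigma> | \<sigma> permutes {0..<N}. signof \<sigma> * (\<Prod>t<N. x t ^ \<mu> (\<sigma> t)))"
  unfolding alternant_def
  by (subst det_col[of _ N]) (auto simp: permutes_in_image intro!: sum.cong prod.cong)

lemma alternant_not_inj:
  assumes "\<not> inj_on x {..<N}"
  shows "alternant N \<mu> x = 0"
proof -
  obtain i j where ij: "i < N" "j < N" "i \<noteq> j" "x i = x j" using assms by (auto simp: inj_on_def)
  then show ?thesis
    unfolding alternant_def by (intro det_identical_columns[of _ N i j]) (auto intro!: eq_vecI)
qed

lemma alternant_vandermonde: "alternant N (\<lambda>s. s) x = det (vandermonde N x)"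
  by (simp add: alternant_def vandermonde_def)

abbreviation ones :: "nat \<Rightarrow> complex mat" where
  "ones N \<equiv> mat 1 N (\<lambda>_. 1)"

text \<open>The torus moves every row vector with nonzero entries to the vector of ones.\<close>

lemma H_set_row_eq_0I:
  assumes f: "f \<in> H_set N 1 l"
    and zero: "\<And>x. inj_on x {..<N} \<Longrightarrow> peval f (mat_diag N x) (ones N) = 0"
  shows "f = 0"
proof (rule H_set_eq_0I[OF f])
  fix x :: "nat \<Rightarrow> complex" and A :: "complex mat"
  assume x: "inj_on x {..<N}" and A: "A \<in> carrier_mat 1 N"
  note fr = H_set_poly_ring[OF f]
  let ?D = "mat_diag N x"
  have nz: "peval f ?D B = 0" if B: "B \<in> carrier_mat 1 N" "\<And>i. i < N \<Longrightarrow> B $$ (0, i) \<noteq> 0" for B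
  proof -
    define h where "h = mat_diag N (\<lambda>i. B $$ (0, i))"
    define g where "g = mat_diag N (\<lambda>i. 1 / B $$ (0, i))"
    have gh: "g * h = 1\<^sub>m N" "h * g = 1\<^sub>m N"
      unfolding g_def h_def mat_diag_diag using B(2) by (auto simp: mat_diag_def intro!: eq_matI)
    have D: "g * ?D * h = ?D"
      unfolding g_def h_def mat_diag_diag using B(2) by (auto simp: mat_diag_def intro!: eq_matI)
    have Bh: "ones N * h = B"
      unfolding h_def using B(1) by (subst mat_diag_mult_right[of _ 1]) (auto intro!: eq_matI)
    have "peval f (g * ?D * h) (ones N * h) = det h ^ l * peval f ?D (ones N)"
      using gh by (intro peval_conjugate[OF f]) (auto simp: g_def h_def)
    then show ?thesis unfolding D Bh using zero[OF x] by simp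
  qed
  \<comment> \<open>Adding t to every entry of \<open>A\<close> makes all of them nonzero for all
    but finitely many t.\<close>
  define u where "u = (\<lambda>v. case v of XE _ _ \<Rightarrow> 0 | AE _ _ \<Rightarrow> (1::complex))"
  have line: "ev f (\<lambda>v. asg ?D A v + t * u v) = peval f ?D (A + t \<cdot>\<^sub>m ones N)" for t
    unfolding ev_eq_peval[OF fr] using A
    by (intro peval_cong[OF fr]) (auto simp: Xof_def Aof_def asg_def u_def mat_diag_def)
  have "finite {t. \<exists>i<N. A $$ (0, i) + t = 0}"
  proof (rule finite_subset)
    show "{t. \<exists>i<N. A $$ (0, i) + t = 0} \<subseteq> (\<lambda>i. - A $$ (0, i)) ` {..<N}"
      by (auto simp: add_eq_0_iff)
  qed simp
  then have "infinite (- {t. \<exists>i<N. A $$ (0, i) + t = 0})"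
    by (simp add: Compl_eq_Diff_UNIV Diff_infinite_finite infinite_UNIV_char_0)
  moreover have "- {t. \<exists>i<N. A $$ (0, i) + t = 0} \<subseteq> {t. ev f (\<lambda>v. asg ?D A v + t * u v) = 0}"
    unfolding line using A by (auto intro!: nz)
  ultimately have "infinite {t. ev f (\<lambda>v. asg ?D A v + t * u v) = 0}"
    using infinite_super by blast
  from ev_line_eq_0[OF this, of 0] show "peval f ?D A = 0" by (simp add: peval_def)
qed

section \<open>The level-rank map at diagonal matrices\<close>

context
  fixes k N :: nat
  assumes k: "k > 0"
begin

lemma div_mod_last: "(s * k + k - Suc 0) mod k = k - Suc 0" "(s * k + k - Suc 0) div k = s"
proof -
  have eq: "s * k + k - Suc 0 = (k - Suc 0) + s * k" using k by simp
  show "(s * k + k - Suc 0) mod k = k - Suc 0" "(s * k + k - Suc 0) div k = s"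
    unfolding eq using k by (simp_all only: mod_mult_self1 div_mult_self1) simp_all
qed

lemma kron1_mat_diag: "kron1 k (mat_diag N x) = mat_diag (k * N) (\<lambda>i. x (i div k))"
proof (rule eq_matI)
  fix i j assume "i < dim_row (mat_diag (k * N) (\<lambda>i. x (i div k)))" "j < dim_col (mat_diag (k * N) (\<lambda>i. x (i div k)))"
  then have ij: "i < N * k" "j < N * k" by (auto simp: mat_diag_def mult.commute)
  then have "i div k < N" "j div k < N" by (auto simp: less_mult_imp_div_less)
  moreover have "i = j" if "i mod k = j mod k" "i div k = j div k" using that by (metis div_mult_mod_eq)
  ultimately show "kron1 k (mat_diag N x) $$ (i, j) = mat_diag (k * N) (\<lambda>i. x (i div k)) $$ (i, j)"
    using ij by (subst kron1_index[OF mat_diag_carrier]) (auto simp: mat_diag_def mult.commute[of k N])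
qed (auto simp: kronecker_def mat_diag_def)

text \<open>At these arguments an entry of the matrix vanishes unless its row and column have the
  same residue modulo k, so the determinant splits into one alternant for each colour.\<close>

lemma level_rank_std_det:
  "peval (level_rank k N (std_det k N \<mu>)) (mat_diag N x) (ones N) =
    (\<Prod>a<k. alternant N (\<lambda>s. \<mu> (s * k + a)) x)"
proof -
  have "peval (level_rank k N (std_det k N \<mu>)) (mat_diag N x) (ones N) =
      peval (std_det k N \<mu>) (mat_diag (k * N) (\<lambda>i. x (i div k))) (kron1 k (ones N))"
    unfolding kron1_mat_diag[symmetric]
    by (intro peval_level_rank H_set_poly_ring[OF std_det_H_set[OF k]]) auto
  also have "\<dots> = det (mat (k * N) (k * N)
      (\<lambda>(i, j). kron1 k (ones N) $$ (i mod k, j) * x (j div k) ^ \<mu> i))"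
    unfolding std_det_def[OF k] using k kron1_carrier[of "ones N" 1 N k]
    by (intro peval_row_det_diag) (auto simp: mult.commute[of k N])
  also have "mat (k * N) (k * N) (\<lambda>(i, j). kron1 k (ones N) $$ (i mod k, j) * x (j div k) ^ \<mu> i) =
      interleave k N (\<lambda>a. mat N N (\<lambda>(s, t). x t ^ \<mu> (s * k + a)))"
  proof (rule eq_matI)
    fix i j assume "i < dim_row (interleave k N (\<lambda>a. mat N N (\<lambda>(s, t). x t ^ \<mu> (s * k + a))))"
      "j < dim_col (interleave k N (\<lambda>a. mat N N (\<lambda>(s, t). x t ^ \<mu> (s * k + a))))"
    then have ij: "i < N * k" "j < N * k" by (auto simp: interleave_def)
    then have "i div k < N" "j div k < N" by (auto simp: less_mult_imp_div_less)
    moreover have "kron1 k (ones N) $$ (i mod k, j) = (if i mod k = j mod k then 1 else 0)"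
      using k ij \<open>j div k < N\<close> by (subst kron1_index[of _ 1 N]) auto
    moreover have "i div k * k + j mod k = i" if "i mod k = j mod k" using that by (metis div_mult_mod_eq)
    ultimately show "mat (k * N) (k * N) (\<lambda>(i, j). kron1 k (ones N) $$ (i mod k, j) * x (j div k) ^ \<mu> i) $$ (i, j) =
        interleave k N (\<lambda>a. mat N N (\<lambda>(s, t). x t ^ \<mu> (s * k + a))) $$ (i, j)"
      using ij by (auto simp: interleave_def mult.commute[of k N] simp del: div_mult_mod_eq)
  qed (auto simp: interleave_def mult.commute[of k N])
  also have "det \<dots> = (\<Prod>a<k. alternant N (\<lambda>s. \<mu> (s * k + a)) x)"
    using k by (subst det_interleave) (auto simp: alternant_def)
  finally show ?thesis .
qed

lemma level_rank_std_det_last: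
  assumes "\<And>i. i < k * N \<Longrightarrow> i mod k \<noteq> k - 1 \<Longrightarrow> \<mu> i = i div k"
  shows "peval (level_rank k N (std_det k N \<mu>)) (mat_diag N x) (ones N) =
    det (vandermonde N x) ^ (k - 1) * alternant N (\<lambda>s. \<mu> (s * k + (k - 1))) x"
proof -
  have "alternant N (\<lambda>s. \<mu> (s * k + a)) x = det (vandermonde N x)" if "a < k - 1" for a
  proof -
    have "\<mu> (s * k + a) = s" if "s < N" for s
      using assms[of "s * k + a"] mult_add_less[OF that, of a k] \<open>a < k - 1\<close>
      by (simp add: mult.commute[of k N])
    then show ?thesis
      unfolding alternant_vandermonde[symmetric] alternant_def
      by (intro arg_cong[of _ _ det] eq_matI) auto
  qed
  moreover have "{..<k} = insert (k - 1) {..<k - 1}" using k by auto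
  ultimately show ?thesis unfolding level_rank_std_det by simp
qed

lemma peval_level_rank_lin:
  assumes "last_expo k N P"
  shows "peval (level_rank k N (lin k N P)) (mat_diag N x) (ones N) =
    det (vandermonde N x) ^ (k - 1) * (\<Sum>m\<in>Poly_Mapping.keys P. Poly_Mapping.lookup P m *
      alternant N (\<lambda>s. expo m (s * k + (k - 1))) x)"
proof -
  have H: "(\<Sum>m\<in>S. Const (a m) * std_det k N (\<mu> m)) \<in> H_set (k * N) k 1" for S a \<mu>
    by (intro H_set_sum H_set_Const std_det_H_set k)
  have "peval (level_rank k N (lin k N P)) (mat_diag N x) (ones N) =
      peval (lin k N P) (kron1 k (mat_diag N x)) (kron1 k (ones N))"
    unfolding lin_def[OF k] by (intro peval_level_rank H_set_poly_ring[OF H]) auto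
  also have "\<dots> = (\<Sum>m\<in>Poly_Mapping.keys P. Poly_Mapping.lookup P m *
      peval (level_rank k N (std_det k N (expo m))) (mat_diag N x) (ones N))"
    by (simp add: lin_def[OF k] peval_level_rank[OF H_set_poly_ring[OF std_det_H_set[OF k]]])
  also have "\<dots> = (\<Sum>m\<in>Poly_Mapping.keys P. Poly_Mapping.lookup P m *
      (det (vandermonde N x) ^ (k - 1) * alternant N (\<lambda>s. expo m (s * k + (k - 1))) x))"
    using assms by (intro sum.cong refl, subst level_rank_std_det_last) (auto simp: last_expo_def[OF k])
  finally show ?thesis by (simp add: sum_distrib_left mult_ac)
qed

section \<open>Injectivity on reduced elements\<close>

definition last_perm :: "(nat \<Rightarrow> nat) \<Rightarrow> nat \<Rightarrow> nat" where
  "last_perm \<sigma> i = (if i < k * N \<and> i mod k = k - 1 then \<sigma> (i div k) * k + (k - 1) else i)"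

lemma last_perm:
  assumes \<sigma>: "\<sigma> permutes {0..<N}"
  shows "last_perm \<sigma> permutes {0..<k * N}" "i < k * N \<Longrightarrow> last_perm \<sigma> i mod k = i mod k"
    "(signof (last_perm \<sigma>) :: complex) = signof \<sigma>"
proof -
  have lt: "\<sigma> s < N" if "s < N" for s using permutes_in_image[OF \<sigma>, of s] that by simp
  have dlt: "i div k < N" if "i < k * N" for i using that by (simp add: less_mult_imp_div_less mult.commute)
  have im: "last_perm \<sigma> i < k * N" if "i < k * N" for i
    using that mult_add_less[OF lt[OF dlt[OF that]], of "k - 1" k] k
    by (auto simp: last_perm_def mult.commute[of k N])
  show mod: "i < k * N \<Longrightarrow> last_perm \<sigma> i mod k = i mod k" for i
    using k by (auto simp: last_perm_def div_mod_last)
  have dv: "last_perm \<sigma> i div k = (if i mod k = k - 1 then \<sigma> (i div k) else i div k)" if "i < k * N" for i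
    using that k by (auto simp: last_perm_def div_mod_last)
  have inj: "inj_on (last_perm \<sigma>) {0..<k * N}"
  proof (rule inj_onI)
    fix i j assume ij: "i \<in> {0..<k * N}" "j \<in> {0..<k * N}" "last_perm \<sigma> i = last_perm \<sigma> j"
    have m: "i mod k = j mod k" using mod[of i] mod[of j] ij by simp
    have "last_perm \<sigma> i div k = last_perm \<sigma> j div k" using ij(3) by simp
    then have "\<sigma> (i div k) = \<sigma> (j div k) \<or> i div k = j div k"
      using ij(1,2) m by (simp only: dv atLeastLessThan_iff split: if_splits) simp_all
    then have "i div k = j div k" using injD[OF permutes_inj[OF \<sigma>]] by blast
    with m show "i = j" by (metis div_mult_mod_eq)
  qed
  then have "bij_betw (last_perm \<sigma>) {0..<k * N} {0..<k * N}"
    using im by (intro bij_betw_imageI endo_inj_surj) auto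
  then show perm: "last_perm \<sigma> permutes {0..<k * N}"
    by (rule bij_imp_permutes) (auto simp: last_perm_def)
  \<comment> \<open>The sign is read off as the determinant of the permutation matrix, which is a
    direct sum of k - 1 identity matrices and the permutation matrix of
    \<open>\<sigma>\<close>.\<close>
  let ?P = "mat (k * N) (k * N) (\<lambda>(i, j). 1\<^sub>m (k * N) $$ (last_perm \<sigma> i, j)) :: complex mat"
  have "(signof (last_perm \<sigma>) :: complex) = det ?P"
    using det_permute_rows[OF one_carrier_mat perm, where 'a = complex] by simp
  also have "?P = interleave k N (\<lambda>a. mat N N (\<lambda>(s, t). 1\<^sub>m N $$ ((if a = k - 1 then \<sigma> s else s), t)))"
  proof (rule eq_matI)
    let ?I = "interleave k N (\<lambda>a. mat N N (\<lambda>(s, t). 1\<^sub>m N $$ ((if a = k - 1 then \<sigma> s else s), t)))"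
    fix i j assume "i < dim_row ?I" "j < dim_col ?I"
    then have ij: "i < k * N" "j < k * N" by (auto simp: interleave_def mult.commute)
    have "last_perm \<sigma> i = j \<longleftrightarrow> last_perm \<sigma> i mod k = j mod k \<and> last_perm \<sigma> i div k = j div k"
      by (metis div_mult_mod_eq)
    then have "last_perm \<sigma> i = j \<longleftrightarrow>
        i mod k = j mod k \<and> (if i mod k = k - 1 then \<sigma> (i div k) else i div k) = j div k"
      using mod[OF ij(1)] dv[OF ij(1)] by simp
    then show "?P $$ (i, j) = ?I $$ (i, j)"
      using ij dlt[OF ij(1)] dlt[OF ij(2)] lt im[OF ij(1)]
      by (auto simp: interleave_def mult.commute[of k N])
  qed (auto simp: interleave_def mult.commute)
  also have "det \<dots> = (\<Prod>a<k. if a = k - 1 then signof \<sigma> else 1)"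
  proof (subst det_interleave[OF k], simp, intro prod.cong refl)
    fix a
    show "det (mat N N (\<lambda>(s, t). 1\<^sub>m N $$ ((if a = k - 1 then \<sigma> s else s), t)) :: complex mat) =
        (if a = k - 1 then signof \<sigma> else 1)"
    proof (cases "a = k - 1")
      case True
      then show ?thesis using det_permute_rows[OF one_carrier_mat \<sigma>, where 'a = complex] by simp
    next
      case False
      have "mat N N (\<lambda>(s, t). 1\<^sub>m N $$ (s, t)) = (1\<^sub>m N :: complex mat)" by (rule eq_matI) auto
      with False show ?thesis by simp
    qed
  qed
  also have "\<dots> = signof \<sigma>" using k by simp
  finally show "(signof (last_perm \<sigma>) :: complex) = signof \<sigma>" .
qed

text \<open>\<open>Q\<close> is \<open>P\<close> antisymmetrized in the variables of the last block.
  Its values are a fixed monomial in the other variables times the sum of alternants that the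
  level-rank map detects, so \<open>Q\<close> vanishes as a polynomial. On the other hand,
  antisymmetrization changes the value of \<open>lin\<close> only by the factor N!.\<close>

lemma lin_eq_0:
  assumes P: "last_expo k N P" and zero: "level_rank k N (lin k N P) = 0"
  shows "lin k N P = 0"
proof -
  let ?K = "Poly_Mapping.keys P" and ?S = "{\<sigma>. \<sigma> permutes {0..<N}}"
  define \<mu> where "\<mu> = (\<lambda>m \<sigma> i. expo m (last_perm \<sigma> i))"
  define Q where "Q = (\<Sum>m\<in>?K. \<Sum>\<sigma>\<in>?S.
    Poly_Mapping.single (monomial k N (\<mu> m \<sigma>)) (Poly_Mapping.lookup P m * signof \<sigma>))"
  \<comment> \<open>The identity is required at all points, since \<open>ev Q\<close> is tested on
    all assignments. Where coordinates coincide, the Vandermonde factor cannot be cancelled, but the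
    alternants themselves vanish.\<close>
  have alt: "(\<Sum>m\<in>?K. Poly_Mapping.lookup P m * alternant N (\<lambda>s. expo m (s * k + (k - 1))) x) = 0" for x
  proof (cases "inj_on x {..<N}")
    case True
    have "det (vandermonde N x) ^ (k - 1) * (\<Sum>m\<in>?K. Poly_Mapping.lookup P m *
      alternant N (\<lambda>s. expo m (s * k + (k - 1))) x) = 0"
      using peval_level_rank_lin[OF P, of x] zero by simp
    then show ?thesis using det_vandermonde_nonzero[OF True] by simp
  qed (simp add: alternant_not_inj)
  have "ev Q w = 0" for w
  proof -
    \<comment> \<open>The auxiliary variables of the last block play the part of the
      eigenvalues.\<close>
    let ?x = "\<lambda>t. w (XE (t * k + (k - 1)) 0)"
    define c where "c = (\<Prod>s<N. \<Prod>a<k - 1. w (XE (s * k + a) 0) ^ s)"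
    have mon: "monom_at w (monomial k N (\<mu> m \<sigma>)) =
        c * (\<Prod>t<N. ?x t ^ expo m (\<sigma> t * k + (k - 1)))" if m: "m \<in> ?K" and \<sigma>: "\<sigma> permutes {0..<N}" for m \<sigma>
    proof -
      have "monom_at w (\<Sum>i\<in>I. Poly_Mapping.single (XE i 0) (\<nu> i)) = (\<Prod>i\<in>I. w (XE i 0) ^ \<nu> i)" for I \<nu>
        by (induction I rule: infinite_finite_induct) (auto simp: monom_at_add)
      then have "monom_at w (monomial k N (\<mu> m \<sigma>)) = (\<Prod>i<N * k. w (XE i 0) ^ \<mu> m \<sigma> i)"
        by (simp add: monomial_def[OF k] mult.commute[of k N])
      also have "\<dots> = (\<Prod>s<N. \<Prod>a<k. w (XE (s * k + a) 0) ^ \<mu> m \<sigma> (s * k + a))"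
        by (rule prod_div_mod[OF k])
      also have "\<dots> = (\<Prod>s<N. (\<Prod>a<k - 1. w (XE (s * k + a) 0) ^ s) * ?x s ^ expo m (\<sigma> s * k + (k - 1)))"
      proof (rule prod.cong[OF refl])
        fix s assume "s \<in> {..<N}"
        then have s: "s < N" by simp
        have 1: "\<mu> m \<sigma> (s * k + a) = s" if "a < k - 1" for a
        proof -
          have lt: "s * k + a < k * N" using mult_add_less[OF s, of a k] that by (simp add: mult.commute[of k N])
          then have "\<mu> m \<sigma> (s * k + a) = expo m (s * k + a)" using that by (simp add: \<mu>_def last_perm_def)
          also have "\<dots> = s" using P m lt that by (auto simp: last_expo_def[OF k])
          finally show ?thesis .
        qed
        have 2: "\<mu> m \<sigma> (s * k + (k - 1)) = expo m (\<sigma> s * k + (k - 1))"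
          using mult_add_less[OF s, of "k - 1" k] k by (simp add: \<mu>_def last_perm_def mult.commute[of k N] div_mod_last)
        have "{..<k} = insert (k - 1) {..<k - 1}" using k by auto
        then show "(\<Prod>a<k. w (XE (s * k + a) 0) ^ \<mu> m \<sigma> (s * k + a)) =
            (\<Prod>a<k - 1. w (XE (s * k + a) 0) ^ s) * ?x s ^ expo m (\<sigma> s * k + (k - 1))"
          by (simp only:) (simp add: 1 2[simplified])
      qed
      finally show ?thesis by (simp add: prod.distrib c_def)
    qed
    have "ev Q w = (\<Sum>m\<in>?K. \<Sum>\<sigma>\<in>?S. Poly_Mapping.lookup P m * signof \<sigma> *
        (c * (\<Prod>t<N. ?x t ^ expo m (\<sigma> t * k + (k - 1)))))"
      unfolding Q_def ev_sum ev_single by (intro sum.cong refl) (simp add: mon)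
    also have "\<dots> = c * (\<Sum>m\<in>?K. Poly_Mapping.lookup P m * alternant N (\<lambda>s. expo m (s * k + (k - 1))) ?x)"
      unfolding alternant_eq_sum_cols sum_distrib_left by (intro sum.cong refl) (simp add: mult_ac)
    finally show ?thesis by (simp only: alt mult_zero_right)
  qed
  then have "Q = 0" by (rule ev_eq_0_imp)
  have "0 = lin k N Q" using \<open>Q = 0\<close> by (simp add: lin_0[OF k])
  also have "\<dots> = (\<Sum>m\<in>?K. \<Sum>\<sigma>\<in>?S. Const (Poly_Mapping.lookup P m * signof \<sigma>) * std_det k N (\<mu> m \<sigma>))"
    by (simp add: Q_def lin_sum[OF k] lin_monomial[OF k])
  also have "\<dots> = (\<Sum>m\<in>?K. \<Sum>\<sigma>\<in>?S. Const (Poly_Mapping.lookup P m) * std_det k N (expo m))"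
  proof (intro sum.cong refl)
    fix m \<sigma> assume "\<sigma> \<in> ?S"
    then have \<sigma>: "\<sigma> permutes {0..<N}" by simp
    \<comment> \<open>The determinant is already alternating in the last block: its sign cancels the
      one in \<open>Q\<close>, and all \<open>\<sigma>\<close> contribute equally.\<close>
    have "std_det k N (\<mu> m \<sigma>) = signof (last_perm \<sigma>) * std_det k N (expo m)"
      unfolding \<mu>_def by (rule std_det_permute[OF k last_perm(1)[OF \<sigma>] last_perm(2)[OF \<sigma>]])
    also have "\<dots> = Const (signof (last_perm \<sigma>)) * std_det k N (expo m)" by (simp add: Const_of_int)
    also have "\<dots> = Const (signof \<sigma>) * std_det k N (expo m)" by (simp only: last_perm(3)[OF \<sigma>])
    finally have "std_det k N (\<mu> m \<sigma>) = Const (signof \<sigma>) * std_det k N (expo m)" .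
    moreover have "Const (signof \<sigma>) * Const (signof \<sigma>) = 1"
      by (simp add: sign_def Const_1 flip: Const_mult)
    then have "Const (signof \<sigma>) * (Const (signof \<sigma>) * R) = R" for R
      by (simp flip: mult.assoc)
    ultimately show "Const (Poly_Mapping.lookup P m * signof \<sigma>) * std_det k N (\<mu> m \<sigma>) =
        Const (Poly_Mapping.lookup P m) * std_det k N (expo m)"
      by (simp only: Const_mult mult.assoc)
  qed
  also have "\<dots> = Const (fact N) * lin k N P"
    using Const_of_nat[of "fact N"]
    by (simp add: lin_def[OF k] card_permutations sum_distrib_left)
  finally have "Const (1 / fact N) * (Const (fact N) * lin k N P) = 0" by simp
  then show ?thesis by (simp add: Const_1 flip: mult.assoc Const_mult)
qed

lemma level_rank_kernel: "sl_image (k * N) k 1 = {f \<in> H_set (k * N) k 1. level_rank k N f = 0}"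
proof (intro equalityI subsetI)
  fix f assume "f \<in> sl_image (k * N) k 1"
  then show "f \<in> {f \<in> H_set (k * N) k 1. level_rank k N f = 0}"
    using sl_image_subset level_rank_sl_image[OF k] by blast
next
  fix f assume f: "f \<in> {f \<in> H_set (k * N) k 1. level_rank k N f = 0}"
  then have "f \<in> reducible k N" using H_set_reducible[OF k] by simp
  then obtain P where P: "last_expo k N P" "f - lin k N P \<in> sl_image (k * N) k 1"
    by (auto simp: reducible_def[OF k])
  have L: "lin k N P \<in> H_set (k * N) k 1"
    unfolding lin_def[OF k] by (intro H_set_sum H_set_Const std_det_H_set k)
  have "level_rank k N f = level_rank k N (f - lin k N P) + level_rank k N (lin k N P)"
    using level_rank_add[of "f - lin k N P" k N "lin k N P"] f L by (auto intro: H_set_poly_ring H_set_diff)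
  then have "level_rank k N (lin k N P) = 0"
    using f level_rank_sl_image[OF k P(2)] by simp
  then have "lin k N P = 0" by (rule lin_eq_0[OF P(1)])
  then show "f \<in> sl_image (k * N) k 1" using P(2) by simp
qed

end


section \<open>Surjectivity\<close>

text \<open>The companion matrix of the monic polynomial with roots
  \<open>y 0, ..., y (N - 1)\<close>. Its entries are symmetric polynomials in the roots, so
  evaluating a semi-invariant at it gives a symmetric polynomial without any division by the
  Vandermonde determinant. The ring is arbitrary because the roots are variables in one place and
  complex numbers in another.\<close>

definition companion :: "nat \<Rightarrow> (nat \<Rightarrow> 'a :: comm_ring_1) \<Rightarrow> 'a mat" where
  "companion N y = mat N N (\<lambda>(i, j). if Suc i < N then (if j = Suc i then 1 else 0)
     else - ((- 1) ^ (N - j) * elem_sym y {..<N} (N - j)))"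

definition unit_row :: "nat \<Rightarrow> 'a :: comm_ring_1 mat" where
  "unit_row N = mat 1 N (\<lambda>(_, j). if j = 0 then 1 else 0)"

lemma companion_carrier [simp]: "companion N y \<in> carrier_mat N N"
  by (simp add: companion_def)

lemma unit_row_carrier [simp]: "unit_row N \<in> carrier_mat 1 N" "unit_row N \<in> carrier_mat (Suc 0) N"
  by (simp_all add: unit_row_def)

lemma vandermonde_carrier [simp]: "vandermonde N x \<in> carrier_mat N N"
  by (simp add: vandermonde_def)

text \<open>Column \<open>j\<close> of the Vandermonde matrix consists of the powers of
  \<open>x j\<close> and is an eigenvector of the companion matrix: the upper rows shift the powers,
  the last row is the recurrence.\<close>

lemma vandermonde_mult_diag: "vandermonde N x * mat_diag N x = companion N x * vandermonde N x"
proof (rule eq_matI)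
  fix i j assume "i < dim_row (companion N x * vandermonde N x)" "j < dim_col (companion N x * vandermonde N x)"
  then have ij: "i < N" "j < N" by (auto simp: companion_def vandermonde_def)
  have "(vandermonde N x * mat_diag N x) $$ (i, j) = x j ^ Suc i"
    using ij by (subst mat_diag_mult_right[of _ N]) (auto simp: vandermonde_def)
  also have "\<dots> = (\<Sum>l<N. companion N x $$ (i, l) * x j ^ l)"
  proof (cases "Suc i < N")
    case True
    then have "(\<Sum>l<N. companion N x $$ (i, l) * x j ^ l) = (\<Sum>l<N. if l = Suc i then x j ^ l else 0)"
      using ij by (intro sum.cong) (auto simp: companion_def)
    then show ?thesis using True by simp
  next
    case False
    then have N: "Suc i = N" using ij by simp
    have "0 = (\<Prod>i<N. x j - x i)" using ij by (intro prod_zero[symmetric]) auto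
    also have "\<dots> = (\<Sum>r\<le>N. (- 1) ^ r * elem_sym x {..<N} r * x j ^ (N - r))"
      using prod_diff_eq_elem_sym[of "{..<N}" "x j" x] by simp
    also have "\<dots> = (\<Sum>l\<le>N. (- 1) ^ (N - l) * elem_sym x {..<N} (N - l) * x j ^ l)"
      by (rule sum.reindex_bij_witness[of _ "\<lambda>l. N - l" "\<lambda>l. N - l"]) auto
    also have "\<dots> = (\<Sum>l<N. (- 1) ^ (N - l) * elem_sym x {..<N} (N - l) * x j ^ l) + x j ^ N"
      by (simp add: elem_sym_0 flip: lessThan_Suc_atMost)
    finally have "x j ^ N = - (\<Sum>l<N. (- 1) ^ (N - l) * elem_sym x {..<N} (N - l) * x j ^ l)"
      by (simp add: eq_neg_iff_add_eq_0 add.commute)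
    also have "\<dots> = (\<Sum>l<N. companion N x $$ (i, l) * x j ^ l)"
      unfolding sum_negf[symmetric] using ij False by (intro sum.cong) (auto simp: companion_def)
    finally show ?thesis using N by simp
  qed
  also have "\<dots> = (companion N x * vandermonde N x) $$ (i, j)"
    using ij by (subst index_mult_mat_sum[of _ N N _ N]) (auto simp: vandermonde_def)
  finally show "(vandermonde N x * mat_diag N x) $$ (i, j) = (companion N x * vandermonde N x) $$ (i, j)" .
qed (auto simp: companion_def vandermonde_def mat_diag_def)

lemma unit_row_mult_vandermonde: "N > 0 \<Longrightarrow> unit_row N * vandermonde N x = ones N"
proof (rule eq_matI)
  fix i j assume "N > 0" "i < dim_row (ones N)" "j < dim_col (ones N)"
  then have ij: "i = 0" "j < N" by auto
  then have "(unit_row N * vandermonde N x) $$ (i, j) =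
      (\<Sum>l<N. unit_row N $$ (0, l) * vandermonde N x $$ (l, j))"
    by (simp only:) (rule index_mult_mat_sum[of _ 1 N _ N], auto)
  also have "\<dots> = (\<Sum>l<N. if l = 0 then 1 else 0)"
    using ij by (intro sum.cong) (auto simp: unit_row_def vandermonde_def)
  finally show "(unit_row N * vandermonde N x) $$ (i, j) = ones N $$ (i, j)"
    using ij \<open>N > 0\<close> by simp
qed (auto simp: unit_row_def vandermonde_def)

text \<open>The Vandermonde matrix conjugates a diagonal matrix with cyclic row vector to companion form.\<close>

lemma peval_diag_eq_companion:
  assumes h: "h \<in> H_set N 1 k" and N: "N > 0" and x: "inj_on x {..<N}"
  shows "peval h (mat_diag N x) (ones N) =
    det (vandermonde N x) ^ k * peval h (companion N x) (unit_row N)"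
proof -
  let ?V = "vandermonde N x"
  obtain W where W: "W \<in> carrier_mat N N" "?V * W = 1\<^sub>m N" "W * ?V = 1\<^sub>m N"
    using det_non_zero_imp_unit[OF vandermonde_carrier det_vandermonde_nonzero[OF x], of "()"]
    by (auto simp: Units_def ring_mat_def)
  have "?V * mat_diag N x * W = companion N x * (?V * W)"
    unfolding vandermonde_mult_diag using W(1) by (intro assoc_mult_mat[of _ N N _ N _ N]) auto
  then have C: "?V * mat_diag N x * W = companion N x"
    using W(2) right_mult_one_mat[OF companion_carrier] by simp
  have "ones N * W = unit_row N * (?V * W)"
    unfolding unit_row_mult_vandermonde[OF N, symmetric, of x]
    using W(1) by (intro assoc_mult_mat[of _ 1 N _ N _ N]) auto
  then have R: "ones N * W = unit_row N" using W(2) right_mult_one_mat[OF unit_row_carrier(1)] by simp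
  have "peval h (companion N x) (unit_row N) = det W ^ k * peval h (mat_diag N x) (ones N)"
    using peval_conjugate[OF h vandermonde_carrier W, of "mat_diag N x" "ones N"]
    unfolding C R by simp
  moreover have "det ?V * det W = 1"
    using W by (metis det_mult det_one vandermonde_carrier)
  then have "det ?V ^ k * det W ^ k = 1" by (simp flip: power_mult_distrib)
  ultimately show ?thesis by (simp flip: mult.assoc)
qed

lemma det_vandermonde_permute:
  assumes "\<sigma> permutes {0..<N}"
  shows "det (vandermonde N (\<lambda>i. x (\<sigma> i))) = signof \<sigma> * det (vandermonde N x)"
proof -
  have "det (transpose_mat (vandermonde N (\<lambda>i. x (\<sigma> i)))) =
      det (mat N N (\<lambda>(i, j). transpose_mat (vandermonde N x) $$ (\<sigma> i, j)))"
    using permutes_in_image[OF assms]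
    by (intro arg_cong[of _ _ det] eq_matI) (auto simp: vandermonde_def)
  also have "\<dots> = signof \<sigma> * det (transpose_mat (vandermonde N x))"
    using assms by (intro det_permute_rows) (auto simp: vandermonde_def)
  finally show ?thesis by (simp add: det_transpose[OF vandermonde_carrier])
qed

lemma companion_cong:
  "(\<And>r. elem_sym y {..<N} r = elem_sym z {..<N} r) \<Longrightarrow> companion N y = companion N z"
  by (rule eq_matI) (auto simp: companion_def)

lemma companion_permute:
  "\<sigma> permutes {0..<N} \<Longrightarrow> companion N (\<lambda>i. x (\<sigma> i)) = companion N x"
  by (intro companion_cong elem_sym_permute) (auto simp: lessThan_atLeast0)

text \<open>At distinct eigenvalues, \<open>h\<close> is the k-th power of the Vandermonde
  determinant times a symmetric polynomial. One Vandermonde factor stays with the symmetric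
  polynomial; the product is alternating, hence a combination of alternants, and these supply the
  exponents of the last block. The other k - 1 factors come from blocks with exponents 0, ..., N -
  1.\<close>

lemma level_rank_surj:
  assumes k: "k > 0" and N: "N > 0" and h: "h \<in> H_set N 1 k"
  shows "\<exists>f\<in>H_set (k * N) k 1. level_rank k N f = h"
proof -
  note hr = H_set_poly_ring[OF h]
  let ?y = "\<lambda>j. Var (XE j 0)"
  \<comment> \<open>The alternating polynomial, in formal eigenvalues \<open>XE j 0\<close>.\<close>
  define F where "F = det (mat N N (\<lambda>(i, j). ?y j ^ i)) * eval_at h (companion N ?y) (unit_row N)"
  have evF: "ev F w = det (vandermonde N (\<lambda>j. w (XE j 0))) * peval h (companion N (\<lambda>j. w (XE j 0))) (unit_row N)" for w
  proof -
    have sgn: "ev ((- 1) ^ n) w = (- 1) ^ n" for n by (simp only: ev_power ev_uminus ev_1)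
    have 1: "map_mat (\<lambda>f. ev f w) (companion N ?y) = companion N (\<lambda>j. w (XE j 0))"
      by (rule eq_matI) (auto simp: companion_def elem_sym_def sgn simp del: ev_power)
    have 2: "map_mat (\<lambda>f. ev f w) (unit_row N) = unit_row N"
      by (rule eq_matI) (auto simp: unit_row_def)
    have 3: "map_mat (\<lambda>f. ev f w) (mat N N (\<lambda>(i, j). ?y j ^ i)) = vandermonde N (\<lambda>j. w (XE j 0))"
      by (rule eq_matI) (auto simp: vandermonde_def)
    have "ev (det (mat N N (\<lambda>(i, j). ?y j ^ i))) w = det (vandermonde N (\<lambda>j. w (XE j 0)))"
      unfolding 3[symmetric] by (rule ev_hom.hom_det[symmetric])
    then show ?thesis
      unfolding F_def ev_mult by (simp add: ev_eval_at[OF hr companion_carrier unit_row_carrier(1)] 1 2)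
  qed
  define Z where "Z = (\<lambda>j. XE j 0) ` {..<N}"
  \<comment> \<open>At an assignment that is 0 off \<open>Z\<close>, all monomials of
    \<open>F\<close> with a variable outside \<open>Z\<close> vanish; so only those in
    \<open>K\<close> enter the expansion of \<open>\<Phi>\<close>.\<close>
  define K where "K = {m \<in> Poly_Mapping.keys F. Poly_Mapping.keys m \<subseteq> Z}"
  define e where "e = (\<lambda>(m::entry \<Rightarrow>\<^sub>0 nat) j. Poly_Mapping.lookup m (XE j 0))"
  define \<Phi> where "\<Phi> = (\<lambda>x. det (vandermonde N x) * peval h (companion N x) (unit_row N))"
  have \<Phi>: "\<Phi> x = (\<Sum>m\<in>K. Poly_Mapping.lookup F m * (\<Prod>j<N. x j ^ e m j))" for x
  proof -
    define w where "w = (\<lambda>v. case v of XE j i \<Rightarrow> if i = 0 \<and> j < N then x j else 0 | AE _ _ \<Rightarrow> 0)"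
    have wx: "w (XE j 0) = x j" if "j < N" for j using that by (simp add: w_def)
    have "vandermonde N (\<lambda>j. w (XE j 0)) = vandermonde N x"
      by (rule eq_matI) (auto simp: vandermonde_def wx)
    moreover have "elem_sym (\<lambda>j. w (XE j 0)) {..<N} r = elem_sym x {..<N} r" for r
      unfolding elem_sym_def by (intro sum.cong prod.cong) (auto simp: wx)
    then have "companion N (\<lambda>j. w (XE j 0)) = companion N x" by (rule companion_cong)
    ultimately have "\<Phi> x = ev F w" by (simp add: \<Phi>_def evF)
    also have "\<dots> = (\<Sum>m\<in>K. Poly_Mapping.lookup F m * monom_at w m)"
      unfolding ev_def
    proof (rule sum.mono_neutral_right)
      show "\<forall>m\<in>Poly_Mapping.keys F - K. Poly_Mapping.lookup F m * monom_at w m = 0"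
      proof
        fix m assume "m \<in> Poly_Mapping.keys F - K"
        then obtain v where v: "v \<in> Poly_Mapping.keys m" "v \<notin> Z" by (auto simp: K_def)
        then have "w v = 0" by (auto simp: w_def Z_def split: entry.splits)
        then have "monom_at w m = 0" using v(1) by (auto simp: monom_at_def in_keys_iff intro!: prod_zero bexI[of _ v])
        then show "Poly_Mapping.lookup F m * monom_at w m = 0" by simp
      qed
    qed (auto simp: K_def)
    also have "\<dots> = (\<Sum>m\<in>K. Poly_Mapping.lookup F m * (\<Prod>j<N. x j ^ e m j))"
    proof (rule sum.cong[OF refl])
      fix m assume "m \<in> K"
      then have "monom_at w m = (\<Prod>v\<in>Z. w v ^ Poly_Mapping.lookup m v)"
        by (intro monom_at_superset) (auto simp: K_def Z_def)
      also have "\<dots> = (\<Prod>j<N. x j ^ e m j)"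
        unfolding Z_def by (subst prod.reindex) (auto simp: inj_on_def wx e_def)
      finally show "Poly_Mapping.lookup F m * monom_at w m = Poly_Mapping.lookup F m * (\<Prod>j<N. x j ^ e m j)"
        by simp
    qed
    finally show ?thesis .
  qed
  \<comment> \<open>As \<open>\<Phi>\<close> is alternating, summing over all permutations with
    signs multiplies it by N! and turns each monomial into an alternant.\<close>
  have alt: "fact N * \<Phi> x = (\<Sum>m\<in>K. Poly_Mapping.lookup F m * alternant N (e m) x)" for x
  proof -
    let ?S = "{\<sigma>. \<sigma> permutes {0..<N}}"
    have "fact N * \<Phi> x = (\<Sum>\<sigma>\<in>?S. \<Phi> x)" by (simp add: card_permutations)
    also have "\<dots> = (\<Sum>\<sigma>\<in>?S. signof \<sigma> * \<Phi> (\<lambda>i. x (\<sigma> i)))"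
      by (intro sum.cong refl) (simp add: \<Phi>_def det_vandermonde_permute companion_permute sign_def)
    also have "\<dots> = (\<Sum>\<sigma>\<in>?S. \<Sum>m\<in>K. Poly_Mapping.lookup F m * (signof \<sigma> * (\<Prod>j<N. x (\<sigma> j) ^ e m j)))"
      unfolding \<Phi> sum_distrib_left by (intro sum.cong refl) (simp add: mult_ac)
    also have "\<dots> = (\<Sum>m\<in>K. Poly_Mapping.lookup F m * alternant N (e m) x)"
      unfolding alternant_eq_sum_rows sum_distrib_left by (rule sum.swap)
    finally show ?thesis .
  qed
  define \<nu> where "\<nu> = (\<lambda>m i. if i mod k = k - 1 then e m (i div k) else i div k)"
  define f where "f = (\<Sum>m\<in>K. Const (Poly_Mapping.lookup F m / fact N) * std_det k N (\<nu> m))"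
  have f: "f \<in> H_set (k * N) k 1"
    unfolding f_def by (intro H_set_sum H_set_Const std_det_H_set k)
  have "level_rank k N f - h = 0"
  proof (rule H_set_row_eq_0I[OF H_set_diff[OF level_rank_H_set[OF k f] h]])
    fix x :: "nat \<Rightarrow> complex" assume x: "inj_on x {..<N}"
    have "peval (level_rank k N f) (mat_diag N x) (ones N) =
        (\<Sum>m\<in>K. Poly_Mapping.lookup F m / fact N * peval (level_rank k N (std_det k N (\<nu> m))) (mat_diag N x) (ones N))"
      by (simp add: peval_level_rank[OF H_set_poly_ring[OF f]]
          peval_level_rank[OF H_set_poly_ring[OF std_det_H_set[OF k]]]) (simp add: f_def)
    also have "\<dots> = (\<Sum>m\<in>K. Poly_Mapping.lookup F m / fact N *
        (det (vandermonde N x) ^ (k - 1) * alternant N (e m) x))"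
    proof (intro sum.cong refl)
      fix m
      have "(\<lambda>s. \<nu> m (s * k + (k - 1))) = e m"
        using k div_mod_last[OF k] by (auto simp: \<nu>_def)
      moreover have "peval (level_rank k N (std_det k N (\<nu> m))) (mat_diag N x) (ones N) =
          det (vandermonde N x) ^ (k - 1) * alternant N (\<lambda>s. \<nu> m (s * k + (k - 1))) x"
        by (rule level_rank_std_det_last[OF k]) (simp add: \<nu>_def)
      ultimately show "Poly_Mapping.lookup F m / fact N *
          peval (level_rank k N (std_det k N (\<nu> m))) (mat_diag N x) (ones N) =
        Poly_Mapping.lookup F m / fact N * (det (vandermonde N x) ^ (k - 1) * alternant N (e m) x)"
        by simp
    qed
    also have "\<dots> = det (vandermonde N x) ^ (k - 1) / fact N *
        (\<Sum>m\<in>K. Poly_Mapping.lookup F m * alternant N (e m) x)"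
      unfolding sum_distrib_left by (intro sum.cong refl) simp
    also have "\<dots> = det (vandermonde N x) ^ (k - 1) * \<Phi> x" unfolding alt[symmetric] by simp
    also have "\<dots> = det (vandermonde N x) ^ k * peval h (companion N x) (unit_row N)"
      using k by (simp add: \<Phi>_def power_eq_if[of _ k])
    also have "\<dots> = peval h (mat_diag N x) (ones N)"
      by (rule peval_diag_eq_companion[OF h N x, symmetric])
    finally show "peval (level_rank k N f - h) (mat_diag N x) (ones N) = 0" by simp
  qed
  then show ?thesis using f by (intro bexI[of _ f]) auto
qed

theorem corollary5p13:
  fixes k N :: nat
  assumes "k > 0" and "N > 0"
  shows "vs_isomorphism class_ring (coinvariants k N) (H_space N 1 k) (reduced_level_rank k N)"
proof -
  have "reduced_level_rank k N = (\<lambda>C. the_elem (level_rank k N ` C))"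
    by (simp add: fun_eq_iff reduced_level_rank_def)
  moreover have "vs_isomorphism class_ring (quotient_space (H_space (k * N) k 1) (sl_image (k * N) k 1))
      (H_space N 1 k) (\<lambda>C. the_elem (level_rank k N ` C))"
    using assms
    by (intro vs_isomorphism_quotient level_rank_H_set level_rank_add level_rank_Const
        level_rank_surj level_rank_kernel) (auto intro: H_set_poly_ring)
  ultimately show ?thesis by (simp add: coinvariants_def)
qed

end
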